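(* Let $h$ be a boundary function, and suppose that either (1) (Poly-$R_1$) and $\mathbf{HK}^h_B$ hold, or (2) (Poly-$\infty$) and $\mathbf{HK}^h_U$ hold. Let $G_D(x,y):=\int_0^\infty q(t,x,y)\,dt$ be the Green function of $X$. Then for $x,y\in D$, $x\neq y$, $$G_D(x,y)\simeq\frac{C_0}{V(x,\rho(x,y))\Psi(\rho(x,y))}\int_0^{\Phi(\rho(x,y))}\frac{h(s,x,y)}{\phi(1/s)}\,ds+\int_{\Phi(\rho(x,y))}^{2\Phi(\mathrm{diam}(D))}\frac{h(s,x,y)}{s\,V(x,\Phi^{-1}(s))\,\phi(1/s)}\,ds$$ (where $2\Phi(\mathrm{diam}(D))=\infty$ if $D$ is unbounded, and the estimate is understood in $[0,\infty]$).
   Context: Notation: $a\wedge b=\min$, $a\vee b=\max$; $f\simeq g$ means $c_1g\le f\le c_2g$ on the specified range for some constants $c_1,c_2>0$. Quotients $c/0$ with $c>0$ are $+\infty$. Subordinator: $S=(S_t)_{t\ge0}$ is a driftless subordinator (non-decreasing pure-jump Lévy process, $S_0=0$) with Laplace exponent $\phi(\lambda)=-\log\mathbb{E}e^{-\lambda S_1}=\int_0^\infty(1-e^{-\lambda s})\nu(ds)$ and $w(r):=\nu(r,\infty)$. Condition (Poly-$R_1$), $R_1\in(0,\infty]$: there are constants $c_1,c_2>0$, $\beta_2\ge\beta_1>0$ with $c_1(R/r)^{\beta_1}\le w(r)/w(R)\le c_2(R/r)^{\beta_2}$ for all $0<r\le R<R_1$. (Poly-$\infty$) is the case $R_1=\infty$.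 Space and process: $(E,\rho)$ is a locally compact separable metric space in which all bounded closed sets are compact, $m$ is a positive Radon measure on $E$ with full support, $B(x,r)$ is the open ball, $V(x,r)=m(B(x,r))$. There are $R_E\in(0,\infty]$ and $d_2\ge d_1>0$ such that for every $a\ge1$ there is $C_V\ge1$ with $C_V^{-1}(R/r)^{d_1}\le V(x,R)/V(x,r)\le C_V(R/r)^{d_2}$ for all $x\in E$, $0<r\le R<aR_E$. $D\subset E$ is a proper open subset. $Y^D$ is a Hunt process in $D$ independent of $S$ whose semigroup has a density (heat kernel) $p_D(t,x,y)$ with respect to $m$; $X_t=Y^D_{S_t}$ has heat kernel $q(t,x,y)=\int_0^\infty p_D(s,x,y)\mathbb{P}(S_t\in ds)$. Scale functions: $\Phi,\Psi:[0,\infty)\to[0,\infty)$ are strictly increasing, $\Psi\ge\Phi$, and for some constants $\alpha_1,\dots,\alpha_4,c_1,\dots,c_4>0$ and all $R\ge r>0$: $c_1(R/r)^{\alpha_1}\le\Phi(R)/\Phi(r)\le c_2(R/r)^{\alpha_2}$ and $c_3(R/r)^{\alpha_3}\le\Psi(R)/\Psi(r)\le c_4(R/r)^{\alpha_4}$. If $D$ is unbounded, $\Phi(\mathrm{diam}(D))$ is read as $\infty$. Boundary function: $h:(0,\infty)\times D\times D\to[0,1]$ such that (H1) $s\mapsto h(s,x,y)$ is non-increasing for all $x,y\in D$; (H2) there are $c_1>0$, $\gamma\ge0$ with $s^\gamma h(s,x,y)\le c_1t^\gamma h(t,x,y)$ for $0<s\le t<4\Phi(\mathrm{diam}(D))+1$,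 $x,y\in D$. Heat kernel conditions: for $C_0\in\{0,1\}$ and $c>0$ put $$I_{c}(t,x,y)=\frac1{V(x,\Phi^{-1}(t))}\wedge\Big(\frac{C_0t}{V(x,\rho(x,y))\Psi(\rho(x,y))}+\frac1{V(x,\Phi^{-1}(t))}\exp\Big(-\frac{c\,\rho(x,y)^2}{\Phi^{-1}(t)^2}\Big)\Big)$$ (the first summand is absent if $C_0=0$). $\mathbf{HK}^h_B$: $D$ is bounded; (i) there are $C_0\in\{0,1\}$ and $c_1,c_2,c_3,c_4>0$ with $c_1h(t,x,y)I_{c_2}(t,x,y)\le p_D(t,x,y)\le c_3h(t,x,y)I_{c_4}(t,x,y)$ for all $(t,x,y)\in(0,1]\times D\times D$; (ii) there is $\lambda_D>0$ with $p_D(t,x,y)\simeq e^{-\lambda_Dt}h(1,x,y)$ for $(t,x,y)\in[1,\infty)\times D\times D$. $\mathbf{HK}^h_U$: $R_E=\infty$ and the two-sided estimate in (i) holds for all $(t,x,y)\in(0,\infty)\times D\times D$. The constant $C_0$ in the claim is the one in these conditions. Standing convention: when (Poly-$R_1$) and $\mathbf{HK}^h_B$ hold, $\Phi$ is normalized (by multiplication by a constant) so that $\Phi(\mathrm{diam}(D))<R_1/8$.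
   Formalization: The heat kernel p_D is taken to be jointly measurable and to satisfy the Chapman–Kolmogorov identity at every pair of points; for densities fixed only almost everywhere the estimate can fail at single pairs in case (2) with D bounded. *)

theory Defs
  imports "HOL-Probability.Probability"
begin

section \<open>The state space\<close>

text \<open>
  The space \<open>E\<close> is the whole type, of class \<open>heine_borel\<close> (a metric space in which bounded
  closed sets are compact, hence locally compact) and \<open>second_countable_topology\<close> (for metric
  spaces: separable).
\<close>

definition radon_measure :: "'a::topological_space measure \<Rightarrow> bool" where
  "radon_measure m \<longleftrightarrow>
     sets m = sets borel \<and>
     (\<forall>K. compact K \<longrightarrow> emeasure m K < \<infinity>) \<and>
     (\<forall>A\<in>sets borel. emeasure m A = (SUP K\<in>{K. compact K \<and> K \<subseteq> A}. emeasure m K))"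

definition full_support :: "'a::topological_space measure \<Rightarrow> bool" where
  "full_support m \<longleftrightarrow> (\<forall>U. open U \<and> U \<noteq> {} \<longrightarrow> emeasure m U > 0)"

definition vol :: "'a::metric_space measure \<Rightarrow> 'a \<Rightarrow> real \<Rightarrow> real" where
  "vol m x r = measure m (ball x r)"

definition volume_growth :: "'a::metric_space measure \<Rightarrow> ereal \<Rightarrow> real \<Rightarrow> real \<Rightarrow> bool" where
  "volume_growth m R_E d1 d2 \<longleftrightarrow>
     0 < R_E \<and> 0 < d1 \<and> d1 \<le> d2 \<and>
     (\<forall>a\<ge>1. \<exists>C\<ge>1. \<forall>x r R. 0 < r \<and> r \<le> R \<and> ereal R < ereal a * R_E \<longrightarrow>
        (R / r) powr d1 / C \<le> vol m x R / vol m x r \<and>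
        vol m x R / vol m x r \<le> C * (R / r) powr d2)"


section \<open>Subordinators\<close>

definition subordinator :: "'v measure \<Rightarrow> (real \<Rightarrow> 'v \<Rightarrow> real) \<Rightarrow> bool" where
  "subordinator M S \<longleftrightarrow>
     prob_space M \<and>
     (\<forall>t\<ge>0. S t \<in> borel_measurable M) \<and>
     (AE \<omega> in M. S 0 \<omega> = 0) \<and>
     (AE \<omega> in M. mono_on {0..} (\<lambda>t. S t \<omega>) \<and> (\<forall>t\<ge>0. continuous (at_right t) (\<lambda>t. S t \<omega>))) \<and>
     (\<forall>s\<ge>0. \<forall>t\<ge>0. distr M borel (\<lambda>\<omega>. S (s + t) \<omega> - S s \<omega>) = distr M borel (S t)) \<and>
     (\<forall>(n::nat) \<tau>. 0 \<le> \<tau> 0 \<and> mono \<tau> \<longrightarrow>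
        prob_space.indep_vars M (\<lambda>_. borel) (\<lambda>i \<omega>. S (\<tau> (Suc i)) \<omega> - S (\<tau> i) \<omega>) {..<n})"

definition laplace_exponent :: "'v measure \<Rightarrow> (real \<Rightarrow> 'v \<Rightarrow> real) \<Rightarrow> real \<Rightarrow> real" where
  "laplace_exponent M S u = - ln (\<integral>\<omega>. exp (- u * S 1 \<omega>) \<partial>M)"

text \<open>The Levy measure of a subordinator, viewed as a measure on the line carried by \<open>(0,\<infinity>)\<close>.\<close>

definition subordinator_levy_measure :: "real measure \<Rightarrow> bool" where
  "subordinator_levy_measure \<nu> \<longleftrightarrow>
     sets \<nu> = sets borel \<and> emeasure \<nu> {..0} = 0 \<and> (\<integral>\<^sup>+s. ennreal (min 1 s) \<partial>\<nu>) < \<infinity>"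

definition driftless_subordinator ::
    "'v measure \<Rightarrow> (real \<Rightarrow> 'v \<Rightarrow> real) \<Rightarrow> real measure \<Rightarrow> bool" where
  "driftless_subordinator M S \<nu> \<longleftrightarrow>
     subordinator M S \<and> subordinator_levy_measure \<nu> \<and>
     (\<forall>u\<ge>0. laplace_exponent M S u = (\<integral>s. (1 - exp (- u * s)) \<partial>\<nu>))"

definition tail :: "real measure \<Rightarrow> real \<Rightarrow> real" where
  "tail \<nu> r = measure \<nu> {r<..}"

text \<open>
  The tail of a Levy measure is finite. If \<open>tail \<nu> R = 0\<close>, the quotient below is \<open>0\<close> in HOL, so the
  lower bound fails: the condition includes \<open>tail \<nu> R > 0\<close> for all \<open>R < R\<^sub>1\<close>.
\<close>

definition Poly_cond :: "real measure \<Rightarrow> ereal \<Rightarrow> bool" where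
  "Poly_cond \<nu> R\<^sub>1 \<longleftrightarrow>
     (\<exists>c1>0. \<exists>c2>0. \<exists>\<beta>1>0. \<exists>\<beta>2\<ge>\<beta>1. \<forall>r R. 0 < r \<and> r \<le> R \<and> ereal R < R\<^sub>1 \<longrightarrow>
        c1 * (R / r) powr \<beta>1 \<le> tail \<nu> r / tail \<nu> R \<and>
        tail \<nu> r / tail \<nu> R \<le> c2 * (R / r) powr \<beta>2)"


section \<open>Hunt processes and heat kernels\<close>

text \<open>
  The process lives on \<open>D\<close> with a cemetery \<open>None\<close> adjoined as the point at infinity (an isolated
  point if \<open>D\<close> is compact).
\<close>

definition cemetery_top :: "'a::topological_space set \<Rightarrow> 'a option topology" where
  "cemetery_top D = Alexandroff_compactification (top_of_set D)"

definition cemetery_borel :: "'a::topological_space set \<Rightarrow> 'a option measure" where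
  "cemetery_borel D = sigma (topspace (cemetery_top D)) {U. openin (cemetery_top D) U}"

text \<open>
  A process is given by a sample space \<open>\<Omega>\<close> with a family \<open>P\<close> of laws indexed by the starting point
  and the coordinates \<open>Y t\<close>. The strong Markov property and quasi-left-continuity are stated for the
  right-continuous natural filtration: a time \<open>T\<close> is a stopping time of it iff \<open>{T < t}\<close> belongs to
  the natural \<open>\<sigma>\<close>-algebra at time \<open>t\<close> for all \<open>t\<close>. Null-set augmentation adds nothing, as a stopping
  time of the augmented filtration is almost surely equal to one of this kind. General initial laws
  reduce to point masses by integration.
\<close>

definition natural_sigma :: "'a::topological_space set \<Rightarrow> 'w set \<Rightarrow> (real \<Rightarrow> 'w \<Rightarrow> 'a option) \<Rightarrow> real \<Rightarrow> 'w measure" where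
  "natural_sigma D \<Omega> Y t =
     sigma \<Omega> {Y s -` A \<inter> \<Omega> | s A. 0 \<le> s \<and> s \<le> t \<and> A \<in> sets (cemetery_borel D)}"

definition optional_time ::
    "'a::topological_space set \<Rightarrow> 'w set \<Rightarrow> (real \<Rightarrow> 'w \<Rightarrow> 'a option) \<Rightarrow> ('w \<Rightarrow> ennreal) \<Rightarrow> bool" where
  "optional_time D \<Omega> Y T \<longleftrightarrow>
     (\<forall>t\<ge>0. {\<omega>\<in>\<Omega>. T \<omega> < ennreal t} \<in> sets (natural_sigma D \<Omega> Y t))"

definition optional_events ::
    "'a::topological_space set \<Rightarrow> 'w set \<Rightarrow> (real \<Rightarrow> 'w \<Rightarrow> 'a option) \<Rightarrow> ('w \<Rightarrow> ennreal) \<Rightarrow> 'w set set" where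
  "optional_events D \<Omega> Y T =
     {\<Lambda>. \<Lambda> \<subseteq> \<Omega> \<and> (\<forall>t\<ge>0. {\<omega>\<in>\<Lambda>. T \<omega> < ennreal t} \<in> sets (natural_sigma D \<Omega> Y t))}"

definition hunt_process ::
    "'a::topological_space set \<Rightarrow> 'w measure \<Rightarrow> ('a option \<Rightarrow> 'w measure) \<Rightarrow> (real \<Rightarrow> 'w \<Rightarrow> 'a option) \<Rightarrow> bool" where
  "hunt_process D W P Y \<longleftrightarrow>
     (\<forall>x\<in>topspace (cemetery_top D). prob_space (P x) \<and> sets (P x) = sets W) \<and>
     (\<forall>t\<ge>0. Y t \<in> measurable W (cemetery_borel D)) \<and>
     (\<forall>t\<ge>0. \<forall>A\<in>sets (cemetery_borel D).
        (\<lambda>x. emeasure (P x) {\<omega>\<in>space W. Y t \<omega> \<in> A}) \<in> borel_measurable (cemetery_borel D)) \<and>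
     (\<forall>x\<in>topspace (cemetery_top D). AE \<omega> in P x. Y 0 \<omega> = x) \<and>
     (\<forall>\<omega>\<in>space W. \<forall>s\<ge>0. \<forall>t\<ge>s. Y s \<omega> = None \<longrightarrow> Y t \<omega> = None) \<and>
     (\<forall>\<omega>\<in>space W. \<forall>t\<ge>0. limitin (cemetery_top D) (\<lambda>s. Y s \<omega>) (Y t \<omega>) (at_right t)) \<and>
     (\<forall>\<omega>\<in>space W. \<forall>t>0. \<exists>l. limitin (cemetery_top D) (\<lambda>s. Y s \<omega>) l (at_left t)) \<and>
     \<comment> \<open>strong Markov property\<close>
     (\<forall>x\<in>topspace (cemetery_top D). \<forall>T. optional_time D (space W) Y T \<longrightarrow>
        (\<forall>\<Lambda>\<in>optional_events D (space W) Y T. \<forall>s\<ge>0. \<forall>A\<in>sets (cemetery_borel D).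
           emeasure (P x) {\<omega>\<in>\<Lambda>. T \<omega> < \<infinity> \<and> Y (enn2real (T \<omega>) + s) \<omega> \<in> A} =
           (\<integral>\<^sup>+\<omega>\<in>{\<omega>\<in>\<Lambda>. T \<omega> < \<infinity>}.
              emeasure (P (Y (enn2real (T \<omega>)) \<omega>)) {\<eta>\<in>space W. Y s \<eta> \<in> A} \<partial>P x))) \<and>
     \<comment> \<open>quasi-left-continuity\<close>
     (\<forall>x\<in>topspace (cemetery_top D). \<forall>T.
        (\<forall>n::nat. optional_time D (space W) Y (T n)) \<and> (\<forall>\<omega>\<in>space W. incseq (\<lambda>n. T n \<omega>)) \<longrightarrow>
        (AE \<omega> in P x. (SUP n. T n \<omega>) < \<infinity> \<longrightarrow>
           limitin (cemetery_top D) (\<lambda>n. Y (enn2real (T n \<omega>)) \<omega>)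
             (Y (enn2real (SUP n. T n \<omega>)) \<omega>) sequentially))"

text \<open>
  A heat kernel is a jointly measurable transition density with respect to \<open>m\<close> that satisfies the
  Chapman-Kolmogorov equation at every point. (The bare density property determines the kernel only
  up to null sets and yields the equation only almost everywhere in the last variable.)
\<close>

definition heat_kernel ::
    "'a::topological_space set \<Rightarrow> 'a measure \<Rightarrow> 'w measure \<Rightarrow> ('a option \<Rightarrow> 'w measure) \<Rightarrow>
     (real \<Rightarrow> 'w \<Rightarrow> 'a option) \<Rightarrow> (real \<Rightarrow> 'a \<Rightarrow> 'a \<Rightarrow> ennreal) \<Rightarrow> bool" where
  "heat_kernel D m W P Y p \<longleftrightarrow>
     (\<lambda>(t, x, y). p t x y) \<in> borel_measurable (restrict_space borel ({0<..} \<times> D \<times> D)) \<and>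
     (\<forall>t>0. \<forall>x\<in>D. \<forall>A\<in>sets borel. A \<subseteq> D \<longrightarrow>
        emeasure (P (Some x)) {\<omega>\<in>space W. Y t \<omega> \<in> Some ` A} = (\<integral>\<^sup>+y\<in>A. p t x y \<partial>m)) \<and>
     (\<forall>s>0. \<forall>t>0. \<forall>x\<in>D. \<forall>y\<in>D. p (s + t) x y = (\<integral>\<^sup>+z\<in>D. p s x z * p t z y \<partial>m))"

text \<open>
  The heat kernel of \<open>X\<^sub>t = Y (S\<^sub>t)\<close>, with \<open>Y\<close> and \<open>S\<close> independent, i.e. realised on the product of
  their sample spaces. The integral is over \<open>(0,\<infinity>)\<close>, as \<open>p\<close> is a kernel for positive times only;
  \<open>S\<^sub>t > 0\<close> holds almost surely for \<open>t > 0\<close> if the Levy measure is infinite, as it is under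
  \<open>Poly_cond\<close>.
\<close>

definition subordinate_kernel ::
    "'v measure \<Rightarrow> (real \<Rightarrow> 'v \<Rightarrow> real) \<Rightarrow> (real \<Rightarrow> 'a \<Rightarrow> 'a \<Rightarrow> ennreal) \<Rightarrow> real \<Rightarrow> 'a \<Rightarrow> 'a \<Rightarrow> ennreal" where
  "subordinate_kernel M S p t x y = (\<integral>\<^sup>+s\<in>{0<..}. p s x y \<partial>distr M borel (S t))"

definition green_function :: "(real \<Rightarrow> 'a \<Rightarrow> 'a \<Rightarrow> ennreal) \<Rightarrow> 'a \<Rightarrow> 'a \<Rightarrow> ennreal" where
  "green_function q x y = (\<integral>\<^sup>+t\<in>{0<..}. q t x y \<partial>lborel)"


section \<open>Scale functions, boundary functions and heat kernel estimates\<close>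

definition scale_function :: "(real \<Rightarrow> real) \<Rightarrow> bool" where
  "scale_function \<Phi> \<longleftrightarrow>
     (\<forall>r\<ge>0. 0 \<le> \<Phi> r) \<and> strict_mono_on {0..} \<Phi> \<and>
     (\<exists>a1>0. \<exists>a2>0. \<exists>c1>0. \<exists>c2>0. \<forall>r R. 0 < r \<and> r \<le> R \<longrightarrow>
        c1 * (R / r) powr a1 \<le> \<Phi> R / \<Phi> r \<and> \<Phi> R / \<Phi> r \<le> c2 * (R / r) powr a2)"

text \<open>
  A scale function need not be continuous, so its inverse is the right-continuous generalized one;
  it is the usual inverse if \<open>\<Phi>\<close> maps \<open>[0,\<infinity>)\<close> onto itself.
\<close>

definition scale_inv :: "(real \<Rightarrow> real) \<Rightarrow> real \<Rightarrow> real" where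
  "scale_inv \<Phi> t = Inf {r. 0 \<le> r \<and> t < \<Phi> r}"

definition scale_diam :: "(real \<Rightarrow> real) \<Rightarrow> 'a::metric_space set \<Rightarrow> ereal" where
  "scale_diam \<Phi> D = (if bounded D then ereal (\<Phi> (diameter D)) else \<infinity>)"

definition boundary_function ::
    "(real \<Rightarrow> real) \<Rightarrow> 'a::metric_space set \<Rightarrow> (real \<Rightarrow> 'a \<Rightarrow> 'a \<Rightarrow> real) \<Rightarrow> bool" where
  "boundary_function \<Phi> D h \<longleftrightarrow>
     (\<forall>s>0. \<forall>x\<in>D. \<forall>y\<in>D. 0 \<le> h s x y \<and> h s x y \<le> 1) \<and>
     (\<forall>x\<in>D. \<forall>y\<in>D. \<forall>s t. 0 < s \<and> s \<le> t \<longrightarrow> h t x y \<le> h s x y) \<and>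
     (\<exists>c1>0. \<exists>\<gamma>\<ge>0. \<forall>s t. 0 < s \<and> s \<le> t \<and> ereal t < 4 * scale_diam \<Phi> D + 1 \<longrightarrow>
        (\<forall>x\<in>D. \<forall>y\<in>D. s powr \<gamma> * h s x y \<le> c1 * (t powr \<gamma> * h t x y)))"

text \<open>
  Quotients are taken in \<open>ennreal\<close>, where \<open>c / 0 = \<infinity>\<close> for \<open>c > 0\<close> and \<open>0 / 0 = 0\<close>. Hence on the
  diagonal the first summand is \<open>\<infinity>\<close> if \<open>C0 = 1\<close>, and it vanishes everywhere if \<open>C0 = 0\<close>.
\<close>

definition kernel_profile ::
    "'a::metric_space measure \<Rightarrow> (real \<Rightarrow> real) \<Rightarrow> (real \<Rightarrow> real) \<Rightarrow> real \<Rightarrow> real \<Rightarrow> real \<Rightarrow> 'a \<Rightarrow> 'a \<Rightarrow> ennreal" where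
  "kernel_profile m \<Phi> \<Psi> C0 c t x y =
     min (1 / ennreal (vol m x (scale_inv \<Phi> t)))
         (ennreal (C0 * t) / ennreal (vol m x (dist x y) * \<Psi> (dist x y)) +
          1 / ennreal (vol m x (scale_inv \<Phi> t)) *
            ennreal (exp (- (c * (dist x y)\<^sup>2 / (scale_inv \<Phi> t)\<^sup>2))))"

definition kernel_bounds ::
    "'a::metric_space measure \<Rightarrow> (real \<Rightarrow> real) \<Rightarrow> (real \<Rightarrow> real) \<Rightarrow> 'a set \<Rightarrow> (real \<Rightarrow> 'a \<Rightarrow> 'a \<Rightarrow> real) \<Rightarrow>
     real \<Rightarrow> (real \<Rightarrow> 'a \<Rightarrow> 'a \<Rightarrow> ennreal) \<Rightarrow> real set \<Rightarrow> bool" where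
  "kernel_bounds m \<Phi> \<Psi> D h C0 p T \<longleftrightarrow>
     (\<exists>c1>0. \<exists>c2>0. \<exists>c3>0. \<exists>c4>0. \<forall>t\<in>T. \<forall>x\<in>D. \<forall>y\<in>D.
        ennreal (c1 * h t x y) * kernel_profile m \<Phi> \<Psi> C0 c2 t x y \<le> p t x y \<and>
        p t x y \<le> ennreal (c3 * h t x y) * kernel_profile m \<Phi> \<Psi> C0 c4 t x y)"

definition HK_B ::
    "'a::metric_space measure \<Rightarrow> (real \<Rightarrow> real) \<Rightarrow> (real \<Rightarrow> real) \<Rightarrow> 'a set \<Rightarrow> (real \<Rightarrow> 'a \<Rightarrow> 'a \<Rightarrow> real) \<Rightarrow>
     real \<Rightarrow> (real \<Rightarrow> 'a \<Rightarrow> 'a \<Rightarrow> ennreal) \<Rightarrow> bool" where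
  "HK_B m \<Phi> \<Psi> D h C0 p \<longleftrightarrow>
     bounded D \<and> kernel_bounds m \<Phi> \<Psi> D h C0 p {0<..1} \<and>
     (\<exists>\<kappa>>0. \<exists>c1>0. \<exists>c2>0. \<forall>t\<ge>1. \<forall>x\<in>D. \<forall>y\<in>D.
        ennreal (c1 * (exp (- \<kappa> * t) * h 1 x y)) \<le> p t x y \<and>
        p t x y \<le> ennreal (c2 * (exp (- \<kappa> * t) * h 1 x y)))"

definition HK_U ::
    "'a::metric_space measure \<Rightarrow> ereal \<Rightarrow> (real \<Rightarrow> real) \<Rightarrow> (real \<Rightarrow> real) \<Rightarrow> 'a set \<Rightarrow>
     (real \<Rightarrow> 'a \<Rightarrow> 'a \<Rightarrow> real) \<Rightarrow> real \<Rightarrow> (real \<Rightarrow> 'a \<Rightarrow> 'a \<Rightarrow> ennreal) \<Rightarrow> bool" where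
  "HK_U m R_E \<Phi> \<Psi> D h C0 p \<longleftrightarrow> R_E = \<infinity> \<and> kernel_bounds m \<Phi> \<Psi> D h C0 p {0<..}"

definition green_profile ::
    "'a::metric_space measure \<Rightarrow> (real \<Rightarrow> real) \<Rightarrow> (real \<Rightarrow> real) \<Rightarrow> (real \<Rightarrow> real) \<Rightarrow> 'a set \<Rightarrow>
     (real \<Rightarrow> 'a \<Rightarrow> 'a \<Rightarrow> real) \<Rightarrow> real \<Rightarrow> 'a \<Rightarrow> 'a \<Rightarrow> ennreal" where
  "green_profile m \<phi> \<Phi> \<Psi> D h C0 x y =
     ennreal C0 / ennreal (vol m x (dist x y) * \<Psi> (dist x y)) *
       (\<integral>\<^sup>+s\<in>{0<..<\<Phi> (dist x y)}. ennreal (h s x y) / ennreal (\<phi> (1 / s)) \<partial>lborel) +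
     (\<integral>\<^sup>+s\<in>{s. \<Phi> (dist x y) < s \<and> ereal s < 2 * scale_diam \<Phi> D}.
        ennreal (h s x y) / ennreal (s * vol m x (scale_inv \<Phi> s) * \<phi> (1 / s)) \<partial>lborel)"

end

theory Submission
  imports Defs
begin

text \<open>
  Let \<open>U(A) = \<integral>\<^sub>0\<^sup>\<infinity> P(S\<^sub>t \<in> A) dt\<close> be the potential measure of \<open>S\<close>. By Tonelli, the Green function is
  \<open>\<integral> p(s,x,y) U(ds)\<close> over \<open>(0,\<infinity>)\<close>, so two comparisons are needed: of \<open>U(ds)\<close> with
  \<open>ds / (s \<phi>(1/s))\<close>, and of \<open>p\<close> with an explicit function of time. Put \<open>\<rho> = dist x y\<close>.

  The potential measure. The Laplace transform of \<open>U\<close> is \<open>1/\<phi>\<close>. This alone shows that \<open>U(-\<infinity>,r]\<close> is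
  comparable to \<open>1/\<phi>(1/r)\<close> for every \<open>r > 0\<close> (\<open>potential_upper\<close>, \<open>potential_lower\<close>). The polynomial
  decay of the Levy tail passes to \<open>\<phi>(1/r)\<close> (\<open>laplace_exponent_scaling\<close>), so that for a large
  constant \<open>A\<close> and all \<open>r < R\<^sub>1\<close> the mass of \<open>U\<close> below \<open>r/A\<close> is small compared with that below \<open>r\<close>, and
  the annulus \<open>(r/A,r]\<close> has mass comparable to \<open>1/\<phi>(1/r)\<close> (\<open>potential_annulus\<close>). A function that
  varies by bounded factors on such annuli does not see the distribution of \<open>U\<close> inside them, so these
  masses replace a density of \<open>U\<close>. Averaging over the scale \<open>r\<close> with the weight \<open>dr/r\<close>, which gives
  each point \<open>s\<close> a total weight between two positive constants, turns \<open>U(ds)\<close> into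
  \<open>dr / (r \<phi>(1/r))\<close> (\<open>nn_integral_potential_le\<close>, \<open>nn_integral_potential_ge\<close>).

  The kernel. Up to constants, \<open>p\<close> is the jump term \<open>C0 s h(s) / (V(\<rho>) \<Psi>(\<rho>))\<close> for \<open>s < \<Phi>(\<rho>)\<close> and
  \<open>h(s) / V(\<Phi>\<^sup>-\<^sup>1(s))\<close> for larger \<open>s\<close>; integrated against \<open>ds / (s \<phi>(1/s))\<close> these give the two
  integrals of the claim (\<open>green_profile_eq\<close>). Only the exponential term for \<open>s < \<Phi>(\<rho>)\<close> is left over.
  It beats every power of \<open>s/\<Phi>(\<rho>)\<close> while \<open>h(s)/h(\<Phi>(\<rho>))\<close> grows at most like a power of
  \<open>\<Phi>(\<rho>)/s\<close>, so its integral is at most a multiple of the contribution of the times between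
  \<open>\<Phi>(\<rho>)\<close> and \<open>2 \<Phi>(\<rho>)\<close> (\<open>spike_integral_le\<close>), an interval that lies below \<open>2 \<Phi>(diameter D)\<close>.

  Long times. If \<open>D\<close> is bounded, the claim stops at \<open>T = 2 \<Phi>(diameter D)\<close>, and the remaining times
  are harmless as soon as \<open>p(s,x,y) \<le> B exp(-\<kappa>s) h(T,x,y)\<close> for \<open>s \<ge> T\<close>, because
  \<open>\<integral> exp(-\<kappa>s) U(ds) = 1/\<phi>(\<kappa>)\<close>. Under \<open>HK_B\<close> this decay is given, with
  \<open>h(1,x,y)\<close> in the place of the comparable \<open>h(T,x,y)\<close>. Under \<open>HK_U\<close> it is a consequence of the
  two-sided bounds: since the volume grows, \<open>p(s,x,y) \<le> p(T,x,y)/2\<close> for some \<open>s > T\<close> and all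
  \<open>x, y\<close>, and the Chapman-Kolmogorov equation iterates this inequality
  (\<open>semigroup_exponential_decay\<close>).
\<close>

section \<open>The potential measure of a subordinator\<close>

text \<open>
  The Cauchy functional equation: multiples of \<open>1/n\<close> enclose \<open>t\<close> up to an error of \<open>1/n\<close>, and
  monotonicity carries this over to \<open>g\<close>.
\<close>

lemma additive_mono_linear:
  fixes g :: "real \<Rightarrow> real"
  assumes add: "\<And>s t. 0 \<le> s \<Longrightarrow> 0 \<le> t \<Longrightarrow> g (s + t) = g s + g t"
    and mono: "\<And>s t. 0 \<le> s \<Longrightarrow> s \<le> t \<Longrightarrow> g s \<le> g t"
    and t: "0 \<le> t"
  shows "g t = t * g 1"
proof -
  have mult: "g (real n * s) = real n * g s" if "0 \<le> s" for n s
  proof (induction n)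
    case 0
    show ?case using add[of 0 0] by simp
  next
    case (Suc n)
    have "g (real (Suc n) * s) = g (real n * s + s)" by (simp add: algebra_simps)
    also have "\<dots> = g (real n * s) + g s" using that by (intro add) auto
    finally show ?case using Suc by (simp add: algebra_simps)
  qed
  have g1: "0 \<le> g 1" using mono[of 0 1] mult[of 0 0] by simp
  have "\<bar>g t - t * g 1\<bar> \<le> g 1 / real (Suc n)" for n
  proof -
    define N where "N = real (Suc n)"
    have N: "N > 0" by (simp add: N_def)
    define k where "k = nat \<lfloor>N * t\<rfloor>"
    have k: "real k \<le> N * t" "N * t \<le> real (Suc k)"
      unfolding k_def using N t by (auto simp: of_nat_nat) linarith+
    have "real k * g 1 = g (real k)" using mult[of 1 k] by simp
    also have "\<dots> \<le> g (N * t)" using k by (intro mono) auto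
    also have e: "g (N * t) = N * g t" unfolding N_def using t by (rule mult)
    finally have lo: "real k * g 1 \<le> N * g t" .
    have "g (N * t) \<le> g (real (Suc k))" using k N t by (intro mono) auto
    also have "\<dots> = real (Suc k) * g 1" using mult[of 1 "Suc k"] by simp
    finally have up: "N * g t \<le> real (Suc k) * g 1" using e by simp
    have "N * t * g 1 \<le> real (Suc k) * g 1" "real k * g 1 \<le> N * t * g 1"
      using k g1 by (auto intro!: mult_right_mono)
    with lo up have "\<bar>N * g t - N * t * g 1\<bar> \<le> g 1"
      by (auto simp: algebra_simps abs_le_iff)
    moreover have "\<bar>N * g t - N * t * g 1\<bar> = N * \<bar>g t - t * g 1\<bar>"
      using N abs_mult[of N "g t - t * g 1"] by (simp add: algebra_simps)
    ultimately show ?thesis using N unfolding N_def[symmetric] by (simp add: pos_le_divide_eq mult.commute)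
  qed
  moreover have "(\<lambda>n. g 1 / real (Suc n)) \<longlonglongrightarrow> 0"
    by (intro LIMSEQ_Suc lim_const_over_n)
  ultimately have "\<bar>g t - t * g 1\<bar> \<le> 0"
    by (intro LIMSEQ_le_const) auto
  thus ?thesis by simp
qed

lemma subordinator_mono_AE:
  assumes "subordinator M S" "0 \<le> s" "s \<le> t"
  shows "AE \<omega> in M. 0 \<le> S s \<omega> \<and> S s \<omega> \<le> S t \<omega>"
proof -
  have "AE \<omega> in M. S 0 \<omega> = 0" "AE \<omega> in M. mono_on {0..} (\<lambda>t. S t \<omega>)"
    using assms(1) unfolding subordinator_def by auto
  thus ?thesis
  proof eventually_elim
    case (elim \<omega>)
    thus ?case using assms(2,3) mono_onD[OF elim(2), of 0 s] mono_onD[OF elim(2), of s t] by auto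
  qed
qed

text \<open>
  Independent stationary increments make \<open>t \<mapsto> E exp(-u S\<^sub>t)\<close> multiplicative, and the paths make it
  monotone; hence it is an exponential.
\<close>

lemma subordinator_laplace:
  assumes sub: "subordinator M S" and u: "0 \<le> u" and t: "0 \<le> t"
  shows "(\<integral>\<^sup>+\<omega>. ennreal (exp (- u * S t \<omega>)) \<partial>M) = ennreal (exp (- t * laplace_exponent M S u))"
proof -
  interpret prob_space M using sub by (simp add: subordinator_def)
  have S[measurable]: "S t \<in> borel_measurable M" if "0 \<le> t" for t
    using sub that by (auto simp: subordinator_def)
  define f where "f t = (\<integral>\<omega>. exp (- u * S t \<omega>) \<partial>M)" for t
  have int: "integrable M (\<lambda>\<omega>. exp (- u * S t \<omega>))" if "0 \<le> t" for t
  proof (rule integrable_const_bound[where B = 1])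
    show "AE \<omega> in M. norm (exp (- u * S t \<omega>)) \<le> 1"
      using subordinator_mono_AE[OF sub that order_refl] u by (auto elim!: eventually_mono)
  qed (use that in measurable)
  have nn: "(\<integral>\<^sup>+\<omega>. ennreal (exp (- u * S t \<omega>)) \<partial>M) = ennreal (f t)" if "0 \<le> t" for t
    unfolding f_def using int[OF that] by (intro nn_integral_eq_integral) auto
  have pos: "0 < f t" if "0 \<le> t" for t
  proof -
    have "0 \<le> f t" unfolding f_def by (intro integral_nonneg_AE) auto
    moreover have "f t \<noteq> 0"
    proof
      assume "f t = 0"
      hence "(\<integral>\<^sup>+\<omega>. ennreal (exp (- u * S t \<omega>)) \<partial>M) = 0" using nn[OF that] by simp
      hence "AE \<omega> in M. ennreal (exp (- u * S t \<omega>)) = 0"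
        using that by (subst (asm) nn_integral_0_iff_AE) measurable
      hence "AE \<omega> in M. False" by eventually_elim simp
      thus False by simp
    qed
    ultimately show ?thesis by simp
  qed
  have mult: "f (s + t) = f s * f t" if s: "0 \<le> s" and t: "0 \<le> t" for s t
  proof -
    \<comment> \<open>the two increments over \<open>[0,s]\<close> and \<open>[s,s+t]\<close>\<close>
    define \<tau> where "\<tau> i = (if i = 0 then 0 else if i = 1 then s else s + t)" for i :: nat
    let ?X = "\<lambda>i \<omega>. ennreal (exp (- u * (S (\<tau> (Suc i)) \<omega> - S (\<tau> i) \<omega>)))"
    have "mono \<tau>" using s t by (auto simp: \<tau>_def mono_def)
    hence iv: "indep_vars (\<lambda>_. borel) (\<lambda>i \<omega>. S (\<tau> (Suc i)) \<omega> - S (\<tau> i) \<omega>) {..<2}"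
      using sub unfolding subordinator_def by (auto simp: \<tau>_def[of 0])
    have "indep_vars (\<lambda>_. borel) (\<lambda>i \<omega>. ?X i \<omega>) {..<2}"
      by (rule indep_vars_compose2[OF iv]) measurable
    from indep_vars_nn_integral[OF _ this]
    have eq: "(\<integral>\<^sup>+\<omega>. (\<Prod>i<2. ?X i \<omega>) \<partial>M) =
      (\<Prod>i<2. \<integral>\<^sup>+\<omega>. ?X i \<omega> \<partial>M)" by simp
    have AE0: "AE \<omega> in M. S 0 \<omega> = 0" using sub by (simp add: subordinator_def)
    have "ennreal (f (s + t)) = (\<integral>\<^sup>+\<omega>. (\<Prod>i<2. ?X i \<omega>) \<partial>M)"
      unfolding nn[OF add_nonneg_nonneg[OF s t], symmetric]
    proof (rule nn_integral_cong_AE, use AE0 in eventually_elim)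
      case (elim \<omega>)
      thus ?case
        by (simp add: numeral_2_eq_2 lessThan_Suc \<tau>_def flip: ennreal_mult)
           (simp add: mult_exp_exp algebra_simps)
    qed
    also have "\<dots> = (\<integral>\<^sup>+\<omega>. ennreal (exp (- u * (S (s + t) \<omega> - S s \<omega>))) \<partial>M) *
         (\<integral>\<^sup>+\<omega>. ennreal (exp (- u * (S s \<omega> - S 0 \<omega>))) \<partial>M)"
      unfolding eq by (simp add: numeral_2_eq_2 lessThan_Suc \<tau>_def)
    also have "(\<integral>\<^sup>+\<omega>. ennreal (exp (- u * (S s \<omega> - S 0 \<omega>))) \<partial>M) = ennreal (f s)"
      unfolding nn[OF s, symmetric]
      by (rule nn_integral_cong_AE, use AE0 in eventually_elim) simp
    also have "(\<integral>\<^sup>+\<omega>. ennreal (exp (- u * (S (s + t) \<omega> - S s \<omega>))) \<partial>M) =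
       (\<integral>\<^sup>+z. ennreal (exp (- u * z)) \<partial>distr M borel (\<lambda>\<omega>. S (s + t) \<omega> - S s \<omega>))"
      using s t by (subst nn_integral_distr) auto
    also have "distr M borel (\<lambda>\<omega>. S (s + t) \<omega> - S s \<omega>) = distr M borel (S t)"
      using sub s t by (auto simp: subordinator_def)
    also have "(\<integral>\<^sup>+z. ennreal (exp (- u * z)) \<partial>distr M borel (S t)) = ennreal (f t)"
      unfolding nn[OF t, symmetric] using t by (subst nn_integral_distr) auto
    finally show ?thesis using pos s t by (simp add: ennreal_mult[symmetric] less_imp_le mult.commute)
  qed
  have anti: "f t \<le> f s" if "0 \<le> s" "s \<le> t" for s t
    unfolding f_def
  proof (rule integral_mono_AE[OF int int])
    show "AE \<omega> in M. exp (- u * S t \<omega>) \<le> exp (- u * S s \<omega>)"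
      by (rule eventually_mono[OF subordinator_mono_AE[OF sub that]])
         (use u in \<open>auto intro!: mult_left_mono\<close>)
  qed (use that in auto)
  have "- ln (f t) = t * - ln (f 1)"
  proof (rule additive_mono_linear[of "\<lambda>t. - ln (f t)"])
    show "- ln (f (s + t)) = - ln (f s) + - ln (f t)" if "0 \<le> s" "0 \<le> t" for s t
      using mult[OF that] pos[OF that(1)] pos[OF that(2)] by (simp add: ln_mult)
    show "- ln (f s) \<le> - ln (f t)" if "0 \<le> s" "s \<le> t" for s t
      using anti[OF that] pos that by simp
  qed fact
  also have "- ln (f 1) = laplace_exponent M S u" by (simp add: f_def laplace_exponent_def)
  finally have "f t = exp (- t * laplace_exponent M S u)"
    using pos[OF t] by (metis exp_ln minus_equation_iff mult_minus_left)
  thus ?thesis using nn[OF t] by simp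
qed

lemma nn_integral_exp_decay:
  assumes "0 < (a::real)"
  shows "(\<integral>\<^sup>+t. ennreal (exp (- a * t)) * indicator {0<..} t \<partial>lborel) = ennreal (1 / a)"
proof -
  have "(\<integral>\<^sup>+t. ennreal (exp (- a * t)) * indicator {0<..} t \<partial>lborel) =
        (\<integral>\<^sup>+t. ennreal (exp (- a * t)) * indicator {0..} t \<partial>lborel)"
  proof (rule nn_integral_cong_AE)
    have "AE t in lborel. t \<noteq> (0::real)" by (rule AE_lborel_singleton)
    thus "AE t in lborel. ennreal (exp (- a * t)) * indicator {0<..} t = ennreal (exp (- a * t)) * indicator {0..} t"
      by eventually_elim (auto simp: indicator_def)
  qed
  also have "\<dots> = ennreal (0 - (- exp (- a * 0) / a))"
  proof (rule nn_integral_FTC_atLeast)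
    show "DERIV (\<lambda>t. - exp (- a * t) / a) x :> exp (- a * x)" for x
      using assms by (auto intro!: derivative_eq_intros)
    have "((\<lambda>t. exp (- a * t)) \<longlongrightarrow> 0) at_top"
      by (rule filterlim_compose[OF exp_at_bot])
         (use assms filterlim_tendsto_neg_mult_at_bot[OF tendsto_const _ filterlim_ident, of "-a"] in simp)
    from tendsto_minus[OF tendsto_divide[OF this tendsto_const[of a]]]
    show "((\<lambda>t. - exp (- a * t) / a) \<longlongrightarrow> 0) at_top" using assms by simp
  qed auto
  finally show ?thesis by simp
qed

text \<open>
  As \<open>t \<mapsto> S\<^sub>t\<close> is monotone, so is \<open>t \<mapsto> P(S\<^sub>t \<le> a)\<close>, and half-lines generate the Borel sets. Thus the laws
  form a kernel. Capping the time at \<open>0\<close> from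
  below makes the kernel total.
\<close>

lemma subordinator_kernel_measurable:
  assumes sub: "subordinator M S"
  shows "(\<lambda>t. distr M borel (S (max 0 t))) \<in> borel \<rightarrow>\<^sub>M subprob_algebra borel"
proof (rule measurable_subprob_algebra_generated[where \<Omega> = UNIV and G = "range atMost"])
  interpret prob_space M using sub by (simp add: subordinator_def)
  let ?K = "\<lambda>t. distr M borel (S (max 0 t))"
  have S[measurable]: "S t \<in> borel_measurable M" if "0 \<le> t" for t
    using sub that by (auto simp: subordinator_def)
  show "sets borel = sigma_sets UNIV (range (atMost :: real \<Rightarrow> _))"
    by (simp add: borel_eq_atMost)
  show "Int_stable (range (atMost :: real \<Rightarrow> _))" by (auto simp: Int_stable_def)
  have P: "prob_space (?K t)" for t by (intro prob_space_distr S) auto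
  show "subprob_space (?K t)" for t
    by (intro prob_space_imp_subprob_space P)
  show "(\<lambda>t. emeasure (?K t) UNIV) \<in> borel_measurable borel"
    using prob_space.emeasure_space_1[OF P] by simp
  fix A :: "real set" assume "A \<in> range atMost"
  then obtain a where A: "A = {..a}" by auto
  define F where "F t = measure (?K t) A" for t
  have "mono (\<lambda>t. - F t)"
  proof (rule monoI)
    fix s t :: real assume "s \<le> t"
    have "measure M (S (max 0 t) -` A \<inter> space M) \<le> measure M (S (max 0 s) -` A \<inter> space M)"
    proof (rule finite_measure_mono_AE)
      have "max 0 s \<le> max 0 t" using \<open>s \<le> t\<close> by auto
      from subordinator_mono_AE[OF sub max.cobounded1 this]
      show "AE \<omega> in M. \<omega> \<in> S (max 0 t) -` A \<inter> space M \<longrightarrow> \<omega> \<in> S (max 0 s) -` A \<inter> space M"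
        by (rule eventually_mono) (auto simp: A)
    qed (auto simp: A intro!: measurable_sets)
    thus "- F s \<le> - F t" by (simp add: F_def measure_distr A)
  qed
  hence "(\<lambda>t. - F t) \<in> borel_measurable borel" by (rule borel_measurable_mono)
  hence "F \<in> borel_measurable borel" by simp
  moreover have "emeasure (?K t) A = ennreal (F t)" for t
    unfolding F_def using P by (intro finite_measure.emeasure_eq_measure prob_space.axioms(1))
  ultimately show "(\<lambda>t. emeasure (?K t) A) \<in> borel_measurable borel"
    by simp
qed (auto)

definition potential_measure :: "'v measure \<Rightarrow> (real \<Rightarrow> 'v \<Rightarrow> real) \<Rightarrow> real measure" where
  "potential_measure M S =
     density lborel (indicator {0<..}) \<bind> (\<lambda>t. distr M borel (S (max 0 t)))"

lemma sets_potential_measure: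
  assumes "subordinator M S"
  shows "sets (potential_measure M S) = sets borel"
  unfolding potential_measure_def by (intro sets_bind) auto

lemma nn_integral_potential_measure:
  assumes sub: "subordinator M S" and [measurable]: "f \<in> borel_measurable borel"
  shows "(\<integral>\<^sup>+s. f s \<partial>potential_measure M S) =
         (\<integral>\<^sup>+t\<in>{0<..}. (\<integral>\<^sup>+s. f s \<partial>distr M borel (S t)) \<partial>lborel)"
proof -
  note K = subordinator_kernel_measurable[OF sub]
  have "(\<integral>\<^sup>+s. f s \<partial>potential_measure M S) =
      (\<integral>\<^sup>+t. (\<integral>\<^sup>+s. f s \<partial>distr M borel (S (max 0 t))) \<partial>density lborel (indicator {0<..}))"
    unfolding potential_measure_def
    by (rule nn_integral_bind[where B = borel]) (use K in \<open>simp_all cong: measurable_cong_sets\<close>)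
  also have "\<dots> = (\<integral>\<^sup>+t. indicator {0<..} t * (\<integral>\<^sup>+s. f s \<partial>distr M borel (S (max 0 t))) \<partial>lborel)"
  proof (rule nn_integral_density)
    show "(\<lambda>t. \<integral>\<^sup>+ s. f s \<partial>distr M borel (S (max 0 t))) \<in> borel_measurable lborel"
      using measurable_compose[OF K nn_integral_measurable_subprob_algebra, of f] by simp
  qed auto
  also have "\<dots> = (\<integral>\<^sup>+t\<in>{0<..}. (\<integral>\<^sup>+s. f s \<partial>distr M borel (S t)) \<partial>lborel)"
    by (intro nn_integral_cong) (auto simp: indicator_def max_def)
  finally show ?thesis .
qed

lemma potential_measure_nonneg:
  assumes sub: "subordinator M S"
  shows "AE s in potential_measure M S. 0 \<le> s"
proof -
  note sets = sets_potential_measure[OF sub]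
  have "(\<integral>\<^sup>+s. indicator {..<0} s \<partial>potential_measure M S) =
      (\<integral>\<^sup>+t\<in>{0<..}. (\<integral>\<^sup>+s. indicator {..<0} s \<partial>distr M borel (S t)) \<partial>lborel)"
    by (rule nn_integral_potential_measure[OF sub]) measurable
  also have "\<dots> = (\<integral>\<^sup>+t\<in>{0::real<..}. 0 \<partial>lborel)"
  proof (rule nn_integral_cong)
    fix t :: real
    have "(\<integral>\<^sup>+s. indicator {..<0} s \<partial>distr M borel (S t)) = 0" if "0 < t"
    proof -
      have "S t \<in> borel_measurable M" using sub that by (auto simp: subordinator_def)
      hence "(\<integral>\<^sup>+s. indicator {..<0} s \<partial>distr M borel (S t)) = (\<integral>\<^sup>+\<omega>. indicator {..<0} (S t \<omega>) \<partial>M)"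
        by (intro nn_integral_distr) auto
      also have "\<dots> = (\<integral>\<^sup>+\<omega>. 0 \<partial>M)"
        using subordinator_mono_AE[OF sub less_imp_le[OF that] order_refl]
        by (intro nn_integral_cong_AE) (auto elim!: eventually_mono simp: indicator_def)
      finally show ?thesis by simp
    qed
    thus "(\<integral>\<^sup>+s. indicator {..<0} s \<partial>distr M borel (S t)) * indicator {0<..} t = 0 * indicator {0<..} t"
      by (auto simp: indicator_def)
  qed
  finally have z: "emeasure (potential_measure M S) {..<0} = 0" using sets by simp
  show ?thesis
  proof (rule AE_I[OF _ z])
    show "{s \<in> space (potential_measure M S). \<not> 0 \<le> s} \<subseteq> {..<0}" by auto
  qed (simp add: sets)
qed

lemma laplace_potential_measure:
  assumes sub: "subordinator M S" and u: "0 \<le> u" and pos: "0 < laplace_exponent M S u"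
  shows "(\<integral>\<^sup>+s. ennreal (exp (- u * s)) \<partial>potential_measure M S) = ennreal (1 / laplace_exponent M S u)"
proof -
  have "(\<integral>\<^sup>+s. ennreal (exp (- u * s)) \<partial>potential_measure M S) =
     (\<integral>\<^sup>+t\<in>{0<..}. (\<integral>\<^sup>+s. ennreal (exp (- u * s)) \<partial>distr M borel (S t)) \<partial>lborel)"
    by (rule nn_integral_potential_measure[OF sub]) measurable
  also have "\<dots> = (\<integral>\<^sup>+t. ennreal (exp (- laplace_exponent M S u * t)) * indicator {0<..} t \<partial>lborel)"
  proof (rule nn_integral_cong)
    fix t :: real
    have "(\<integral>\<^sup>+s. ennreal (exp (- u * s)) \<partial>distr M borel (S t)) = ennreal (exp (- laplace_exponent M S u * t))"
      if "0 < t"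
      using sub that subordinator_laplace[OF sub u, of t]
      by (subst nn_integral_distr) (auto simp: subordinator_def mult.commute)
    thus "(\<integral>\<^sup>+s. ennreal (exp (- u * s)) \<partial>distr M borel (S t)) * indicator {0<..} t =
       ennreal (exp (- laplace_exponent M S u * t)) * indicator {0<..} t"
      by (auto simp: indicator_def)
  qed
  also have "\<dots> = ennreal (1 / laplace_exponent M S u)" by (rule nn_integral_exp_decay[OF pos])
  finally show ?thesis .
qed

lemma green_function_eq_potential:
  assumes sub: "subordinator M S"
    and meas: "(\<lambda>s. p s x y * indicator {0<..} s) \<in> borel_measurable borel"
  shows "green_function (subordinate_kernel M S p) x y =
         (\<integral>\<^sup>+s. p s x y * indicator {0<..} s \<partial>potential_measure M S)"
  unfolding green_function_def subordinate_kernel_def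
  by (rule nn_integral_potential_measure[OF sub meas, symmetric])

section \<open>The Laplace exponent and the tail of the Levy measure\<close>

lemma levy_tail_finite:
  assumes lev: "subordinator_levy_measure \<nu>" and a: "0 < a"
  shows "emeasure \<nu> {a<..} = ennreal (tail \<nu> a)"
proof -
  have [measurable_cong]: "sets \<nu> = sets borel" using lev by (simp add: subordinator_levy_measure_def)
  have "ennreal (min 1 a) * emeasure \<nu> {a<..} = (\<integral>\<^sup>+s. ennreal (min 1 a) * indicator {a<..} s \<partial>\<nu>)"
    by (rule nn_integral_cmult_indicator[symmetric]) simp
  also have "\<dots> \<le> (\<integral>\<^sup>+s. ennreal (min 1 s) \<partial>\<nu>)"
    by (intro nn_integral_mono) (auto simp: indicator_def intro!: ennreal_leI)
  also have "\<dots> < \<infinity>" using lev by (simp add: subordinator_levy_measure_def)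
  finally have "emeasure \<nu> {a<..} \<noteq> \<infinity>" using a by (auto simp: ennreal_mult_eq_top_iff less_top[symmetric])
  thus ?thesis by (simp add: tail_def emeasure_eq_ennreal_measure)
qed

lemma levy_sigma_finite:
  assumes lev: "subordinator_levy_measure \<nu>"
  shows "sigma_finite_measure \<nu>"
proof
  have sets: "sets \<nu> = sets borel" using lev by (simp add: subordinator_levy_measure_def)
  define A where "A = insert {..0} (range (\<lambda>n. {1 / real (Suc n)<..}))"
  have "\<exists>n. 1 / real (Suc n) < x" if "0 < x" for x :: real
    using that by (rule nat_approx_posE) blast
  hence "\<Union>A = UNIV" unfolding A_def by (auto simp: not_le) (meson not_le)
  moreover have "space \<nu> = UNIV" using sets_eq_imp_space_eq[OF sets] by simp
  moreover have "emeasure \<nu> a \<noteq> \<infinity>" if "a \<in> A" for a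
    using that lev by (auto simp: A_def levy_tail_finite[OF lev] subordinator_levy_measure_def)
  ultimately show "\<exists>A. countable A \<and> A \<subseteq> sets \<nu> \<and> \<Union>A = space \<nu> \<and> (\<forall>a\<in>A. emeasure \<nu> a \<noteq> \<infinity>)"
    by (intro exI[of _ A]) (auto simp: A_def sets)
qed

lemma levy_AE_pos:
  assumes lev: "subordinator_levy_measure \<nu>"
  shows "AE s in \<nu>. 0 < s"
proof (rule AE_I)
  show "{s \<in> space \<nu>. \<not> 0 < s} \<subseteq> {..0}" by auto
  show "emeasure \<nu> {..0} = 0" "{..0} \<in> sets \<nu>" using lev by (auto simp: subordinator_levy_measure_def)
qed

lemma integrable_one_minus_exp:
  assumes lev: "subordinator_levy_measure \<nu>" and u: "0 \<le> u"
  shows "integrable \<nu> (\<lambda>s. 1 - exp (- u * s))"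
proof (rule integrableI_nonneg)
  have [measurable_cong]: "sets \<nu> = sets borel" using lev by (simp add: subordinator_levy_measure_def)
  show "(\<lambda>s. 1 - exp (- u * s)) \<in> borel_measurable \<nu>" by measurable
  show "AE s in \<nu>. 0 \<le> 1 - exp (- u * s)"
    using levy_AE_pos[OF lev] by eventually_elim (use u in auto)
  have "(\<integral>\<^sup>+s. ennreal (1 - exp (- u * s)) \<partial>\<nu>) \<le> (\<integral>\<^sup>+s. ennreal (max 1 u) * ennreal (min 1 s) \<partial>\<nu>)"
  proof (rule nn_integral_mono_AE, use levy_AE_pos[OF lev] in eventually_elim)
    case (elim s)
    have "1 - exp (- u * s) \<le> u * s" using exp_ge_add_one_self[of "- u * s"] by simp
    also have "\<dots> \<le> max 1 u * s" using elim by (intro mult_right_mono) auto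
    finally have "1 - exp (- u * s) \<le> max 1 u * s" .
    moreover have "1 - exp (- u * s) \<le> max 1 u * 1"
      using exp_ge_zero[of "- u * s"] max.cobounded1[of 1 u] by linarith
    ultimately have "1 - exp (- u * s) \<le> max 1 u * min 1 s" by (simp add: min_def)
    thus ?case using elim by (simp flip: ennreal_mult)
  qed
  also have "\<dots> = ennreal (max 1 u) * (\<integral>\<^sup>+s. ennreal (min 1 s) \<partial>\<nu>)" by (rule nn_integral_cmult) measurable
  also have "\<dots> < \<infinity>" using lev by (auto simp: subordinator_levy_measure_def ennreal_mult_less_top)
  finally show "(\<integral>\<^sup>+s. ennreal (1 - exp (- u * s)) \<partial>\<nu>) < \<infinity>" .
qed

text \<open>
  The layer-cake formula, from \<open>1 - exp (-s/r) = \<integral> exp (-z) 1[r z < s] dz\<close>. In this form the scaling of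
  the tail can be used under the integral.
\<close>

lemma laplace_exponent_layer_cake:
  assumes drift: "driftless_subordinator M S \<nu>" and r: "0 < r"
  shows "ennreal (laplace_exponent M S (1 / r)) =
         (\<integral>\<^sup>+z. ennreal (exp (- z) * tail \<nu> (r * z)) * indicator {0<..} z \<partial>lborel)"
proof -
  let ?F = "\<lambda>s z. ennreal (exp (- z)) * indicator {0<..} z * indicator {r * z<..} s"
  have lev: "subordinator_levy_measure \<nu>" using drift by (simp add: driftless_subordinator_def)
  have [measurable_cong]: "sets \<nu> = sets borel" using lev by (simp add: subordinator_levy_measure_def)
  interpret N: sigma_finite_measure \<nu> by (rule levy_sigma_finite[OF lev])
  interpret pair_sigma_finite \<nu> lborel ..
  have "laplace_exponent M S (1 / r) = (\<integral>s. (1 - exp (- (1 / r) * s)) \<partial>\<nu>)"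
    using drift r by (auto simp: driftless_subordinator_def)
  also have "ennreal \<dots> = (\<integral>\<^sup>+s. ennreal (1 - exp (- (1 / r) * s)) \<partial>\<nu>)"
    using levy_AE_pos[OF lev] r
    by (intro nn_integral_eq_integral[symmetric] integrable_one_minus_exp[OF lev])
       (auto elim!: eventually_mono)
  also have "\<dots> = (\<integral>\<^sup>+s. \<integral>\<^sup>+z. ?F s z \<partial>lborel \<partial>\<nu>)"
  proof (rule nn_integral_cong_AE, use levy_AE_pos[OF lev] in eventually_elim)
    case (elim s)
    have "(\<integral>\<^sup>+z. ?F s z \<partial>lborel) =
          (\<integral>\<^sup>+z. ennreal (exp (- z)) * indicator {0..s / r} z \<partial>lborel)"
    proof (rule nn_integral_cong_AE)
      have "AE z in lborel. z \<noteq> (0::real)" "AE z in lborel. z \<noteq> s / r" by (rule AE_lborel_singleton)+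
      thus "AE z in lborel. ?F s z =
         ennreal (exp (- z)) * indicator {0..s / r} z"
        by eventually_elim (use r in \<open>auto simp: indicator_def field_simps\<close>)
    qed
    also have "\<dots> = ennreal (- exp (- (s / r)) - (- exp (- 0)))"
      by (rule nn_integral_FTC_Icc) (use elim r in \<open>auto intro!: derivative_eq_intros\<close>)
    finally show ?case by simp
  qed
  also have "\<dots> = (\<integral>\<^sup>+z. \<integral>\<^sup>+s. ?F s z \<partial>\<nu> \<partial>lborel)"
    by (rule Fubini'[symmetric]) (simp add: split_def indicator_def, measurable)
  also have "\<dots> = (\<integral>\<^sup>+z. ennreal (exp (- z) * tail \<nu> (r * z)) * indicator {0<..} z \<partial>lborel)"
  proof (rule nn_integral_cong)
    fix z :: real
    have "(\<integral>\<^sup>+s. ?F s z \<partial>\<nu>) =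
       ennreal (exp (- z)) * indicator {0<..} z * emeasure \<nu> {r * z<..}"
      by (rule nn_integral_cmult_indicator) simp
    also have "\<dots> = ennreal (exp (- z) * tail \<nu> (r * z)) * indicator {0<..} z"
      using r by (auto simp: indicator_def levy_tail_finite[OF lev] ennreal_mult tail_def)
    finally show "(\<integral>\<^sup>+s. ?F s z \<partial>\<nu>) = \<dots>" .
  qed
  finally show ?thesis .
qed

lemma tail_antimono:
  assumes lev: "subordinator_levy_measure \<nu>" and "0 < a" "a \<le> b"
  shows "tail \<nu> b \<le> tail \<nu> a"
proof -
  have "sets \<nu> = sets borel" using lev by (simp add: subordinator_levy_measure_def)
  hence "emeasure \<nu> {b<..} \<le> emeasure \<nu> {a<..}" using assms by (intro emeasure_mono) auto
  thus ?thesis using assms by (simp add: levy_tail_finite[OF lev] tail_def)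
qed

lemma tail_borel_measurable:
  assumes lev: "subordinator_levy_measure \<nu>" and r: "0 < r"
  shows "(\<lambda>z. ennreal (exp (- z) * tail \<nu> (r * z)) * indicator {0<..} z) \<in> borel_measurable borel"
proof -
  have "mono_on {0<..} (\<lambda>z. - tail \<nu> (r * z))"
    using tail_antimono[OF lev] r by (auto intro!: mono_onI)
  hence "(\<lambda>z. - tail \<nu> (r * z)) \<in> borel_measurable (restrict_space borel {0<..})"
    by (rule borel_measurable_mono_on_fnc)
  hence [measurable]: "(\<lambda>z. tail \<nu> (r * z)) \<in> borel_measurable (restrict_space borel {0<..})" by simp
  have [measurable]: "(\<lambda>z::real. z) \<in> borel_measurable (restrict_space borel {0<..})"
    by (rule measurable_restrict_space1) simp
  have "(\<lambda>z. ennreal (exp (- z) * tail \<nu> (r * z))) \<in> borel_measurable (restrict_space borel {0<..})"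
    by measurable
  thus ?thesis by (subst (asm) borel_measurable_restrict_space_iff_ennreal) auto
qed

lemma laplace_exponent_ge_tail:
  assumes drift: "driftless_subordinator M S \<nu>" and r: "0 < r" and b: "0 < b"
  shows "b * exp (- b) * tail \<nu> (r * b) \<le> laplace_exponent M S (1 / r)"
proof -
  have lev: "subordinator_levy_measure \<nu>" using drift by (simp add: driftless_subordinator_def)
  have "ennreal (b * exp (- b) * tail \<nu> (r * b)) =
      (\<integral>\<^sup>+z. ennreal (exp (- b) * tail \<nu> (r * b)) * indicator {0<..<b} z \<partial>lborel)"
    using b by (subst nn_integral_cmult_indicator) (auto simp: tail_def mult_ac simp flip: ennreal_mult)
  also have "\<dots> \<le> (\<integral>\<^sup>+z. ennreal (exp (- z) * tail \<nu> (r * z)) * indicator {0<..} z \<partial>lborel)"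
    using r b tail_antimono[OF lev]
    by (intro nn_integral_mono) (auto simp: indicator_def tail_def intro!: ennreal_leI mult_mono)
  also have "\<dots> = ennreal (laplace_exponent M S (1 / r))"
    by (rule laplace_exponent_layer_cake[OF drift r, symmetric])
  moreover have "0 \<le> laplace_exponent M S (1 / r)"
    using drift r levy_AE_pos[OF lev]
    by (auto simp: driftless_subordinator_def intro!: integral_nonneg_AE elim!: eventually_mono)
  ultimately show ?thesis by simp
qed

lemma Poly_cond_tail_pos:
  assumes poly: "Poly_cond \<nu> R1" and R: "0 < R" "ereal R < R1"
  shows "0 < tail \<nu> R"
proof -
  obtain c1 \<beta>1 where "c1 > 0" "c1 * (R / R) powr \<beta>1 \<le> tail \<nu> R / tail \<nu> R"
    using poly R unfolding Poly_cond_def by blast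
  hence "tail \<nu> R \<noteq> 0" using R by auto
  moreover have "0 \<le> tail \<nu> R" by (simp add: tail_def)
  ultimately show ?thesis by simp
qed

lemma laplace_exponent_pos:
  assumes drift: "driftless_subordinator M S \<nu>" and poly: "Poly_cond \<nu> R1" and R1: "0 < R1"
    and u: "0 < u"
  shows "0 < laplace_exponent M S u"
proof -
  obtain R where R: "0 < R" "ereal R < R1" using R1
    by (metis ereal_dense2 ereal_less(2) zero_ereal_def less_ereal.simps(1))
  have "0 < (R * u) * exp (- (R * u)) * tail \<nu> (1 / u * (R * u))"
    using Poly_cond_tail_pos[OF poly R] R u by simp
  also have "\<dots> \<le> laplace_exponent M S (1 / (1 / u))"
    by (rule laplace_exponent_ge_tail[OF drift]) (use R u in auto)
  finally show ?thesis by simp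
qed

lemma laplace_exponent_mono:
  assumes drift: "driftless_subordinator M S \<nu>" and "0 \<le> u" "u \<le> v"
  shows "laplace_exponent M S u \<le> laplace_exponent M S v"
proof -
  have lev: "subordinator_levy_measure \<nu>" using drift by (simp add: driftless_subordinator_def)
  have "(\<integral>s. (1 - exp (- u * s)) \<partial>\<nu>) \<le> (\<integral>s. (1 - exp (- v * s)) \<partial>\<nu>)"
    using levy_AE_pos[OF lev] assms
    by (intro integral_mono_AE integrable_one_minus_exp[OF lev])
       (auto elim!: eventually_mono intro!: mult_right_mono)
  thus ?thesis using drift assms by (simp add: driftless_subordinator_def)
qed

text \<open>
  This is \<open>1 - q\<^sup>2 \<le> 2 (1 - q)\<close> for \<open>q = exp (-u s)\<close>.
\<close>

lemma laplace_exponent_double: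
  assumes drift: "driftless_subordinator M S \<nu>" and "0 \<le> u"
  shows "laplace_exponent M S (2 * u) \<le> 2 * laplace_exponent M S u"
proof -
  have lev: "subordinator_levy_measure \<nu>" using drift by (simp add: driftless_subordinator_def)
  have "(\<integral>s. (1 - exp (- (2 * u) * s)) \<partial>\<nu>) \<le> (\<integral>s. 2 * (1 - exp (- u * s)) \<partial>\<nu>)"
  proof (rule integral_mono)
    fix s
    have "0 \<le> (exp (- u * s) - 1)\<^sup>2" by simp
    also have "(exp (- u * s) - 1)\<^sup>2 = exp (- (2 * u) * s) - 2 * exp (- u * s) + 1"
      by (simp add: power2_eq_square algebra_simps mult_exp_exp)
    finally show "1 - exp (- (2 * u) * s) \<le> 2 * (1 - exp (- u * s))" by simp
  qed (use assms in \<open>intro integrable_one_minus_exp[OF lev] integrable_mult_right; simp\<close>)+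
  also have "\<dots> = 2 * (\<integral>s. (1 - exp (- u * s)) \<partial>\<nu>)" by (rule integral_mult_right_zero)
  finally show ?thesis using drift assms by (simp add: driftless_subordinator_def)
qed

text \<open>
  In the layer-cake formula the levels \<open>z < 1\<close> involve the tail below \<open>R < R1\<close> only, where its scaling is
  available, and the levels \<open>z \<ge> 1\<close> contribute at most a fixed multiple of the former because the tail
  is non-increasing.
\<close>

lemma laplace_exponent_scaling:
  assumes drift: "driftless_subordinator M S \<nu>" and poly: "Poly_cond \<nu> R1"
  shows "\<exists>c>0. \<exists>\<beta>>0. \<forall>r R. 0 < r \<and> r \<le> R \<and> ereal R < R1 \<longrightarrow>
     c * (R / r) powr \<beta> * laplace_exponent M S (1 / R) \<le> laplace_exponent M S (1 / r)"
proof -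
  have lev: "subordinator_levy_measure \<nu>" using drift by (simp add: driftless_subordinator_def)
  obtain c \<beta> where c: "c > 0" "\<beta> > 0" and
    "\<forall>r R. 0 < r \<and> r \<le> R \<and> ereal R < R1 \<longrightarrow> c * (R / r) powr \<beta> \<le> tail \<nu> r / tail \<nu> R"
    using poly unfolding Poly_cond_def by blast
  hence sc: "c * (R / r) powr \<beta> * tail \<nu> R \<le> tail \<nu> r" if "0 < r" "r \<le> R" "ereal R < R1" for r R
    using that Poly_cond_tail_pos[OF poly, of R] by (metis order_less_le_trans pos_le_divide_eq)
  let ?L = "laplace_exponent M S"
  let ?e = "\<lambda>r z. ennreal (exp (- z) * tail \<nu> (r * z))"
  have "c / (1 + exp 1) * (R / r) powr \<beta> * ?L (1 / R) \<le> ?L (1 / r)"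
    if rR: "0 < r \<and> r \<le> R \<and> ereal R < R1" for r R
  proof -
    from rR have R: "0 < R" by simp
    \<comment> \<open>the part of the layer-cake integral where the tail can be rescaled\<close>
    define I where "I = (\<integral>\<^sup>+z. ?e R z * indicator {0<..<1} z \<partial>lborel)"
    define b where "b = c * (R / r) powr \<beta>"
    have b: "0 < b" using rR c by (simp add: b_def)
    have m: "(\<lambda>z. ?e R z * indicator {0<..<1} z) \<in> borel_measurable borel"
    proof -
      have "(\<lambda>z. (?e R z * indicator {0<..} z) * indicator {0<..<1} z) \<in> borel_measurable borel"
        using tail_borel_measurable[OF lev R] by measurable
      thus ?thesis by (rule measurable_cong[THEN iffD1, rotated]) (auto simp: indicator_def)
    qed
    have tl: "ennreal (exp (-1) * tail \<nu> R) \<le> I"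
    proof -
      have "ennreal (exp (-1) * tail \<nu> R) = (\<integral>\<^sup>+z. ennreal (exp (-1) * tail \<nu> R) * indicator {0<..<1::real} z \<partial>lborel)"
        by (subst nn_integral_cmult_indicator) auto
      also have "\<dots> \<le> I" unfolding I_def using R tail_antimono[OF lev]
        by (intro nn_integral_mono) (auto simp: indicator_def tail_def intro!: ennreal_leI mult_mono)
      finally show ?thesis .
    qed
    have "ennreal (?L (1 / R)) = (\<integral>\<^sup>+z. ?e R z * indicator {0<..} z \<partial>lborel)"
      by (rule laplace_exponent_layer_cake[OF drift R])
    also have "\<dots> \<le> (\<integral>\<^sup>+z. ?e R z * indicator {0<..<1} z +
         ennreal (tail \<nu> R) * (ennreal (exp (- 1 * z)) * indicator {0<..} z) \<partial>lborel)"
    proof (intro nn_integral_mono)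
      fix z :: real
      show "?e R z * indicator {0<..} z \<le>
        ?e R z * indicator {0<..<1} z +
         ennreal (tail \<nu> R) * (ennreal (exp (- 1 * z)) * indicator {0<..} z)"
        using tail_antimono[OF lev R, of "R * z"] R
        by (auto simp: indicator_def tail_def mult.commute simp flip: ennreal_mult intro!: ennreal_leI mult_left_mono)
    qed
    also have "\<dots> = I + ennreal (tail \<nu> R) * (\<integral>\<^sup>+z. ennreal (exp (- 1 * z)) * indicator {0<..} z \<partial>lborel)"
      unfolding I_def using m by (subst nn_integral_add) (auto intro!: nn_integral_cmult)
    also have "\<dots> = I + ennreal (tail \<nu> R)" by (subst nn_integral_exp_decay) auto
    also have "ennreal (tail \<nu> R) = ennreal (exp 1) * ennreal (exp (-1) * tail \<nu> R)"
      by (simp add: tail_def exp_minus field_simps flip: ennreal_mult)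
    also have "I + \<dots> \<le> I + ennreal (exp 1) * I" using tl by (intro add_left_mono mult_left_mono) auto
    also have "\<dots> = ennreal (1 + exp 1) * I"
      by (subst ennreal_plus) (auto simp: distrib_right)
    finally have le: "ennreal (?L (1 / R)) \<le> ennreal (1 + exp 1) * I" .
    have "ennreal b * I = (\<integral>\<^sup>+z. ennreal b * (?e R z * indicator {0<..<1} z) \<partial>lborel)"
      unfolding I_def using m by (intro nn_integral_cmult[symmetric]) auto
    also have "\<dots> \<le> (\<integral>\<^sup>+z. ?e r z * indicator {0<..} z \<partial>lborel)"
    proof (intro nn_integral_mono)
      fix z :: real
      have "b * (exp (- z) * tail \<nu> (R * z)) \<le> exp (- z) * tail \<nu> (r * z)" if z: "0 < z" "z < 1"
      proof -
        have "ereal (R * z) < R1" using rR z R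
          by (meson ereal_less_eq(3) less_imp_le mult_left_le order_le_less_trans)
        hence "c * ((R * z) / (r * z)) powr \<beta> * tail \<nu> (R * z) \<le> tail \<nu> (r * z)"
          using rR z by (intro sc) auto
        hence "b * tail \<nu> (R * z) \<le> tail \<nu> (r * z)" using z by (simp add: b_def)
        hence "exp (- z) * (b * tail \<nu> (R * z)) \<le> exp (- z) * tail \<nu> (r * z)"
          by (intro mult_left_mono) auto
        thus ?thesis by (simp add: mult_ac)
      qed
      thus "ennreal b * (?e R z * indicator {0<..<1} z) \<le>
          ?e r z * indicator {0<..} z"
        using b by (auto simp: indicator_def tail_def simp flip: ennreal_mult intro!: ennreal_leI)
    qed
    also have "\<dots> = ennreal (?L (1 / r))"
      using rR by (intro laplace_exponent_layer_cake[OF drift, symmetric]) auto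
    finally have le2: "ennreal b * I \<le> ennreal (?L (1 / r))" .
    have L0: "0 \<le> ?L (1 / r)" "0 \<le> ?L (1 / R)"
      using laplace_exponent_ge_tail[OF drift, of r 1] laplace_exponent_ge_tail[OF drift, of R 1] rR
      by (auto simp: tail_def intro: order_trans[rotated])
    have "ennreal (b * ?L (1 / R)) \<le> ennreal b * (ennreal (1 + exp 1) * I)"
      using le b L0 by (simp add: ennreal_mult mult_left_mono)
    also have "\<dots> = ennreal (1 + exp 1) * (ennreal b * I)" by (simp add: mult_ac)
    also have "\<dots> \<le> ennreal (1 + exp 1) * ennreal (?L (1 / r))" using le2 by (intro mult_left_mono) auto
    also have "\<dots> = ennreal ((1 + exp 1) * ?L (1 / r))" using L0 by (intro ennreal_mult[symmetric]) auto
    finally have "b * ?L (1 / R) \<le> (1 + exp 1) * ?L (1 / r)"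
      using L0 by (subst (asm) ennreal_le_iff) auto
    moreover have "0 < 1 + exp (1::real)" by (simp add: add_pos_pos)
    ultimately have "b * ?L (1 / R) / (1 + exp 1) \<le> ?L (1 / r)" by (simp add: pos_divide_le_eq mult.commute)
    thus "c / (1 + exp 1) * (R / r) powr \<beta> * ?L (1 / R) \<le> ?L (1 / r)"
      unfolding b_def by simp
  qed
  moreover have "0 < c / (1 + exp 1)" using c by (auto simp: add_pos_pos)
  ultimately show ?thesis using c by blast
qed

section \<open>The potential measure at a single scale\<close>

lemma ennreal_mult_triple:
  "0 \<le> a \<Longrightarrow> 0 \<le> b \<Longrightarrow> 0 \<le> c \<Longrightarrow> ennreal a * (ennreal b * ennreal c) = ennreal (a * (b * c))"
  by (simp add: ennreal_mult)

text \<open>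
  Everything that the estimates use about the potential measure \<open>U\<close> and the Laplace exponent \<open>\<phi>\<close>.
\<close>

locale potential_estimates =
  fixes U :: "real measure" and \<phi> :: "real \<Rightarrow> real"
  assumes sets_U[measurable_cong]: "sets U = sets borel"
    and nonneg_U: "AE s in U. 0 \<le> s"
    and laplace_U: "\<And>u. 0 < u \<Longrightarrow> (\<integral>\<^sup>+s. ennreal (exp (- u * s)) \<partial>U) = ennreal (1 / \<phi> u)"
    and \<phi>_pos: "\<And>u. 0 < u \<Longrightarrow> 0 < \<phi> u"
    and \<phi>_mono: "\<And>u v. 0 < u \<Longrightarrow> u \<le> v \<Longrightarrow> \<phi> u \<le> \<phi> v"
    and \<phi>_double: "\<And>u. 0 < u \<Longrightarrow> \<phi> (2 * u) \<le> 2 * \<phi> u"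
begin

abbreviation wt :: "real \<Rightarrow> ennreal" where "wt r \<equiv> ennreal (1 / (r * \<phi> (1 / r)))"

lemma potential_upper:
  assumes r: "0 < r"
  shows "emeasure U {..r} \<le> ennreal (exp 1 / \<phi> (1 / r))"
proof -
  have "emeasure U {..r} = (\<integral>\<^sup>+s. indicator {..r} s \<partial>U)" by simp
  also have "\<dots> \<le> (\<integral>\<^sup>+s. ennreal (exp 1) * ennreal (exp (- (1 / r) * s)) \<partial>U)"
    using r by (intro nn_integral_mono) (auto simp: indicator_def mult_exp_exp simp flip: ennreal_mult)
  also have "\<dots> = ennreal (exp 1) * (\<integral>\<^sup>+s. ennreal (exp (- (1 / r) * s)) \<partial>U)"
    by (rule nn_integral_cmult) measurable
  also have "\<dots> = ennreal (exp 1 / \<phi> (1 / r))"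
    using r \<phi>_pos[of "1 / r"] by (subst laplace_U) (auto simp flip: ennreal_mult)
  finally show ?thesis .
qed

text \<open>
  On \<open>(r,\<infinity>)\<close> one has \<open>exp (-4s/r) \<le> exp (-3) exp (-s/r)\<close>, so the transform at \<open>4/r\<close>, which is at least
  \<open>1 / (4 \<phi>(1/r))\<close>, receives at most \<open>exp (-3) / \<phi>(1/r)\<close> from there. The factor \<open>4\<close> is chosen because
  \<open>1/4 - exp (-3) \<ge> 1/8\<close>.
\<close>

lemma potential_lower:
  assumes r: "0 < r"
  shows "ennreal (1 / (8 * \<phi> (1 / r))) \<le> emeasure U {..r}"
proof -
  let ?a = "ennreal (1 / (8 * \<phi> (1 / r)))"
  let ?e = "\<lambda>s. ennreal (exp (- (1 / r) * s))"
  have p: "0 < \<phi> (1 / r)" using r by (intro \<phi>_pos) auto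
  have q: "0 < \<phi> (4 / r)" using r by (intro \<phi>_pos) auto
  have "\<phi> (4 / r) \<le> 2 * \<phi> (2 / r)" using \<phi>_double[of "2 / r"] r by simp
  also have "\<dots> \<le> 2 * (2 * \<phi> (1 / r))" using \<phi>_double[of "1 / r"] r by simp
  finally have "\<phi> (4 / r) \<le> 4 * \<phi> (1 / r)" by simp
  hence "ennreal (1 / (4 * \<phi> (1 / r))) \<le> ennreal (1 / \<phi> (4 / r))"
    using p q by (intro ennreal_leI) (auto simp: frac_le)
  also have "\<dots> = (\<integral>\<^sup>+s. ennreal (exp (- (4 / r) * s)) \<partial>U)"
    using r by (intro laplace_U[symmetric]) auto
  also have "\<dots> \<le> (\<integral>\<^sup>+s. indicator {..r} s + ennreal (exp (- 3)) * ?e s \<partial>U)"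
  proof (rule nn_integral_mono_AE, use nonneg_U in eventually_elim)
    case (elim s)
    have "exp (- (4 / r) * s) \<le> 1" using elim r by simp
    moreover have "exp (- (4 / r) * s) \<le> exp (- 3) * exp (- (1 / r) * s)" if "r < s"
      using that r by (simp add: mult_exp_exp field_simps)
    ultimately show ?case
    proof (cases "s \<le> r")
      case True
      have "ennreal (exp (- (4 / r) * s)) \<le> 1" using \<open>exp (- (4 / r) * s) \<le> 1\<close> by (simp add: ennreal_le_1)
      thus ?thesis using True by (simp add: add_increasing2)
    next
      case False
      hence "ennreal (exp (- (4 / r) * s)) \<le> ennreal (exp (- 3) * exp (- (1 / r) * s))"
        using \<open>r < s \<Longrightarrow> exp (- (4 / r) * s) \<le> exp (- 3) * exp (- (1 / r) * s)\<close>
        by (intro ennreal_leI) auto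
      thus ?thesis using False by (simp add: ennreal_mult)
    qed
  qed
  also have "\<dots> = emeasure U {..r} + ennreal (exp (- 3)) * (\<integral>\<^sup>+s. ?e s \<partial>U)"
    by (subst nn_integral_add) (auto intro!: nn_integral_cmult)
  also have "\<dots> = emeasure U {..r} + ennreal (exp (- 3) / \<phi> (1 / r))"
    using r p by (subst laplace_U) (auto simp flip: ennreal_mult)
  also have "\<dots> \<le> emeasure U {..r} + ?a"
  proof (intro add_left_mono ennreal_leI)
    have "(2::real) ^ 3 \<le> exp 1 ^ 3" by (intro power_mono) (auto intro: order_trans[OF _ exp_ge_add_one_self])
    hence "8 \<le> exp (3::real)" by (simp flip: exp_of_nat_mult)
    hence "exp (- 3) \<le> (1 / 8 :: real)" by (simp add: exp_minus field_simps)
    thus "exp (- 3) / \<phi> (1 / r) \<le> 1 / (8 * \<phi> (1 / r))" using p by (simp add: field_simps)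
  qed
  finally have "?a + ?a
      \<le> emeasure U {..r} + ?a"
    using p by (simp flip: ennreal_plus)
  thus ?thesis by (simp add: add.commute ennreal_add_left_cancel_le)
qed

text \<open>
  If \<open>\<phi>(1/r)\<close> has a power growth as \<open>r\<close> decreases, then the mass of \<open>U\<close> below \<open>r/A\<close> is at most half the
  lower bound for its mass below \<open>r\<close>.
\<close>

lemma potential_annulus:
  assumes c: "0 < c" "0 < \<beta>"
    and scal: "\<And>r R. 0 < r \<Longrightarrow> r \<le> R \<Longrightarrow> ereal R < R1 \<Longrightarrow> c * (R / r) powr \<beta> * \<phi> (1 / R) \<le> \<phi> (1 / r)"
  shows "\<exists>A>1. \<forall>r. 0 < r \<and> ereal r < R1 \<longrightarrow> ennreal (1 / (16 * \<phi> (1 / r))) \<le> emeasure U {r / A<..r}"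
proof -
  \<comment> \<open>the second entry makes \<open>exp 1 / \<phi> (A / r) \<le> 1 / (16 * \<phi> (1 / r))\<close>\<close>
  define A where "A = max 2 ((16 * exp 1 / c) powr (1 / \<beta>))"
  have A: "2 \<le> A" by (simp add: A_def)
  have "16 * exp 1 / c = ((16 * exp 1 / c) powr (1 / \<beta>)) powr \<beta>"
    using c by (simp add: powr_powr)
  also have "\<dots> \<le> A powr \<beta>" unfolding A_def using c by (intro powr_mono2) auto
  finally have Ab: "16 * exp 1 \<le> c * A powr \<beta>" using c by (simp add: field_simps)
  show ?thesis
  proof (intro exI[of _ A] conjI allI impI)
    fix r assume r: "0 < r \<and> ereal r < R1"
    have p: "0 < \<phi> (1 / r)" using r by (intro \<phi>_pos) auto
    have "16 * exp 1 * \<phi> (1 / r) \<le> c * A powr \<beta> * \<phi> (1 / r)" using Ab p by (intro mult_right_mono) auto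
    also have "\<dots> = c * (r / (r / A)) powr \<beta> * \<phi> (1 / r)" using r by simp
    also have "\<dots> \<le> \<phi> (1 / (r / A))" using r A by (intro scal) (auto simp: field_simps)
    finally have q: "16 * exp 1 * \<phi> (1 / r) \<le> \<phi> (1 / (r / A))" .
    have "ennreal (1 / (16 * \<phi> (1 / r))) + ennreal (1 / (16 * \<phi> (1 / r))) = ennreal (1 / (8 * \<phi> (1 / r)))"
      using p by (simp flip: ennreal_plus)
    also have "\<dots> \<le> emeasure U {..r}" using r by (intro potential_lower) auto
    also have "\<dots> = emeasure U ({r / A<..r} \<union> {..r / A})"
      using r A by (intro arg_cong[where f = "emeasure U"]) (auto simp: field_simps intro: order_trans)
    also have "\<dots> \<le> emeasure U {r / A<..r} + emeasure U {..r / A}"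
      by (intro emeasure_subadditive) (auto simp: sets_U)
    also have "emeasure U {..r / A} \<le> ennreal (exp 1 / \<phi> (1 / (r / A)))"
      using r A by (intro potential_upper) auto
    also have "\<dots> \<le> ennreal (exp 1 / (16 * exp 1 * \<phi> (1 / r)))"
      using q p by (intro ennreal_leI frac_le) auto
    also have "exp 1 / (16 * exp 1 * \<phi> (1 / r)) = 1 / (16 * \<phi> (1 / r))" by simp
    finally show "ennreal (1 / (16 * \<phi> (1 / r))) \<le> emeasure U {r / A<..r}"
      by (simp add: add.commute ennreal_add_left_cancel_le)
  qed (use A in auto)
qed

lemma sigma_finite_U: "sigma_finite_measure U"
proof
  have "UNIV = (\<Union>n. {..real (Suc n)})"
  proof (intro set_eqI iffI)
    fix x :: real
    obtain n where "x \<le> real n" using real_arch_simple by blast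
    hence "x \<le> real (Suc n)" by simp
    thus "x \<in> (\<Union>n. {..real (Suc n)})" by blast
  qed simp
  moreover have "emeasure U {..real (Suc n)} \<noteq> \<infinity>" for n
    using potential_upper[of "real (Suc n)"] by (auto simp: top_unique)
  ultimately show "\<exists>A. countable A \<and> A \<subseteq> sets U \<and> \<Union> A = space U \<and> (\<forall>a\<in>A. emeasure U a \<noteq> \<infinity>)"
    using sets_eq_imp_space_eq[OF sets_U]
    by (intro exI[of _ "range (\<lambda>n. {..real (Suc n)})"]) (auto simp: sets_U)
qed

lemma \<phi>_measurable: "(\<lambda>r. \<phi> (1 / r)) \<in> borel_measurable (restrict_space borel {0<..})"
proof -
  have "mono_on {0<..} (\<lambda>r. - \<phi> (1 / r))"
    by (auto intro!: mono_onI \<phi>_mono simp: field_simps)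
  hence "(\<lambda>r. - \<phi> (1 / r)) \<in> borel_measurable (restrict_space borel {0<..})"
    by (rule borel_measurable_mono_on_fnc)
  thus ?thesis by simp
qed

lemma weight_measurable:
  "(\<lambda>r. wt r * indicator {0<..} r) \<in> borel_measurable borel"
proof -
  note [measurable] = \<phi>_measurable
  have [measurable]: "(\<lambda>r::real. r) \<in> borel_measurable (restrict_space borel {0<..})"
    by (rule measurable_restrict_space1) simp
  have "(\<lambda>r. wt r) \<in> borel_measurable (restrict_space borel {0<..})"
    by measurable
  thus ?thesis by (subst (asm) borel_measurable_restrict_space_iff_ennreal) auto
qed

text \<open>
  Each \<open>s\<close> lies in \<open>[r,2r)\<close> for a set of scales \<open>r\<close> of \<open>dr/r\<close>-measure at least \<open>1/2\<close>, so averaging over \<open>r\<close>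
  loses at most a factor \<open>2\<close>. After interchanging the integrals only the mass of \<open>[r,2r)\<close> enters.
  The scales that occur satisfy \<open>r \<le> s < T\<close>, hence the bound stops at the same time \<open>T\<close>.
\<close>

lemma nn_integral_potential_le:
  assumes [measurable]: "g \<in> borel_measurable borel" "k \<in> borel_measurable borel"
    and le: "\<And>r s. 0 < r \<Longrightarrow> r \<le> s \<Longrightarrow> s < 2 * r \<Longrightarrow> ereal s < T \<Longrightarrow> g s \<le> k r"
  shows "(\<integral>\<^sup>+s. g s * indicator {s. 0 < s \<and> ereal s < T} s \<partial>U) \<le>
     ennreal (4 * exp 1) * (\<integral>\<^sup>+r. k r * wt r * indicator {r. 0 < r \<and> ereal r < T} r \<partial>lborel)"
proof -
  interpret U: sigma_finite_measure U by (rule sigma_finite_U)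
  interpret pair_sigma_finite U lborel ..
  let ?I = "{s. 0 < s \<and> ereal s < T}"
  let ?K = "\<lambda>r. k r * (wt r * indicator {0<..} r) * indicator ?I r"
  define F where "F s r = 2 * (g s * indicator ?I s) * ennreal (1 / r) * indicator {(s, r). r \<le> s \<and> s < 2 * r} (s, r)" for s r
  have [measurable]: "?I \<in> sets borel" by measurable
  have "(\<integral>\<^sup>+s. g s * indicator ?I s \<partial>U) \<le> (\<integral>\<^sup>+s. (\<integral>\<^sup>+r. F s r \<partial>lborel) \<partial>U)"
  proof (intro nn_integral_mono)
    fix s
    show "g s * indicator ?I s \<le> (\<integral>\<^sup>+r. F s r \<partial>lborel)"
    proof (cases "s \<in> ?I")
      case True
      hence s: "0 < s" by simp
      have "ennreal 2 * (ennreal (1 / s) * ennreal (s - s / 2)) = 1"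
        using s by (subst ennreal_mult_triple) auto
      hence "g s * indicator ?I s = (g s * indicator ?I s) * (ennreal 2 * (ennreal (1 / s) * ennreal (s - s / 2)))"
        by (simp only: mult_1_right)
      also have "\<dots> = 2 * (g s * indicator ?I s) * (ennreal (1 / s) * ennreal (s - s / 2))"
        by (simp only: mult_ac ennreal_numeral)
      also have "\<dots> = (\<integral>\<^sup>+r. 2 * (g s * indicator ?I s) * ennreal (1 / s) * indicator {s / 2<..s} r \<partial>lborel)"
        using s by (subst nn_integral_cmult_indicator) (auto simp: mult_ac)
      also have "\<dots> \<le> (\<integral>\<^sup>+r. F s r \<partial>lborel)"
        unfolding F_def using s
        by (intro nn_integral_mono) (auto simp: indicator_def intro!: mult_left_mono ennreal_leI divide_left_mono)
      finally show ?thesis .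
    qed simp
  qed
  also have "\<dots> = (\<integral>\<^sup>+r. (\<integral>\<^sup>+s. F s r \<partial>U) \<partial>lborel)"
    by (rule Fubini'[symmetric]) (simp add: F_def split_def indicator_def, measurable)
  also have "\<dots> \<le> (\<integral>\<^sup>+r. ennreal (4 * exp 1) * (?K r) \<partial>lborel)"
  proof (intro nn_integral_mono)
    fix r :: real
    show "(\<integral>\<^sup>+s. F s r \<partial>U) \<le> ennreal (4 * exp 1) * (?K r)"
    proof (cases "r \<in> ?I")
      case False
      have "F s r = 0" for s
        using False by (auto simp: F_def indicator_def) (meson ereal_less_eq(3) order_le_less_trans)
      thus ?thesis by simp
    next
      case True
      hence r: "0 < r" by simp
      have p: "0 < \<phi> (1 / r)" "0 < \<phi> (1 / (2 * r))" using r by (auto intro!: \<phi>_pos)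
      have "(\<integral>\<^sup>+s. F s r \<partial>U) \<le> (\<integral>\<^sup>+s. 2 * k r * ennreal (1 / r) * indicator {..2 * r} s \<partial>U)"
        unfolding F_def using le[OF r]
        by (intro nn_integral_mono) (auto simp: indicator_def intro!: mult_mono)
      also have "\<dots> = 2 * k r * ennreal (1 / r) * emeasure U {..2 * r}"
        by (rule nn_integral_cmult_indicator) (simp add: sets_U)
      also have "\<dots> \<le> 2 * k r * ennreal (1 / r) * ennreal (2 * exp 1 / \<phi> (1 / r))"
      proof (rule mult_left_mono)
        have "emeasure U {..2 * r} \<le> ennreal (exp 1 / \<phi> (1 / (2 * r)))" using r by (intro potential_upper) auto
        also have "\<dots> \<le> ennreal (2 * exp 1 / \<phi> (1 / r))"
          using \<phi>_double[of "1 / (2 * r)"] r p by (intro ennreal_leI) (simp add: field_simps)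
        finally show "emeasure U {..2 * r} \<le> ennreal (2 * exp 1 / \<phi> (1 / r))" .
      qed simp
      also have "\<dots> = k r * (ennreal 2 * (ennreal (1 / r) * ennreal (2 * exp 1 / \<phi> (1 / r))))"
        by (simp add: mult_ac)
      also have "ennreal 2 * (ennreal (1 / r) * ennreal (2 * exp 1 / \<phi> (1 / r))) = ennreal (4 * exp 1) * wt r"
        using r p by (subst ennreal_mult_triple) (auto simp flip: ennreal_mult)
      finally show ?thesis using True r by (simp add: mult_ac)
    qed
  qed
  also have "\<dots> = ennreal (4 * exp 1) * (\<integral>\<^sup>+r. (?K r) \<partial>lborel)"
    by (rule nn_integral_cmult) (use weight_measurable in measurable)
  also have "(\<integral>\<^sup>+r. (?K r) \<partial>lborel) =
     (\<integral>\<^sup>+r. k r * wt r * indicator ?I r \<partial>lborel)"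
    by (intro nn_integral_cong) (auto simp: indicator_def)
  finally show ?thesis .
qed

text \<open>
  The converse averaging: each \<open>s\<close> lies in \<open>(r/A,r]\<close> for a set of scales of \<open>dr/r\<close>-measure at most
  \<open>A - 1\<close>. The annuli extend downwards from \<open>r\<close>, so that only the range of \<open>r\<close> has to respect an upper
  limit on the scales.
\<close>

lemma nn_integral_potential_ge:
  assumes [measurable]: "g \<in> borel_measurable borel" and A: "1 < A"
    and ann: "\<And>r. r \<in> I \<Longrightarrow> 0 < r \<and> ennreal (1 / (16 * \<phi> (1 / r))) \<le> emeasure U {r / A<..r}"
    and le: "\<And>r s. r \<in> I \<Longrightarrow> r / A < s \<Longrightarrow> s \<le> r \<Longrightarrow> k r \<le> g s"
  shows "(\<integral>\<^sup>+r. k r * wt r * indicator I r \<partial>lborel) \<le>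
     ennreal (16 * (A - 1)) * (\<integral>\<^sup>+s. g s * indicator {0<..} s \<partial>U)"
proof -
  interpret U: sigma_finite_measure U by (rule sigma_finite_U)
  interpret pair_sigma_finite U lborel ..
  define G where "G s r = 16 * (g s * indicator {0<..} s) * ennreal (1 / r) * indicator {(s, r). s \<le> r \<and> r < s * A} (s, r)" for s r
  have "(\<integral>\<^sup>+r. k r * wt r * indicator I r \<partial>lborel) \<le> (\<integral>\<^sup>+r. (\<integral>\<^sup>+s. G s r \<partial>U) \<partial>lborel)"
  proof (intro nn_integral_mono)
    fix r :: real
    show "k r * wt r * indicator I r \<le> (\<integral>\<^sup>+s. G s r \<partial>U)"
    proof (cases "r \<in> I")
      case True
      hence r: "0 < r" using ann by auto
      have p: "0 < \<phi> (1 / r)" using r by (auto intro!: \<phi>_pos)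
      have "k r * wt r * indicator I r = 16 * k r * ennreal (1 / r) * ennreal (1 / (16 * \<phi> (1 / r)))"
      proof -
        have "wt r = ennreal 16 * (ennreal (1 / r) * ennreal (1 / (16 * \<phi> (1 / r))))"
          using r p by (simp del: ennreal_numeral flip: ennreal_mult)
        thus ?thesis using True by (simp add: mult_ac)
      qed
      also have "\<dots> \<le> 16 * k r * ennreal (1 / r) * emeasure U {r / A<..r}"
        using ann[OF True] by (intro mult_left_mono) auto
      also have "\<dots> = (\<integral>\<^sup>+s. 16 * k r * ennreal (1 / r) * indicator {r / A<..r} s \<partial>U)"
        by (rule nn_integral_cmult_indicator[symmetric]) (simp add: sets_U)
      also have "\<dots> \<le> (\<integral>\<^sup>+s. G s r \<partial>U)"
      proof (intro nn_integral_mono)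
        fix s
        have "0 < s" if "r / A < s" using that r A by (meson divide_pos_pos less_trans zero_less_one)
        thus "16 * k r * ennreal (1 / r) * indicator {r / A<..r} s \<le> G s r"
          using le[OF True, of s] A by (auto simp: G_def indicator_def field_simps intro!: mult_mono)
      qed
      finally show ?thesis .
    qed simp
  qed
  also have "\<dots> = (\<integral>\<^sup>+s. (\<integral>\<^sup>+r. G s r \<partial>lborel) \<partial>U)"
    by (rule Fubini') (simp add: G_def split_def indicator_def, measurable)
  also have "\<dots> \<le> (\<integral>\<^sup>+s. ennreal (16 * (A - 1)) * (g s * indicator {0<..} s) \<partial>U)"
  proof (intro nn_integral_mono)
    fix s :: real
    show "(\<integral>\<^sup>+r. G s r \<partial>lborel) \<le> ennreal (16 * (A - 1)) * (g s * indicator {0<..} s)"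
    proof (cases "0 < s")
      case True
      have "(\<integral>\<^sup>+r. G s r \<partial>lborel) \<le> (\<integral>\<^sup>+r. 16 * (g s * indicator {0<..} s) * ennreal (1 / s) * indicator {s..<s * A} r \<partial>lborel)"
        unfolding G_def using True
        by (intro nn_integral_mono) (auto simp: indicator_def intro!: mult_left_mono ennreal_leI divide_left_mono)
      also have "\<dots> = 16 * (g s * indicator {0<..} s) * ennreal (1 / s) * ennreal (s * A - s)"
        using True A by (subst nn_integral_cmult_indicator) auto
      also have "\<dots> = g s * indicator {0<..} s * (ennreal 16 * (ennreal (1 / s) * ennreal (s * A - s)))"
        by (simp add: mult_ac)
      also have "ennreal 16 * (ennreal (1 / s) * ennreal (s * A - s)) = ennreal (16 * (A - 1))"
        using True A by (subst ennreal_mult_triple) (auto simp: field_simps)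
      finally show ?thesis by (simp add: mult_ac)
    qed (simp add: G_def)
  qed
  also have "\<dots> = ennreal (16 * (A - 1)) * (\<integral>\<^sup>+s. g s * indicator {0<..} s \<partial>U)"
    by (rule nn_integral_cmult) measurable
  finally show ?thesis .
qed

end

lemma potential_estimates_subordinator:
  assumes drift: "driftless_subordinator M S \<nu>" and poly: "Poly_cond \<nu> R1" and R1: "0 < R1"
  shows "potential_estimates (potential_measure M S) (laplace_exponent M S)"
proof
  have sub: "subordinator M S" using drift by (simp add: driftless_subordinator_def)
  note pos = laplace_exponent_pos[OF drift poly R1]
  show "sets (potential_measure M S) = sets borel" by (rule sets_potential_measure[OF sub])
  show "AE s in potential_measure M S. 0 \<le> s" by (rule potential_measure_nonneg[OF sub])
  show "0 < laplace_exponent M S u" if "0 < u" for u using pos[OF that] .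
  show "(\<integral>\<^sup>+s. ennreal (exp (- u * s)) \<partial>potential_measure M S) = ennreal (1 / laplace_exponent M S u)"
    if "0 < u" for u
    using laplace_potential_measure[OF sub less_imp_le[OF that] pos[OF that]] .
  show "laplace_exponent M S u \<le> laplace_exponent M S v" if "0 < u" "u \<le> v" for u v
    using laplace_exponent_mono[OF drift _ that(2)] that by simp
  show "laplace_exponent M S (2 * u) \<le> 2 * laplace_exponent M S u" if "0 < u" for u
    using laplace_exponent_double[OF drift] that by simp
qed

section \<open>Scale functions and their inverses\<close>

lemma scale_function_less: "scale_function \<Phi> \<Longrightarrow> 0 \<le> r \<Longrightarrow> r < R \<Longrightarrow> \<Phi> r < \<Phi> R"
  unfolding scale_function_def by (elim conjE) (rule strict_mono_onD[of "{0..}" \<Phi>], auto)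

lemma scale_function_mono: "scale_function \<Phi> \<Longrightarrow> 0 \<le> r \<Longrightarrow> r \<le> R \<Longrightarrow> \<Phi> r \<le> \<Phi> R"
  using scale_function_less[of \<Phi> r R] by (cases "r = R") auto

lemma scale_function_pos: "scale_function \<Phi> \<Longrightarrow> 0 < r \<Longrightarrow> 0 < \<Phi> r"
  using scale_function_less[of \<Phi> 0 r] by (auto simp: scale_function_def intro: le_less_trans)

lemma scale_function_lower:
  assumes "scale_function \<Phi>"
  obtains a c where "0 < a" "0 < c" "\<And>r R. 0 < r \<Longrightarrow> r \<le> R \<Longrightarrow> c * (R / r) powr a * \<Phi> r \<le> \<Phi> R"
proof -
  obtain a c where ac: "0 < a" "0 < c" "\<And>r R. 0 < r \<Longrightarrow> r \<le> R \<Longrightarrow> c * (R / r) powr a \<le> \<Phi> R / \<Phi> r"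
    using assms unfolding scale_function_def by metis
  have "c * (R / r) powr a * \<Phi> r \<le> \<Phi> R" if "0 < r" "r \<le> R" for r R
    using ac(3)[OF that] scale_function_pos[OF assms that(1)] by (simp add: pos_le_divide_eq)
  thus ?thesis using that ac by blast
qed

lemma scale_function_upper:
  assumes "scale_function \<Phi>"
  obtains a c where "0 < a" "0 < c" "\<And>r R. 0 < r \<Longrightarrow> r \<le> R \<Longrightarrow> \<Phi> R \<le> c * (R / r) powr a * \<Phi> r"
proof -
  obtain a c where ac: "0 < a" "0 < c" "\<And>r R. 0 < r \<Longrightarrow> r \<le> R \<Longrightarrow> \<Phi> R / \<Phi> r \<le> c * (R / r) powr a"
    using assms unfolding scale_function_def by metis
  have "\<Phi> R \<le> c * (R / r) powr a * \<Phi> r" if "0 < r" "r \<le> R" for r R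
    using ac(3)[OF that] scale_function_pos[OF assms that(1)] by (simp add: pos_divide_le_eq)
  thus ?thesis using that ac by blast
qed

lemma scale_function_unbounded:
  assumes "scale_function \<Phi>"
  shows "\<exists>r>0. t < \<Phi> r"
proof -
  obtain a c where ac: "0 < a" "0 < c" "\<And>r R. 0 < r \<Longrightarrow> r \<le> R \<Longrightarrow> c * (R / r) powr a * \<Phi> r \<le> \<Phi> R"
    using scale_function_lower[OF assms] by blast
  have p: "0 < c * \<Phi> 1" using ac scale_function_pos[OF assms, of 1] by simp
  define b where "b = (\<bar>t\<bar> + 1) / (c * \<Phi> 1)"
  have b: "0 < b" using p by (simp add: b_def)
  define R where "R = max 1 (b powr (1 / a))"
  have R: "1 \<le> R" by (simp add: R_def)
  have "b = (b powr (1 / a)) powr a" using b ac by (simp add: powr_powr)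
  also have "\<dots> \<le> R powr a" unfolding R_def using ac by (intro powr_mono2) auto
  finally have "b * (c * \<Phi> 1) \<le> R powr a * (c * \<Phi> 1)" using p by (intro mult_right_mono) auto
  hence "\<bar>t\<bar> + 1 \<le> R powr a * (c * \<Phi> 1)" using ac(2) scale_function_pos[OF assms, of 1] by (simp add: b_def)
  also have "\<dots> \<le> \<Phi> R" using ac(3)[of 1 R] R by (simp add: mult_ac)
  finally show ?thesis using R by (intro exI[of _ R]) auto
qed

lemma scale_function_small:
  assumes "scale_function \<Phi>" and t: "0 < t"
  shows "\<exists>r>0. \<Phi> r \<le> t"
proof -
  obtain a c where ac: "0 < a" "0 < c" "\<And>r R. 0 < r \<Longrightarrow> r \<le> R \<Longrightarrow> c * (R / r) powr a * \<Phi> r \<le> \<Phi> R"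
    using scale_function_lower[OF assms(1)] by blast
  have p: "0 < \<Phi> 1" using scale_function_pos[OF assms(1), of 1] by simp
  define b where "b = c * t / \<Phi> 1"
  have b: "0 < b" using p ac t by (simp add: b_def)
  define r where "r = min 1 (b powr (1 / a))"
  have r: "0 < r" "r \<le> 1" using b by (auto simp: r_def)
  have "r powr a \<le> (b powr (1 / a)) powr a" using ac r by (intro powr_mono2) (auto simp: r_def)
  also have "\<dots> = b" using b ac by (simp add: powr_powr)
  finally have rb: "r powr a \<le> b" .
  have "c * (1 / r) powr a * \<Phi> r \<le> \<Phi> 1" using ac(3)[of r 1] r by simp
  hence "c * \<Phi> r \<le> \<Phi> 1 * r powr a" using r by (simp add: powr_divide field_simps)
  also have "\<dots> \<le> \<Phi> 1 * b" using rb p by (intro mult_left_mono) auto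
  also have "\<dots> = c * t" using p by (simp add: b_def)
  finally show ?thesis using ac r by (intro exI[of _ r]) auto
qed

lemma scale_inv_le: "0 \<le> r \<Longrightarrow> t < \<Phi> r \<Longrightarrow> scale_inv \<Phi> t \<le> r"
  unfolding scale_inv_def by (rule cInf_lower) (auto intro: bdd_belowI[of _ 0])

lemma scale_inv_ge:
  assumes "scale_function \<Phi>" "\<Phi> r \<le> t"
  shows "r \<le> scale_inv \<Phi> t"
  unfolding scale_inv_def
proof (rule cInf_greatest)
  show "{r. 0 \<le> r \<and> t < \<Phi> r} \<noteq> {}"
    using scale_function_unbounded[OF assms(1), of t] by (auto intro: less_imp_le)
  fix v assume "v \<in> {r. 0 \<le> r \<and> t < \<Phi> r}"
  hence "\<Phi> r < \<Phi> v" "0 \<le> v" using assms(2) by auto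
  thus "r \<le> v" using scale_function_mono[OF assms(1), of v r] by (cases "v \<le> r") auto
qed

lemma scale_inv_less:
  assumes "scale_function \<Phi>" "scale_inv \<Phi> t < v"
  shows "t < \<Phi> v"
  using scale_inv_ge[OF assms(1), of v t] assms(2) by (meson not_le)

lemma scale_inv_eq:
  assumes "scale_function \<Phi>" "0 \<le> r"
  shows "scale_inv \<Phi> (\<Phi> r) = r"
proof (rule antisym)
  show "scale_inv \<Phi> (\<Phi> r) \<le> r"
  proof (rule dense_ge)
    fix v assume "r < v"
    thus "scale_inv \<Phi> (\<Phi> r) \<le> v"
      using assms(2) scale_function_less[OF assms, of v] by (intro scale_inv_le) auto
  qed
qed (use assms in \<open>auto intro: scale_inv_ge\<close>)

lemma scale_inv_mono:
  assumes "scale_function \<Phi>" "s \<le> t"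
  shows "scale_inv \<Phi> s \<le> scale_inv \<Phi> t"
proof (rule dense_ge)
  fix v assume v: "scale_inv \<Phi> t < v"
  have "0 \<le> scale_inv \<Phi> t" unfolding scale_inv_def
    using scale_function_unbounded[OF assms(1), of t] by (intro cInf_greatest) (auto intro: less_imp_le)
  thus "scale_inv \<Phi> s \<le> v" using scale_inv_less[OF assms(1) v] v assms(2) by (intro scale_inv_le) auto
qed

lemma scale_inv_pos:
  assumes "scale_function \<Phi>" "0 < t"
  shows "0 < scale_inv \<Phi> t"
proof -
  obtain r where "0 < r" "\<Phi> r \<le> t" using scale_function_small[OF assms] by blast
  thus ?thesis using scale_inv_ge[OF assms(1), of r t] by simp
qed

text \<open>
  The lower scaling bound for \<open>\<Phi>\<close> is an upper scaling bound for its inverse. Since \<open>\<Phi>\<close> may jump, the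
  proof compares with points \<open>v\<close> slightly above \<open>scale_inv \<Phi> t\<close>.
\<close>

lemma scale_inv_mult:
  assumes \<Phi>: "scale_function \<Phi>" and A: "0 < A"
  shows "\<exists>C\<ge>1. \<forall>t>0. scale_inv \<Phi> (A * t) \<le> C * scale_inv \<Phi> t"
proof -
  obtain a c where ac: "0 < a" "0 < c" "\<And>r R. 0 < r \<Longrightarrow> r \<le> R \<Longrightarrow> c * (R / r) powr a * \<Phi> r \<le> \<Phi> R"
    using scale_function_lower[OF \<Phi>] by blast
  define C where "C = max 1 ((A / c) powr (1 / a))"
  have C: "1 \<le> C" by (simp add: C_def)
  have "A / c = ((A / c) powr (1 / a)) powr a" using A ac by (simp add: powr_powr)
  also have "\<dots> \<le> C powr a" unfolding C_def using ac by (intro powr_mono2) auto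
  finally have AC: "A \<le> c * C powr a" using ac by (simp add: field_simps)
  show ?thesis
  proof (intro exI[of _ C] conjI allI impI C)
    fix t :: real assume t: "0 < t"
    have "scale_inv \<Phi> (A * t) / C \<le> scale_inv \<Phi> t"
    proof (rule dense_ge)
      fix v assume v: "scale_inv \<Phi> t < v"
      have v0: "0 < v" using scale_inv_pos[OF \<Phi> t] v by simp
      have "A * t \<le> c * C powr a * t" using AC t by (intro mult_right_mono) auto
      also have "\<dots> < c * C powr a * \<Phi> v" using scale_inv_less[OF \<Phi> v] ac C by (intro mult_strict_left_mono) auto
      also have "\<dots> \<le> \<Phi> (C * v)" using ac(3)[of v "C * v"] C v0 by simp
      finally have "scale_inv \<Phi> (A * t) \<le> C * v" using C v0 by (intro scale_inv_le) auto
      thus "scale_inv \<Phi> (A * t) / C \<le> v" using C by (simp add: pos_divide_le_eq mult.commute)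
    qed
    thus "scale_inv \<Phi> (A * t) \<le> C * scale_inv \<Phi> t" using C by (simp add: pos_divide_le_eq mult.commute)
  qed
qed

text \<open>
  The upper scaling bound for \<open>\<Phi>\<close>, with \<open>t\<close> in the place of \<open>\<Phi> (scale_inv \<Phi> t)\<close>. These numbers may
  differ if \<open>\<Phi>\<close> jumps, but \<open>\<Phi>\<close> is at most \<open>t\<close> at half the argument.
\<close>

lemma scale_ratio_le:
  assumes \<Phi>: "scale_function \<Phi>"
  shows "\<exists>C>0. \<exists>a>0. \<forall>t>0. \<forall>\<rho>\<ge>scale_inv \<Phi> t. \<Phi> \<rho> / t \<le> C * (\<rho> / scale_inv \<Phi> t) powr a"
proof -
  obtain a c where ac: "0 < a" "0 < c" "\<And>r R. 0 < r \<Longrightarrow> r \<le> R \<Longrightarrow> \<Phi> R \<le> c * (R / r) powr a * \<Phi> r"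
    using scale_function_upper[OF \<Phi>] by blast
  have "\<Phi> \<rho> / t \<le> c * 2 powr a * (\<rho> / scale_inv \<Phi> t) powr a"
    if t: "0 < t" and \<rho>: "scale_inv \<Phi> t \<le> \<rho>" for t \<rho>
  proof -
    define u where "u = scale_inv \<Phi> t"
    have u: "0 < u" unfolding u_def by (rule scale_inv_pos[OF \<Phi> t])
    have "\<Phi> (u / 2) \<le> t" using scale_inv_le[of "u / 2" t \<Phi>] u unfolding u_def[symmetric] by (cases "t < \<Phi> (u / 2)") auto
    hence "c * (\<rho> / (u / 2)) powr a * \<Phi> (u / 2) \<le> c * (\<rho> / (u / 2)) powr a * t"
      using ac by (intro mult_left_mono) auto
    with ac(3)[of "u / 2" \<rho>] have "\<Phi> \<rho> \<le> c * (\<rho> / (u / 2)) powr a * t" using u \<rho> by (simp add: u_def)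
    also have "\<rho> / (u / 2) = 2 * (\<rho> / u)" by simp
    also have "c * (2 * (\<rho> / u)) powr a * t = (c * 2 powr a * (\<rho> / u) powr a) * t"
      using u \<rho> by (subst powr_mult) (auto simp: u_def)
    finally show "\<Phi> \<rho> / t \<le> c * 2 powr a * (\<rho> / scale_inv \<Phi> t) powr a"
      using t by (simp add: u_def pos_divide_le_eq)
  qed
  moreover have "0 < c * 2 powr a" using ac by simp
  ultimately show ?thesis using ac by blast
qed

lemma powr_times_exp_bounded:
  assumes "0 < (b::real)" "0 < c"
  shows "\<exists>K>0. \<forall>z\<ge>1. exp (- (c * z\<^sup>2)) * z powr b \<le> K"
proof (intro exI[of _ "(b / c) powr b"] conjI allI impI)
  fix z :: real assume z: "1 \<le> z"
  have "c / b * z \<le> exp (c / b * z)" using exp_ge_add_one_self[of "c / b * z"] by linarith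
  hence "(c / b * z) powr b \<le> exp (c / b * z) powr b" using assms z by (intro powr_mono2) auto
  also have "exp (c / b * z) powr b = exp (c * z)" using assms by (simp add: powr_def)
  also have "\<dots> \<le> exp (c * z\<^sup>2)" using z assms by (simp add: power2_eq_square)
  finally have "(c / b * z) powr b \<le> exp (c * z\<^sup>2)" .
  hence "(b / c) powr b * (c / b * z) powr b \<le> (b / c) powr b * exp (c * z\<^sup>2)" by (intro mult_left_mono) auto
  also have "(b / c) powr b * (c / b * z) powr b = z powr b"
    using assms z by (subst powr_mult[symmetric]) auto
  finally show "exp (- (c * z\<^sup>2)) * z powr b \<le> (b / c) powr b"
    by (simp add: exp_minus inverse_eq_divide pos_divide_le_eq)
qed (use assms in auto)

section \<open>Volumes of balls\<close>

lemma emeasure_ball_vol: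
  fixes m :: "'a::heine_borel measure"
  assumes "radon_measure m"
  shows "emeasure m (ball x r) = ennreal (vol m x r)"
proof -
  have sets: "sets m = sets borel" using assms by (simp add: radon_measure_def)
  have "emeasure m (ball x r) \<le> emeasure m (cball x r)" by (intro emeasure_mono) (auto simp: sets)
  also have "\<dots> < \<infinity>"
  proof -
    have "\<forall>K. compact K \<longrightarrow> emeasure m K < \<infinity>" using assms unfolding radon_measure_def by (elim conjE)
    thus ?thesis using compact_cball by blast
  qed
  finally show ?thesis by (simp add: vol_def emeasure_eq_ennreal_measure)
qed

lemma vol_nonneg: "0 \<le> vol m x r" by (simp add: vol_def)

lemma vol_subset:
  fixes m :: "'a::heine_borel measure"
  assumes "radon_measure m" "ball x r \<subseteq> ball y R"
  shows "vol m x r \<le> vol m y R"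
proof -
  have sets: "sets m = sets borel" using assms by (simp add: radon_measure_def)
  have "emeasure m (ball x r) \<le> emeasure m (ball y R)"
    using assms(2) by (intro emeasure_mono) (auto simp: sets)
  thus ?thesis using assms(1) by (simp add: emeasure_ball_vol vol_nonneg)
qed

lemma vol_mono:
  fixes m :: "'a::heine_borel measure"
  assumes "radon_measure m" "r \<le> R"
  shows "vol m x r \<le> vol m x R"
  using assms by (intro vol_subset) auto

lemma vol_pos:
  fixes m :: "'a::heine_borel measure"
  assumes "radon_measure m" "full_support m" "0 < r"
  shows "0 < vol m x r"
proof -
  have "0 < emeasure m (ball x r)" using assms by (auto simp: full_support_def)
  thus ?thesis using assms(1) by (simp add: emeasure_ball_vol)
qed

text \<open>
  The constant of \<open>volume_growth\<close> depends on the multiple of \<open>R_E\<close> below which the radii stay. It is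
  uniform if the radii are bounded by some \<open>L\<close> (case \<open>b\<close>) or if \<open>R_E\<close> is infinite.
\<close>

lemma vol_doubling:
  fixes m :: "'a::heine_borel measure"
  assumes "radon_measure m" "full_support m" "volume_growth m R_E d1 d2" "b \<or> R_E = \<infinity>"
  shows "\<exists>C\<ge>1. \<forall>x r R. 0 < r \<and> r \<le> R \<and> (b \<longrightarrow> R \<le> L) \<longrightarrow> vol m x R \<le> C * (R / r) powr d2 * vol m x r"
proof -
  have RE: "0 < R_E" using assms by (simp add: volume_growth_def)
  have "\<exists>a\<ge>1. \<forall>R. (b \<longrightarrow> R \<le> L) \<longrightarrow> ereal R < ereal a * R_E"
  proof (cases R_E)
    case (real \<rho>)
    hence \<rho>: "0 < \<rho>" using RE by simp
    define a where "a = max 1 ((L + 1) / \<rho>)"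
    have "(L + 1) / \<rho> * \<rho> \<le> a * \<rho>" unfolding a_def using \<rho> by (intro mult_right_mono) auto
    hence "L < a * \<rho>" using \<rho> by simp
    moreover have b using assms(4) real by simp
    moreover have "1 \<le> a" by (simp add: a_def)
    ultimately show ?thesis using real by (intro exI[of _ a]) auto
  next
    case PInf
    thus ?thesis by (intro exI[of _ 1]) simp
  qed (use RE in simp)
  then obtain a where a: "1 \<le> a" "\<And>R. (b \<longrightarrow> R \<le> L) \<Longrightarrow> ereal R < ereal a * R_E" by blast
  have "\<exists>C\<ge>1. \<forall>x r R. 0 < r \<and> r \<le> R \<and> ereal R < ereal a * R_E \<longrightarrow>
        (R / r) powr d1 / C \<le> vol m x R / vol m x r \<and> vol m x R / vol m x r \<le> C * (R / r) powr d2"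
    using assms(3) a(1) unfolding volume_growth_def by simp
  then obtain C where C: "1 \<le> C" "\<And>x r R. 0 < r \<Longrightarrow> r \<le> R \<Longrightarrow> ereal R < ereal a * R_E \<Longrightarrow>
       vol m x R / vol m x r \<le> C * (R / r) powr d2"
    by blast
  show ?thesis
  proof (intro exI[of _ C] conjI allI impI C)
    fix x r R assume "0 < r \<and> r \<le> R \<and> (b \<longrightarrow> R \<le> L)"
    thus "vol m x R \<le> C * (R / r) powr d2 * vol m x r"
      using C(2)[of r R x] a(2)[of R] vol_pos[OF assms(1,2), of r x] by (simp add: pos_divide_le_eq)
  qed
qed

lemma volume_growth_lower:
  fixes m :: "'a::heine_borel measure"
  assumes "radon_measure m" "full_support m" "volume_growth m \<infinity> d1 d2"
  shows "\<exists>C>0. \<forall>x r R. 0 < r \<and> r \<le> R \<longrightarrow> (R / r) powr d1 / C * vol m x r \<le> vol m x R"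
proof -
  have "\<exists>C\<ge>1. \<forall>x r R. 0 < r \<and> r \<le> R \<and> ereal R < ereal 1 * \<infinity> \<longrightarrow>
        (R / r) powr d1 / C \<le> vol m x R / vol m x r \<and> vol m x R / vol m x r \<le> C * (R / r) powr d2"
    using assms(3) unfolding volume_growth_def by (elim conjE) (drule spec[of _ 1], simp)
  then obtain C where C: "1 \<le> C" "\<And>x r R. 0 < r \<Longrightarrow> r \<le> R \<Longrightarrow> (R / r) powr d1 / C \<le> vol m x R / vol m x r"
    by auto
  have "(R / r) powr d1 / C * vol m x r \<le> vol m x R" if "0 < r" "r \<le> R" for x r R
    using C(2)[OF that, of x] vol_pos[OF assms(1,2) that(1), of x] by (simp add: pos_le_divide_eq)
  thus ?thesis using C(1) by (intro exI[of _ C]) auto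
qed

text \<open>
  A ball of radius \<open>r\<close> centred in \<open>D\<close> and one of radius \<open>diameter D + r\<close> centred in \<open>D\<close> are nested, and
  doubling compares the two radii.
\<close>

lemma vol_uniform:
  fixes m :: "'a::heine_borel measure"
  assumes "radon_measure m" "full_support m" "volume_growth m R_E d1 d2" "bounded D" "0 < r"
  shows "\<exists>v1>0. \<exists>v2>0. \<forall>x\<in>D. v1 \<le> vol m x r \<and> vol m x r \<le> v2"
proof (cases "D = {}")
  case False
  then obtain x0 where x0: "x0 \<in> D" by blast
  define L where "L = diameter D + r"
  have dist: "dist x y \<le> diameter D" if "x \<in> D" "y \<in> D" for x y
    using diameter_bounded_bound[OF assms(4) that] .
  have L: "r \<le> L" using dist[OF x0 x0] by (simp add: L_def)
  obtain C where C: "1 \<le> C" "\<And>x r R. 0 < r \<Longrightarrow> r \<le> R \<Longrightarrow> R \<le> L \<Longrightarrow> vol m x R \<le> C * (R / r) powr d2 * vol m x r"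
    using vol_doubling[OF assms(1-3), of True L] by auto
  define K where "K = C * (L / r) powr d2"
  have K: "0 < K" using C L assms(5) by (simp add: K_def)
  have "vol m x0 r / K \<le> vol m x r \<and> vol m x r \<le> vol m x0 L" if x: "x \<in> D" for x
  proof
    have sub: "ball a r \<subseteq> ball b L" if "a \<in> D" "b \<in> D" for a b
    proof
      fix z assume "z \<in> ball a r"
      thus "z \<in> ball b L" using dist[OF that(2,1)] dist_triangle[of b z a] by (simp add: L_def)
    qed
    have "vol m x0 r \<le> vol m x L" by (rule vol_subset[OF assms(1) sub[OF x0 x]])
    also have "\<dots> \<le> K * vol m x r" unfolding K_def using C(2)[of r L x] assms(5) L by simp
    finally show "vol m x0 r / K \<le> vol m x r" using K by (simp add: pos_divide_le_eq mult.commute)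
    show "vol m x r \<le> vol m x0 L" by (rule vol_subset[OF assms(1) sub[OF x x0]])
  qed
  moreover have "0 < vol m x0 r / K" "0 < vol m x0 L"
    using K vol_pos[OF assms(1,2)] assms(5) L by auto
  ultimately show ?thesis by blast
qed (auto intro: exI[of _ 1])

section \<open>Pointwise comparison of the kernel profile\<close>

text \<open>
  Off the diagonal and for positive times this is \<open>kernel_profile\<close> as a real number; see
  \<open>kernel_profile_eq\<close> below.
\<close>

definition real_profile ::
  "'a::metric_space measure \<Rightarrow> (real \<Rightarrow> real) \<Rightarrow> (real \<Rightarrow> real) \<Rightarrow> real \<Rightarrow> real \<Rightarrow> real \<Rightarrow> 'a \<Rightarrow> 'a \<Rightarrow> real" where
  "real_profile m \<Phi> \<Psi> C0 c t x y =
     min (1 / vol m x (scale_inv \<Phi> t))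
         (C0 * t / (vol m x (dist x y) * \<Psi> (dist x y)) +
          exp (- (c * (dist x y)\<^sup>2 / (scale_inv \<Phi> t)\<^sup>2)) / vol m x (scale_inv \<Phi> t))"

text \<open>
  The doubling assumption covers all radii if \<open>D\<close> is unbounded and the radii up to the inverse of the
  last relevant time if \<open>D\<close> is bounded; this is the form common to both cases of the theorem.
\<close>

locale kernel_setting =
  fixes m :: "'a::heine_borel measure" and \<Phi> \<Psi> :: "real \<Rightarrow> real" and D :: "'a set"
    and h :: "real \<Rightarrow> 'a \<Rightarrow> 'a \<Rightarrow> real" and C0 CV d ch \<gamma> :: real
  assumes radon: "radon_measure m" and full: "full_support m"
    and \<Phi>: "scale_function \<Phi>" and \<Psi>: "scale_function \<Psi>"
    and \<Phi>_le_\<Psi>: "\<And>r. 0 \<le> r \<Longrightarrow> \<Phi> r \<le> \<Psi> r"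
    and h_nonneg: "\<And>s x y. 0 < s \<Longrightarrow> x \<in> D \<Longrightarrow> y \<in> D \<Longrightarrow> 0 \<le> h s x y"
    and h_anti: "\<And>s t x y. x \<in> D \<Longrightarrow> y \<in> D \<Longrightarrow> 0 < s \<Longrightarrow> s \<le> t \<Longrightarrow> h t x y \<le> h s x y"
    and ch: "0 < ch" and \<gamma>: "0 \<le> \<gamma>"
    and h_doubling: "\<And>s t x y. 0 < s \<Longrightarrow> s \<le> t \<Longrightarrow> ereal t < 4 * scale_diam \<Phi> D + 1 \<Longrightarrow>
          x \<in> D \<Longrightarrow> y \<in> D \<Longrightarrow> s powr \<gamma> * h s x y \<le> ch * (t powr \<gamma> * h t x y)"
    and C0: "C0 \<in> {0, 1}"
    and CV: "1 \<le> CV" and d: "0 < d"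
    and doubling: "\<And>x r R. 0 < r \<Longrightarrow> r \<le> R \<Longrightarrow> (bounded D \<Longrightarrow> R \<le> scale_inv \<Phi> (2 * \<Phi> (diameter D))) \<Longrightarrow>
          vol m x R \<le> CV * (R / r) powr d * vol m x r"
begin

abbreviation V where "V \<equiv> vol m"
abbreviation \<Phi>i where "\<Phi>i \<equiv> scale_inv \<Phi>"
definition horizon :: ereal where "horizon = 2 * scale_diam \<Phi> D"

abbreviation profile where "profile \<equiv> kernel_profile m \<Phi> \<Psi> C0"
abbreviation rprofile where "rprofile \<equiv> real_profile m \<Phi> \<Psi> C0"

abbreviation end_time where "end_time \<equiv> 2 * \<Phi> (diameter D)"

lemma V_pos: "0 < r \<Longrightarrow> 0 < V x r" using vol_pos[OF radon full] .
lemma \<Phi>i_pos: "0 < t \<Longrightarrow> 0 < \<Phi>i t" using scale_inv_pos[OF \<Phi>] .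
lemma \<Phi>_pos: "0 < t \<Longrightarrow> 0 < \<Phi> t" using scale_function_pos[OF \<Phi>] .
lemma \<Psi>_pos: "0 < t \<Longrightarrow> 0 < \<Psi> t" using scale_function_pos[OF \<Psi>] .
lemma V\<Phi>i_mono: "s \<le> t \<Longrightarrow> V x (\<Phi>i s) \<le> V x (\<Phi>i t)"
  by (intro vol_mono[OF radon] scale_inv_mono[OF \<Phi>])
lemma V\<Phi>i_pos: "0 < t \<Longrightarrow> 0 < V x (\<Phi>i t)" by (intro V_pos \<Phi>i_pos)
lemma C0_cases: "0 \<le> C0" "C0 \<le> 1" using C0 by auto

lemma horizon_bounded: "bounded D \<Longrightarrow> horizon = ereal end_time"
  by (simp add: scale_diam_def horizon_def flip: times_ereal.simps(1))

lemma scale_diam_nonneg: "0 \<le> scale_diam \<Phi> D"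
proof -
  have "0 \<le> \<Phi> (diameter D)" if "bounded D"
    using \<Phi> diameter_ge_0[OF that] by (simp add: scale_function_def)
  thus ?thesis by (simp add: scale_diam_def)
qed

lemma le_horizon_imp: "ereal t \<le> horizon \<Longrightarrow> ereal t < 4 * scale_diam \<Phi> D + 1"
  using scale_diam_nonneg by (cases "scale_diam \<Phi> D") (auto simp: horizon_def one_ereal_def)

lemma dist_le_diameter: "x \<in> D \<Longrightarrow> y \<in> D \<Longrightarrow> bounded D \<Longrightarrow> dist x y \<le> diameter D"
  using diameter_bounded_bound .

lemma \<Phi>_dist_le: "x \<in> D \<Longrightarrow> y \<in> D \<Longrightarrow> ereal (2 * \<Phi> (dist x y)) \<le> horizon"
  using dist_le_diameter[of x y] scale_function_mono[OF \<Phi>, of "dist x y" "diameter D"]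
  by (cases "bounded D") (auto simp: horizon_bounded, simp add: horizon_def scale_diam_def)

lemma \<Phi>_dist_le': "x \<in> D \<Longrightarrow> y \<in> D \<Longrightarrow> ereal (\<Phi> (dist x y)) \<le> horizon"
proof (rule order_trans[OF _ \<Phi>_dist_le])
  have "0 \<le> \<Phi> (dist x y)" using \<Phi> by (simp add: scale_function_def)
  thus "ereal (\<Phi> (dist x y)) \<le> ereal (2 * \<Phi> (dist x y))" by simp
qed

lemma h_ratio:
  assumes "0 < s" "s \<le> t" "ereal t \<le> horizon" "x \<in> D" "y \<in> D"
  shows "h s x y \<le> ch * (t / s) powr \<gamma> * h t x y"
proof -
  have "s powr \<gamma> * h s x y \<le> ch * (t powr \<gamma> * h t x y)"
    by (rule h_doubling) (use assms le_horizon_imp in auto)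
  hence "h s x y \<le> ch * (t powr \<gamma> * h t x y) / s powr \<gamma>" using assms by (simp add: pos_le_divide_eq mult.commute)
  also have "\<dots> = ch * (t / s) powr \<gamma> * h t x y" using assms by (simp add: powr_divide)
  finally show ?thesis .
qed

lemma doubling_\<Phi>i:
  assumes "0 < r" "r \<le> \<Phi>i t" "ereal t \<le> horizon"
  shows "V x (\<Phi>i t) \<le> CV * (\<Phi>i t / r) powr d * V x r"
  using assms scale_inv_mono[OF \<Phi>, of t "end_time"]
  by (intro doubling) (auto simp: horizon_bounded)

text \<open>
  With respect to \<open>dr / (r \<phi>(1/r))\<close>, the integrands of both integrals of the claim in one function of
  time.
\<close>

definition green_density :: "'a \<Rightarrow> 'a \<Rightarrow> real \<Rightarrow> real" where
  "green_density x y r = (if r < \<Phi> (dist x y) then C0 * r * h r x y / (V x (dist x y) * \<Psi> (dist x y))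
              else h r x y / V x (\<Phi>i r))"

lemma green_density_nonneg: "0 < r \<Longrightarrow> x \<in> D \<Longrightarrow> y \<in> D \<Longrightarrow> 0 \<le> green_density x y r"
  using h_nonneg[of r x y] C0_cases \<Psi> by (auto simp: green_density_def vol_nonneg scale_function_def)

lemma h_measurable:
  assumes "x \<in> D" "y \<in> D"
  shows "(\<lambda>r. h r x y) \<in> borel_measurable (restrict_space borel {0<..})"
proof -
  have "mono_on {0<..} (\<lambda>r. - h r x y)" using h_anti assms by (auto intro!: mono_onI)
  hence "(\<lambda>r. - h r x y) \<in> borel_measurable (restrict_space borel {0<..})"
    by (rule borel_measurable_mono_on_fnc)
  thus ?thesis by simp
qed

lemma V\<Phi>i_measurable: "(\<lambda>r. V x (\<Phi>i r)) \<in> borel_measurable borel"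
  by (rule borel_measurable_mono) (auto intro!: monoI V\<Phi>i_mono)

lemma green_density_measurable:
  assumes "x \<in> D" "y \<in> D"
  shows "(\<lambda>r. ennreal (green_density x y r) * indicator {0<..} r) \<in> borel_measurable borel"
proof -
  note [measurable] = h_measurable[OF assms] measurable_restrict_space1[OF V\<Phi>i_measurable]
  have [measurable]: "(\<lambda>r::real. r) \<in> borel_measurable (restrict_space borel {0<..})"
    by (rule measurable_restrict_space1) simp
  have "(\<lambda>r. ennreal (green_density x y r)) \<in> borel_measurable (restrict_space borel {0<..})"
    unfolding green_density_def by measurable
  thus ?thesis by (subst (asm) borel_measurable_restrict_space_iff_ennreal) auto
qed

lemma kernel_profile_eq:
  assumes "0 < t" "x \<noteq> y"
  shows "profile c t x y = ennreal (rprofile c t x y)"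
proof -
  have p: "0 < V x (\<Phi>i t)" "0 < V x (dist x y)" "0 < \<Psi> (dist x y)"
    using assms by (auto intro!: V_pos \<Phi>i_pos \<Psi>_pos)
  have "1 / ennreal (V x (\<Phi>i t)) = ennreal (1 / V x (\<Phi>i t))"
    using p by (metis divide_ennreal ennreal_1 less_imp_le zero_le_one)
  moreover have "ennreal (C0 * t) / ennreal (V x (dist x y) * \<Psi> (dist x y)) = ennreal (C0 * t / (V x (dist x y) * \<Psi> (dist x y)))"
    using p assms C0_cases by (intro divide_ennreal) auto
  ultimately show ?thesis
    unfolding kernel_profile_def real_profile_def using p assms C0_cases
    by (simp add: ennreal_mult[symmetric] ennreal_plus[symmetric] min_def ennreal_le_iff del: ennreal_plus)
qed

lemma real_profile_le: "rprofile c t x y \<le> 1 / V x (\<Phi>i t)"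
  by (simp add: real_profile_def)

lemma real_profile_nonneg: "0 < t \<Longrightarrow> 0 \<le> rprofile c t x y"
  using C0_cases \<Psi> by (auto simp: real_profile_def vol_nonneg scale_function_def)

text \<open>
  For \<open>r < \<Phi> \<rho>\<close> the jump term is at most the other entry of the minimum, because \<open>s < \<Phi> \<rho> \<le> \<Psi> \<rho>\<close> and the ball of
  radius \<open>\<Phi>i s\<close> is the smaller one. For \<open>r \<ge> \<Phi> \<rho>\<close> the exponential factor is bounded below, since \<open>\<rho>\<close> is at
  most a multiple of \<open>\<Phi>i s\<close> when \<open>s\<close> and \<open>r\<close> are comparable.
\<close>

lemma green_density_lower:
  assumes A: "1 < A" and c: "0 < c"
  shows "\<exists>b>0. \<forall>x\<in>D. \<forall>y\<in>D. \<forall>r s. x \<noteq> y \<and> 0 < r \<and> r / A < s \<and> s \<le> r \<longrightarrow>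
           b * green_density x y r \<le> h s x y * rprofile c s x y"
proof -
  obtain C where C: "1 \<le> C" "\<And>t. 0 < t \<Longrightarrow> \<Phi>i (A * t) \<le> C * \<Phi>i t"
    using scale_inv_mult[OF \<Phi>, of A] A by auto
  define b where "b = min (1 / A) (exp (- (c * C\<^sup>2)))"
  have "b * green_density x y r \<le> h s x y * rprofile c s x y"
    if D: "x \<in> D" "y \<in> D" and xy: "x \<noteq> y" and r: "0 < r" "r / A < s" "s \<le> r" for x y r s
  proof -
    define \<rho> where "\<rho> = dist x y"
    let ?E = "exp (- (c * \<rho>\<^sup>2 / (\<Phi>i s)\<^sup>2))"
    have \<rho>: "0 < \<rho>" using xy by (simp add: \<rho>_def)
    have s: "0 < s" using r A by (meson divide_pos_pos less_trans zero_less_one)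
    have p: "0 < V x \<rho>" "0 < \<Psi> \<rho>" "0 < V x (\<Phi>i s)" "0 < V x (\<Phi>i r)"
      using \<rho> s r by (auto intro!: V_pos \<Phi>i_pos \<Psi>_pos)
    have hs: "0 \<le> h r x y" "h r x y \<le> h s x y" using h_nonneg h_anti D r s by auto
    show ?thesis
    proof (cases "r < \<Phi> \<rho>")
      case True
      have "\<Phi>i s \<le> \<rho>" using True r \<rho> by (intro scale_inv_le) auto
      hence v: "V x (\<Phi>i s) \<le> V x \<rho>" by (rule vol_mono[OF radon])
      have sP: "s \<le> \<Psi> \<rho>" using True r \<Phi>_le_\<Psi>[of \<rho>] \<rho> by linarith
      have "C0 * s / (V x \<rho> * \<Psi> \<rho>) \<le> 1 / V x \<rho>"
      proof -
        have "C0 * s \<le> 1 * \<Psi> \<rho>" using C0_cases sP s by (intro mult_mono) auto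
        thus ?thesis using p by (simp add: field_simps)
      qed
      also have "\<dots> \<le> 1 / V x (\<Phi>i s)" using v p by (intro divide_left_mono) auto
      finally have "C0 * s / (V x \<rho> * \<Psi> \<rho>) \<le> rprofile c s x y"
        using p by (simp add: real_profile_def \<rho>_def[symmetric])
      moreover have "b * r \<le> s"
      proof -
        have "b * r \<le> 1 / A * r" using r by (intro mult_right_mono) (auto simp: b_def)
        thus ?thesis using r by simp
      qed
      hence "C0 * (b * r) / (V x \<rho> * \<Psi> \<rho>) \<le> C0 * s / (V x \<rho> * \<Psi> \<rho>)"
        using p C0_cases by (intro divide_right_mono mult_left_mono) auto
      ultimately have "C0 * (b * r) / (V x \<rho> * \<Psi> \<rho>) \<le> rprofile c s x y" by linarith
      hence "h r x y * (C0 * (b * r) / (V x \<rho> * \<Psi> \<rho>)) \<le> h s x y * rprofile c s x y"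
        using hs real_profile_nonneg[OF s, of c x y] A r C0_cases p
        by (intro mult_mono) (auto simp: b_def)
      thus ?thesis using True by (simp add: green_density_def \<rho>_def[symmetric] mult_ac)
    next
      case False
      have "\<rho> \<le> \<Phi>i r" using False by (intro scale_inv_ge[OF \<Phi>]) auto
      also have "\<dots> \<le> \<Phi>i (A * s)" using r A by (intro scale_inv_mono[OF \<Phi>]) (simp add: pos_divide_less_eq mult.commute less_imp_le)
      also have "\<dots> \<le> C * \<Phi>i s" using C(2)[OF s] .
      finally have "\<rho> / \<Phi>i s \<le> C" using \<Phi>i_pos[OF s] by (simp add: pos_divide_le_eq)
      hence "(\<rho> / \<Phi>i s)\<^sup>2 \<le> C\<^sup>2" using \<rho> \<Phi>i_pos[OF s] by (intro power_mono) auto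
      hence "c * (\<rho> / \<Phi>i s)\<^sup>2 \<le> c * C\<^sup>2" using c by (intro mult_left_mono) auto
      hence e: "exp (- (c * C\<^sup>2)) \<le> ?E" by (simp add: power_divide)
      have e1: "?E \<le> 1" using c by simp
      have "b / V x (\<Phi>i r) \<le> b / V x (\<Phi>i s)"
        using V\<Phi>i_mono[of s r x] p r A by (intro divide_left_mono) (auto simp: b_def)
      also have "\<dots> \<le> ?E / V x (\<Phi>i s)"
      proof (intro divide_right_mono)
        have "b \<le> exp (- (c * C\<^sup>2))" by (simp add: b_def)
        thus "b \<le> ?E" using e by linarith
      qed (use p in simp)
      also have "\<dots> \<le> rprofile c s x y"
        unfolding real_profile_def \<rho>_def[symmetric]
      proof (rule min.boundedI)
        show "?E / V x (\<Phi>i s) \<le> 1 / V x (\<Phi>i s)"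
          using e1 p by (intro divide_right_mono) auto
        have "0 \<le> C0 * s / (V x \<rho> * \<Psi> \<rho>)" using p s C0_cases by simp
        thus "?E / V x (\<Phi>i s) \<le>
          C0 * s / (V x \<rho> * \<Psi> \<rho>) + ?E / V x (\<Phi>i s)" by simp
      qed
      finally have "h r x y * (b / V x (\<Phi>i r)) \<le> h s x y * rprofile c s x y"
        using hs real_profile_nonneg[OF s, of c x y] A p
        by (intro mult_mono) (auto simp: b_def)
      thus ?thesis using False by (simp add: green_density_def \<rho>_def[symmetric] mult_ac)
    qed
  qed
  moreover have "0 < b" using A by (simp add: b_def)
  ultimately show ?thesis by blast
qed

text \<open>
  Let \<open>z = \<rho> / \<Phi>i s\<close>. If \<open>z \<ge> 1\<close>, then replacing the volume at \<open>\<Phi>i s\<close> by that at \<open>\<rho>\<close>, and gaining the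
  factor \<open>(s / \<Phi> \<rho>)\<^sup>N\<close>, both cost powers of \<open>z\<close>, which \<open>exp (- c z\<^sup>2)\<close> absorbs. If \<open>z < 1\<close>, then \<open>s \<ge> \<Phi> \<rho>\<close> and
  there is nothing to gain.
\<close>

lemma exp_decay:
  assumes c: "0 < c" and N: "0 < N"
  shows "\<exists>C>0. \<forall>x\<in>D. \<forall>y\<in>D. \<forall>s. x \<noteq> y \<and> 0 < s \<longrightarrow>
     exp (- (c * (dist x y)\<^sup>2 / (\<Phi>i s)\<^sup>2)) / V x (\<Phi>i s) \<le> C * (s / \<Phi> (dist x y)) powr N / V x (dist x y)"
proof -
  obtain C2 a where C2: "0 < C2" "0 < a" "\<And>t \<rho>. 0 < t \<Longrightarrow> \<Phi>i t \<le> \<rho> \<Longrightarrow> \<Phi> \<rho> / t \<le> C2 * (\<rho> / \<Phi>i t) powr a"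
    using scale_ratio_le[OF \<Phi>] by blast
  obtain K where K: "0 < K" "\<And>z. 1 \<le> z \<Longrightarrow> exp (- (c * z\<^sup>2)) * z powr (d + a * N) \<le> K"
    using powr_times_exp_bounded[of "d + a * N" c] d C2 N c by (auto simp: add_pos_pos)
  define C where "C = max 1 (CV * K * C2 powr N)"
  have "exp (- (c * (dist x y)\<^sup>2 / (\<Phi>i s)\<^sup>2)) / V x (\<Phi>i s) \<le> C * (s / \<Phi> (dist x y)) powr N / V x (dist x y)"
    if D: "x \<in> D" "y \<in> D" and xy: "x \<noteq> y" and s: "0 < s" for x y s
  proof -
    define \<rho> where "\<rho> = dist x y"
    define u where "u = \<Phi>i s"
    have \<rho>: "0 < \<rho>" using xy by (simp add: \<rho>_def)
    have u: "0 < u" unfolding u_def by (rule \<Phi>i_pos[OF s])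
    have p: "0 < V x \<rho>" "0 < V x u" "0 < \<Phi> \<rho>"
      using \<rho> u by (auto intro!: V_pos \<Phi>_pos)
    have "exp (- (c * \<rho>\<^sup>2 / u\<^sup>2)) / V x u \<le> C * (s / \<Phi> \<rho>) powr N / V x \<rho>"
    proof (cases "u \<le> \<rho>")
      case True
      define z where "z = \<rho> / u"
      have z: "1 \<le> z" using True u by (simp add: z_def)
      have ze: "c * \<rho>\<^sup>2 / u\<^sup>2 = c * z\<^sup>2" by (simp add: z_def power_divide)
      have "ereal (\<Phi> \<rho>) \<le> horizon" unfolding \<rho>_def by (rule \<Phi>_dist_le'[OF D])
      hence Vz: "V x \<rho> \<le> CV * z powr d * V x u"
        using doubling_\<Phi>i[of u "\<Phi> \<rho>" x] True u \<rho> by (simp add: scale_inv_eq[OF \<Phi>] z_def)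
      have "\<Phi> \<rho> / s \<le> C2 * z powr a" unfolding z_def u_def using C2(3) s True by (simp add: u_def)
      hence "(\<Phi> \<rho> / s) powr N \<le> (C2 * z powr a) powr N" using p s N by (intro powr_mono2) auto
      also have "\<dots> = C2 powr N * z powr (a * N)" using C2 z by (simp add: powr_mult powr_powr)
      finally have Pz: "(\<Phi> \<rho> / s) powr N \<le> C2 powr N * z powr (a * N)" .
      have "V x \<rho> * (\<Phi> \<rho> / s) powr N * exp (- (c * z\<^sup>2))
         \<le> (CV * z powr d * V x u) * (C2 powr N * z powr (a * N)) * exp (- (c * z\<^sup>2))"
        using Vz Pz p CV by (intro mult_mono mult_right_mono mult_nonneg_nonneg) auto
      also have "\<dots> = CV * C2 powr N * V x u * (exp (- (c * z\<^sup>2)) * z powr (d + a * N))"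
        using z by (simp add: powr_add mult_ac)
      also have "\<dots> \<le> CV * C2 powr N * V x u * K"
        using K(2)[OF z] CV p by (intro mult_left_mono) auto
      also have "\<dots> = CV * K * C2 powr N * V x u" by simp
      also have "\<dots> \<le> C * V x u" unfolding C_def using p by (intro mult_right_mono) auto
      finally have main: "V x \<rho> * (\<Phi> \<rho> / s) powr N * exp (- (c * z\<^sup>2)) \<le> C * V x u" .
      have inv: "(s / \<Phi> \<rho>) powr N = 1 / (\<Phi> \<rho> / s) powr N" using p s by (simp add: powr_divide)
      have q: "0 < (\<Phi> \<rho> / s) powr N" using p s by simp
      define w where "w = (\<Phi> \<rho> / s) powr N"
      have w: "0 < w" using q by (simp add: w_def)
      have "exp (- (c * z\<^sup>2)) / V x u = (V x \<rho> * w * exp (- (c * z\<^sup>2))) / (V x \<rho> * w * V x u)"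
        using p w by simp
      also have "\<dots> \<le> (C * V x u) / (V x \<rho> * w * V x u)"
        using main p w by (intro divide_right_mono) (auto simp: w_def)
      also have "\<dots> = C * (1 / w) / V x \<rho>" using p w by simp
      finally show ?thesis unfolding ze inv w_def .
    next
      case False
      have "\<Phi> \<rho> \<le> s" using False scale_inv_le[of \<rho> s \<Phi>] \<rho> by (cases "s < \<Phi> \<rho>") (auto simp: u_def)
      hence "1 \<le> (s / \<Phi> \<rho>) powr N" using p N by (intro ge_one_powr_ge_zero) auto
      hence "1 * 1 \<le> C * (s / \<Phi> \<rho>) powr N" by (intro mult_mono) (auto simp: C_def)
      hence q: "1 \<le> C * (s / \<Phi> \<rho>) powr N" by simp
      have "exp (- (c * \<rho>\<^sup>2 / u\<^sup>2)) / V x u \<le> 1 / V x u" using p c by (intro divide_right_mono) auto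
      also have "\<dots> \<le> 1 / V x \<rho>" using False p vol_mono[OF radon, of \<rho> u x] by (intro divide_left_mono) auto
      also have "\<dots> \<le> C * (s / \<Phi> \<rho>) powr N / V x \<rho>" using q p by (intro divide_right_mono) auto
      finally show ?thesis .
    qed
    thus ?thesis by (simp add: \<rho>_def u_def)
  qed
  moreover have "0 < C" by (simp add: C_def)
  ultimately show ?thesis by blast
qed

text \<open>
  A bound for the exponential term, times the boundary function, at times before \<open>\<Phi> \<rho>\<close>. The factor
  \<open>r / \<Phi> \<rho>\<close> cancels the \<open>1/r\<close> in the weight \<open>1 / (r \<phi>(1/r))\<close>, so the integral down to \<open>0\<close> is finite.
\<close>

definition spike :: "'a \<Rightarrow> 'a \<Rightarrow> real \<Rightarrow> real" where
  "spike x y r = (if r < \<Phi> (dist x y) then h (\<Phi> (dist x y)) x y * (r / \<Phi> (dist x y)) / V x (dist x y) else 0)"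

text \<open>
  The exponent \<open>\<gamma> + 1\<close> in the decay of the exponential term pays for the growth \<open>(\<Phi> \<rho> / r)\<^sup>\<gamma>\<close> of the
  boundary function towards small times and leaves one power of \<open>r / \<Phi> \<rho>\<close>.
\<close>

lemma green_density_upper:
  assumes c: "0 < c"
  shows "\<exists>C>0. \<forall>x\<in>D. \<forall>y\<in>D. \<forall>r s. x \<noteq> y \<and> 0 < r \<and> r \<le> s \<and> s < 2 * r \<longrightarrow>
           h s x y * rprofile c s x y \<le> C * (green_density x y r + spike x y r)"
proof -
  obtain C1 where C1: "0 < C1" "\<And>x y s. x \<in> D \<Longrightarrow> y \<in> D \<Longrightarrow> x \<noteq> y \<Longrightarrow> 0 < s \<Longrightarrow>
     exp (- (c * (dist x y)\<^sup>2 / (\<Phi>i s)\<^sup>2)) / V x (\<Phi>i s) \<le> C1 * (s / \<Phi> (dist x y)) powr (\<gamma> + 1) / V x (dist x y)"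
    using exp_decay[OF c, of "\<gamma> + 1"] \<gamma> by auto
  define B where "B = ch * C1 * 2 powr (\<gamma> + 1)"
  define C where "C = max 2 B"
  have B: "0 < B" using C1 ch by (simp add: B_def)
  have "h s x y * rprofile c s x y \<le> C * (green_density x y r + spike x y r)"
    if D: "x \<in> D" "y \<in> D" and xy: "x \<noteq> y" and r: "0 < r" "r \<le> s" "s < 2 * r" for x y r s
  proof -
    define \<rho> where "\<rho> = dist x y"
    have \<rho>: "0 < \<rho>" using xy by (simp add: \<rho>_def)
    have s: "0 < s" using r by auto
    have p: "0 < V x \<rho>" "0 < \<Psi> \<rho>" "0 < V x (\<Phi>i s)" "0 < V x (\<Phi>i r)" "0 < \<Phi> \<rho>"
      using \<rho> s r by (auto intro!: V_pos \<Phi>i_pos \<Psi>_pos \<Phi>_pos)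
    have hs: "0 \<le> h r x y" "h s x y \<le> h r x y" "0 \<le> h s x y" using h_nonneg h_anti D r s by auto
    show ?thesis
    proof (cases "r < \<Phi> \<rho>")
      case True
      have "C0 * s / (V x \<rho> * \<Psi> \<rho>) \<le> C0 * (2 * r) / (V x \<rho> * \<Psi> \<rho>)"
        using p C0_cases r by (intro divide_right_mono mult_left_mono) auto
      moreover have "exp (- (c * \<rho>\<^sup>2 / (\<Phi>i s)\<^sup>2)) / V x (\<Phi>i s) \<le> C1 * (2 powr (\<gamma> + 1) * (r / \<Phi> \<rho>) powr (\<gamma> + 1)) / V x \<rho>"
      proof -
        have "(s / \<Phi> \<rho>) powr (\<gamma> + 1) \<le> (2 * (r / \<Phi> \<rho>)) powr (\<gamma> + 1)"
          using s r p \<gamma> by (intro powr_mono2) (auto simp: divide_right_mono)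
        also have "\<dots> = 2 powr (\<gamma> + 1) * (r / \<Phi> \<rho>) powr (\<gamma> + 1)" using r p by (subst powr_mult) auto
        finally have "C1 * (s / \<Phi> \<rho>) powr (\<gamma> + 1) / V x \<rho> \<le> C1 * (2 powr (\<gamma> + 1) * (r / \<Phi> \<rho>) powr (\<gamma> + 1)) / V x \<rho>"
          using C1 p by (intro divide_right_mono mult_left_mono) auto
        with C1(2)[OF D xy s] show ?thesis by (simp add: \<rho>_def)
      qed
      ultimately have prof: "rprofile c s x y \<le>
           C0 * (2 * r) / (V x \<rho> * \<Psi> \<rho>) + C1 * (2 powr (\<gamma> + 1) * (r / \<Phi> \<rho>) powr (\<gamma> + 1)) / V x \<rho>"
        by (simp add: real_profile_def \<rho>_def)
      have "h s x y * rprofile c s x y \<le> h r x y *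
          (C0 * (2 * r) / (V x \<rho> * \<Psi> \<rho>) + C1 * (2 powr (\<gamma> + 1) * (r / \<Phi> \<rho>) powr (\<gamma> + 1)) / V x \<rho>)"
        using hs prof real_profile_nonneg[OF s] by (intro mult_mono) auto
      also have "\<dots> = 2 * green_density x y r + h r x y * (C1 * 2 powr (\<gamma> + 1) * (r / \<Phi> \<rho>) powr (\<gamma> + 1) / V x \<rho>)"
        using True by (simp add: green_density_def \<rho>_def distrib_left mult_ac)
      also have "h r x y * (C1 * 2 powr (\<gamma> + 1) * (r / \<Phi> \<rho>) powr (\<gamma> + 1) / V x \<rho>) \<le> B * spike x y r"
      proof -
        have "ereal (\<Phi> \<rho>) \<le> horizon" unfolding \<rho>_def by (rule \<Phi>_dist_le'[OF D])
        hence "h r x y \<le> ch * (\<Phi> \<rho> / r) powr \<gamma> * h (\<Phi> \<rho>) x y"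
          using True r D by (intro h_ratio) auto
        hence "h r x y * (C1 * 2 powr (\<gamma> + 1) * (r / \<Phi> \<rho>) powr (\<gamma> + 1) / V x \<rho>) \<le>
          (ch * (\<Phi> \<rho> / r) powr \<gamma> * h (\<Phi> \<rho>) x y) * (C1 * 2 powr (\<gamma> + 1) * (r / \<Phi> \<rho>) powr (\<gamma> + 1) / V x \<rho>)"
          using C1 p by (intro mult_right_mono) auto
        also have "\<dots> = B * (h (\<Phi> \<rho>) x y * ((\<Phi> \<rho> / r) powr \<gamma> * (r / \<Phi> \<rho>) powr (\<gamma> + 1)) / V x \<rho>)"
          by (simp add: B_def mult_ac)
        also have "(\<Phi> \<rho> / r) powr \<gamma> * (r / \<Phi> \<rho>) powr (\<gamma> + 1) = r / \<Phi> \<rho>"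
          using r p by (simp add: powr_divide powr_add)
        finally show ?thesis using True by (simp add: spike_def \<rho>_def)
      qed
      also have "2 * green_density x y r + B * spike x y r \<le> C * green_density x y r + C * spike x y r"
        using green_density_nonneg[OF r(1) D] True h_nonneg[OF p(5) D] p r
        by (intro add_mono mult_right_mono) (auto simp: C_def spike_def \<rho>_def)
      finally show ?thesis by (simp add: distrib_left)
    next
      case False
      have "rprofile c s x y \<le> 1 / V x (\<Phi>i s)" by (rule real_profile_le)
      also have "\<dots> \<le> 1 / V x (\<Phi>i r)" using V\<Phi>i_mono[OF r(2), of x] p by (intro divide_left_mono) auto
      finally have "h s x y * rprofile c s x y \<le> h r x y * (1 / V x (\<Phi>i r))"
        using hs real_profile_nonneg[OF s] by (intro mult_mono) auto
      also have "\<dots> = 1 * green_density x y r" using False by (simp add: green_density_def \<rho>_def)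
      also have "\<dots> \<le> C * green_density x y r" using green_density_nonneg[OF r(1) D] by (intro mult_right_mono) (auto simp: C_def)
      finally show ?thesis using False by (simp add: spike_def \<rho>_def)
    qed
  qed
  moreover have "0 < C" by (simp add: C_def)
  ultimately show ?thesis by blast
qed

end

section \<open>Integration against the potential measure\<close>

locale green_setting = kernel_setting m \<Phi> \<Psi> D h C0 CV d ch \<gamma> + potential_estimates U \<phi>
  for m :: "'a::heine_borel measure" and \<Phi> \<Psi> D h C0 CV d ch \<gamma> U \<phi>
begin

abbreviation before_horizon :: "real set" where "before_horizon \<equiv> {r. 0 < r \<and> ereal r < horizon}"

definition green_integral :: "'a \<Rightarrow> 'a \<Rightarrow> ennreal" where
  "green_integral x y = (\<integral>\<^sup>+r. ennreal (green_density x y r) * wt r * indicator before_horizon r \<partial>lborel)"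

lemma before_horizon_borel [measurable]: "before_horizon \<in> sets borel" by measurable

lemma weighted_measurable:
  assumes "(\<lambda>r. ennreal (f r) * indicator {0<..} r) \<in> borel_measurable borel"
    and B: "B \<in> sets borel" "B \<subseteq> {0<..}"
  shows "(\<lambda>r. ennreal (f r) * wt r * indicator B r) \<in> borel_measurable borel"
proof -
  note [measurable] = weight_measurable assms
  have "(\<lambda>r. (ennreal (f r) * indicator {0<..} r) * (wt r * indicator {0<..} r) * indicator B r) \<in> borel_measurable borel"
    by measurable
  also have "(\<lambda>r. (ennreal (f r) * indicator {0<..} r) * (wt r * indicator {0<..} r) * indicator B r) =
     (\<lambda>r. ennreal (f r) * wt r * indicator B r)"
    using B by (auto simp: indicator_def fun_eq_iff)
  finally show ?thesis .
qed

lemma green_profile_eq: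
  assumes D: "x \<in> D" "y \<in> D" and xy: "x \<noteq> y"
  shows "green_profile m \<phi> \<Phi> \<Psi> D h C0 x y = green_integral x y"
proof -
  let ?f = "\<lambda>s. ennreal (h s x y) / ennreal (\<phi> (1 / s))"
  let ?g = "\<lambda>s. ennreal (green_density x y s) * wt s"
  define \<rho> where "\<rho> = dist x y"
  have \<rho>: "0 < \<rho>" using xy by (simp add: \<rho>_def)
  have p: "0 < V x \<rho>" "0 < \<Psi> \<rho>" "0 < \<Phi> \<rho>" using \<rho> by (auto intro: V_pos \<Psi>_pos \<Phi>_pos)
  define B1 where "B1 = {0<..<\<Phi> \<rho>}"
  define B2 where "B2 = {s. \<Phi> \<rho> < s \<and> ereal s < horizon}"
  have B[measurable]: "B1 \<in> sets borel" "B2 \<in> sets borel" by (simp_all add: B1_def B2_def)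
  have B0: "B1 \<subseteq> {0<..}" "B2 \<subseteq> {0<..}" using p by (auto simp: B1_def B2_def)
  note m1 = weighted_measurable[OF green_density_measurable[OF D] B(1) B0(1)]
  note m2 = weighted_measurable[OF green_density_measurable[OF D] B(2) B0(2)]
  have "ennreal C0 / ennreal (V x \<rho> * \<Psi> \<rho>) *
       (\<integral>\<^sup>+s. ?f s * indicator B1 s \<partial>lborel) =
     (\<integral>\<^sup>+s. ennreal C0 / ennreal (V x \<rho> * \<Psi> \<rho>) * (?f s * indicator B1 s) \<partial>lborel)"
  proof (rule nn_integral_cmult[symmetric])
    note [measurable] = h_measurable[OF D] \<phi>_measurable
    have "(\<lambda>s. ?f s) \<in> borel_measurable (restrict_space borel {0<..})"
      by measurable
    hence [measurable]: "(\<lambda>s. ?f s * indicator {0<..} s) \<in> borel_measurable borel"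
      by (subst (asm) borel_measurable_restrict_space_iff_ennreal) auto
    have "(\<lambda>s. (?f s * indicator {0<..} s) * indicator B1 s) \<in> borel_measurable borel"
      by measurable
    also have "(\<lambda>s. (?f s * indicator {0<..} s) * indicator B1 s) =
        (\<lambda>s. ?f s * indicator B1 s)"
      using B0 by (auto simp: indicator_def fun_eq_iff)
    finally show "(\<lambda>s. ?f s * indicator B1 s) \<in> borel_measurable lborel" by simp
  qed
  also have "\<dots> = (\<integral>\<^sup>+s. ?g s * indicator B1 s \<partial>lborel)"
  proof (intro nn_integral_cong)
    fix s
    show "ennreal C0 / ennreal (V x \<rho> * \<Psi> \<rho>) * (?f s * indicator B1 s) =
       ?g s * indicator B1 s"
    proof (cases "s \<in> B1")
      case True
      hence s: "0 < s" "s < \<Phi> \<rho>" by (auto simp: B1_def)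
      have q: "0 < \<phi> (1 / s)" using s by (intro \<phi>_pos) auto
      have hh: "0 \<le> h s x y" using h_nonneg s D by auto
      have "ennreal C0 / ennreal (V x \<rho> * \<Psi> \<rho>) * (?f s) =
         ennreal (C0 / (V x \<rho> * \<Psi> \<rho>)) * ennreal (h s x y / \<phi> (1 / s))"
        using p q hh C0_cases by (simp add: divide_ennreal)
      also have "\<dots> = ennreal (C0 / (V x \<rho> * \<Psi> \<rho>) * (h s x y / \<phi> (1 / s)))"
        using p q hh C0_cases by (intro ennreal_mult[symmetric]) auto
      also have "C0 / (V x \<rho> * \<Psi> \<rho>) * (h s x y / \<phi> (1 / s)) = green_density x y s * (1 / (s * \<phi> (1 / s)))"
        using s p q by (simp add: green_density_def \<rho>_def[symmetric])
      also have "ennreal \<dots> = ?g s"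
        using green_density_nonneg[OF s(1) D] s q by (intro ennreal_mult) auto
      finally show ?thesis using True by simp
    qed simp
  qed
  finally have first: "ennreal C0 / ennreal (V x \<rho> * \<Psi> \<rho>) *
       (\<integral>\<^sup>+s. ?f s * indicator B1 s \<partial>lborel) =
       (\<integral>\<^sup>+s. ?g s * indicator B1 s \<partial>lborel)" .
  have second: "(\<integral>\<^sup>+s. ennreal (h s x y) / ennreal (s * V x (\<Phi>i s) * \<phi> (1 / s)) * indicator B2 s \<partial>lborel) =
       (\<integral>\<^sup>+s. ?g s * indicator B2 s \<partial>lborel)"
  proof (intro nn_integral_cong)
    fix s
    show "ennreal (h s x y) / ennreal (s * V x (\<Phi>i s) * \<phi> (1 / s)) * indicator B2 s =
       ?g s * indicator B2 s"
    proof (cases "s \<in> B2")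
      case True
      hence s: "0 < s" "\<Phi> \<rho> < s" using p by (auto simp: B2_def)
      have q: "0 < \<phi> (1 / s)" using s by (intro \<phi>_pos) auto
      have v: "0 < V x (\<Phi>i s)" using s by (intro V\<Phi>i_pos) auto
      have hh: "0 \<le> h s x y" using h_nonneg s D by auto
      have "ennreal (h s x y) / ennreal (s * V x (\<Phi>i s) * \<phi> (1 / s)) = ennreal (h s x y / (s * V x (\<Phi>i s) * \<phi> (1 / s)))"
        using s q v hh by (intro divide_ennreal) auto
      also have "h s x y / (s * V x (\<Phi>i s) * \<phi> (1 / s)) = green_density x y s * (1 / (s * \<phi> (1 / s)))"
        using s by (simp add: green_density_def \<rho>_def[symmetric] mult_ac)
      also have "ennreal \<dots> = ?g s"
        using green_density_nonneg[OF s(1) D] s q by (intro ennreal_mult) auto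
      finally show ?thesis using True by simp
    qed simp
  qed
  have "green_profile m \<phi> \<Phi> \<Psi> D h C0 x y =
    (\<integral>\<^sup>+s. ?g s * indicator B1 s \<partial>lborel) +
    (\<integral>\<^sup>+s. ?g s * indicator B2 s \<partial>lborel)"
    unfolding green_profile_def first[symmetric] second[symmetric]
    by (simp only: \<rho>_def B1_def B2_def horizon_def)
  also have "\<dots> = (\<integral>\<^sup>+s. ?g s * indicator B1 s + ?g s * indicator B2 s \<partial>lborel)"
    using m1 m2 by (intro nn_integral_add[symmetric]) auto
  also have "\<dots> = green_integral x y"
    unfolding green_integral_def
  proof (rule nn_integral_cong_AE)
    have hz: "ereal (2 * \<Phi> \<rho>) \<le> horizon" unfolding \<rho>_def by (rule \<Phi>_dist_le[OF D])
    have lt: "ereal s < horizon" if "s < \<Phi> \<rho>" for s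
    proof (rule less_le_trans[OF _ hz])
      show "ereal s < ereal (2 * \<Phi> \<rho>)" using that p by simp
    qed
    have "AE s in lborel. s \<noteq> \<Phi> \<rho>" by (rule AE_lborel_singleton)
    thus "AE s in lborel. ?g s * indicator B1 s + ?g s * indicator B2 s =
      ?g s * indicator before_horizon s"
    proof eventually_elim
      case (elim s)
      consider "s < \<Phi> \<rho>" | "\<Phi> \<rho> < s" using elim by linarith
      thus ?case
      proof cases
        case 1
        thus ?thesis using lt[OF 1] by (auto simp: indicator_def B1_def B2_def)
      next
        case 2
        thus ?thesis using p by (auto simp: indicator_def B1_def B2_def)
      qed
    qed
  qed
  finally show ?thesis .
qed

text \<open>
  The contribution of the times between \<open>\<tau>\<close> and \<open>2\<tau>\<close>. It serves to absorb the exponential term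
  (\<open>\<tau> = \<Phi> \<rho>\<close>) and the long times (\<open>2\<tau>\<close> equal to the horizon).
\<close>

lemma green_integral_ge:
  assumes D: "x \<in> D" "y \<in> D" and xy: "x \<noteq> y" and \<tau>: "\<Phi> (dist x y) \<le> \<tau>" "ereal (2 * \<tau>) \<le> horizon"
  shows "ennreal (h (2 * \<tau>) x y / (2 * V x (\<Phi>i (2 * \<tau>)) * \<phi> (1 / \<tau>))) \<le> green_integral x y"
proof -
  have \<tau>0: "0 < \<tau>" using \<tau>(1) \<Phi>_pos[of "dist x y"] xy by simp
  have p: "0 < V x (\<Phi>i (2 * \<tau>))" "0 < \<phi> (1 / \<tau>)" "0 \<le> h (2 * \<tau>) x y"
    using \<tau>0 D by (auto intro!: V\<Phi>i_pos \<phi>_pos h_nonneg)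
  define b where "b = h (2 * \<tau>) x y / V x (\<Phi>i (2 * \<tau>)) * (1 / (2 * \<tau> * \<phi> (1 / \<tau>)))"
  have b: "0 \<le> b" using p \<tau>0 by (simp add: b_def)
  have "h (2 * \<tau>) x y / (2 * V x (\<Phi>i (2 * \<tau>)) * \<phi> (1 / \<tau>)) = b * (2 * \<tau> - \<tau>)"
    using \<tau>0 p by (simp add: b_def)
  also have "ennreal (b * (2 * \<tau> - \<tau>)) = (\<integral>\<^sup>+r. ennreal b * indicator {\<tau><..<2 * \<tau>} r \<partial>lborel)"
    using b \<tau>0 by (subst nn_integral_cmult_indicator) (auto simp: ennreal_mult)
  also have "\<dots> \<le> green_integral x y" unfolding green_integral_def
  proof (intro nn_integral_mono)
    fix r :: real
    show "ennreal b * indicator {\<tau><..<2 * \<tau>} r \<le> ennreal (green_density x y r) * wt r * indicator before_horizon r"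
    proof (cases "r \<in> {\<tau><..<2 * \<tau>}")
      case True
      hence r: "\<tau> < r" "r < 2 * \<tau>" "0 < r" using \<tau>0 by auto
      have q: "0 < \<phi> (1 / r)" using r by (intro \<phi>_pos) auto
      have "ereal r < horizon" using r \<tau>(2) by (metis ereal_less_eq(3) less_ereal.simps(1) less_le_trans)
      hence t: "r \<in> before_horizon" using r by simp
      have "h (2 * \<tau>) x y / V x (\<Phi>i (2 * \<tau>)) \<le> h r x y / V x (\<Phi>i r)"
        using r D p V\<Phi>i_mono[of r "2 * \<tau>" x] h_anti[of x y r "2 * \<tau>"] V\<Phi>i_pos[of r x]
        by (intro frac_le) auto
      also have "\<dots> = green_density x y r" using r \<tau> by (simp add: green_density_def)
      finally have k1: "h (2 * \<tau>) x y / V x (\<Phi>i (2 * \<tau>)) \<le> green_density x y r" .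
      have "\<phi> (1 / r) \<le> \<phi> (1 / \<tau>)" using r \<tau>0 by (intro \<phi>_mono) (auto simp: field_simps)
      hence "r * \<phi> (1 / r) \<le> 2 * \<tau> * \<phi> (1 / \<tau>)" using r q \<tau>0 by (intro mult_mono) auto
      hence k2: "1 / (2 * \<tau> * \<phi> (1 / \<tau>)) \<le> 1 / (r * \<phi> (1 / r))" using r q by (intro frac_le) auto
      have "b \<le> green_density x y r * (1 / (r * \<phi> (1 / r)))"
        unfolding b_def using k1 k2 p \<tau>0 green_density_nonneg[OF r(3) D] by (intro mult_mono) auto
      hence "ennreal b \<le> ennreal (green_density x y r) * wt r"
        using green_density_nonneg[OF r(3) D] r q by (subst ennreal_mult[symmetric]) (auto intro: ennreal_leI)
      thus ?thesis using True t by simp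
    qed simp
  qed
  finally show ?thesis .
qed

text \<open>
  The weighted spike is constant in \<open>r\<close> apart from the factor \<open>1/\<phi>(1/r)\<close>, which increases. Its integral is
  therefore at most \<open>h(\<Phi> \<rho>) / (V(\<rho>) \<phi>(1/\<Phi> \<rho>))\<close>, which doubling compares with the integral over the
  times between \<open>\<Phi> \<rho>\<close> and \<open>2 \<Phi> \<rho>\<close>.
\<close>

lemma spike_integral_le:
  "\<exists>C>0. \<forall>x\<in>D. \<forall>y\<in>D. x \<noteq> y \<longrightarrow>
     (\<integral>\<^sup>+r. ennreal (spike x y r) * wt r * indicator before_horizon r \<partial>lborel) \<le> ennreal C * green_integral x y"
proof -
  obtain C2 where C2: "1 \<le> C2" "\<And>t. 0 < t \<Longrightarrow> \<Phi>i (2 * t) \<le> C2 * \<Phi>i t"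
    using scale_inv_mult[OF \<Phi>, of 2] by auto
  define C where "C = 2 * ch * 2 powr \<gamma> * CV * C2 powr d"
  have C: "0 < C" using ch CV C2 by (simp add: C_def)
  have "(\<integral>\<^sup>+r. ennreal (spike x y r) * wt r * indicator before_horizon r \<partial>lborel) \<le> ennreal C * green_integral x y"
    if D: "x \<in> D" "y \<in> D" and xy: "x \<noteq> y" for x y
  proof -
    define \<rho> where "\<rho> = dist x y"
    define T where "T = \<Phi> \<rho>"
    let ?b = "h (2 * T) x y / (2 * V x (\<Phi>i (2 * T)) * \<phi> (1 / T))"
    let ?s = "\<lambda>r. ennreal (spike x y r) * wt r * indicator before_horizon r"
    have \<rho>: "0 < \<rho>" using xy by (simp add: \<rho>_def)
    have T: "0 < T" unfolding T_def using \<rho> by (rule \<Phi>_pos)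
    have p: "0 < V x \<rho>" "0 < \<phi> (1 / T)" "0 \<le> h T x y" "0 \<le> h (2 * T) x y" "0 < V x (\<Phi>i (2 * T))"
      using \<rho> T D by (auto intro!: V_pos \<phi>_pos h_nonneg \<Phi>i_pos)
    define b where "b = h T x y / (T * V x \<rho> * \<phi> (1 / T))"
    have b: "0 \<le> b" using p T by (simp add: b_def)
    have "(\<integral>\<^sup>+r. ?s r \<partial>lborel) \<le>
        (\<integral>\<^sup>+r. ennreal b * indicator {0<..<T} r \<partial>lborel)"
    proof (intro nn_integral_mono)
      fix r :: real
      show "?s r \<le> ennreal b * indicator {0<..<T} r"
      proof (cases "r \<in> before_horizon \<and> r < T")
        case True
        hence r: "0 < r" "r < T" by auto
        have q: "0 < \<phi> (1 / r)" using r by (intro \<phi>_pos) auto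
        have "\<phi> (1 / T) \<le> \<phi> (1 / r)" using r T by (intro \<phi>_mono) (auto simp: field_simps)
        hence "h T x y / (T * V x \<rho> * \<phi> (1 / r)) \<le> b"
          unfolding b_def using p T q by (intro divide_left_mono mult_left_mono) auto
        moreover have "spike x y r * (1 / (r * \<phi> (1 / r))) = h T x y / (T * V x \<rho> * \<phi> (1 / r))"
          using r T by (simp add: spike_def \<rho>_def[symmetric] T_def[symmetric])
        moreover have "0 \<le> spike x y r" using r T p by (simp add: spike_def \<rho>_def[symmetric] T_def[symmetric])
        ultimately have "ennreal (spike x y r) * wt r \<le> ennreal b"
          using r q by (subst ennreal_mult[symmetric]) (auto intro: ennreal_leI)
        thus ?thesis using True by simp
      next
        case False
        thus ?thesis by (auto simp: indicator_def spike_def \<rho>_def[symmetric] T_def[symmetric])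
      qed
    qed
    also have "\<dots> = ennreal (b * T)" using b T by (subst nn_integral_cmult_indicator) (auto simp: ennreal_mult)
    also have "\<dots> \<le> ennreal (C * ?b)"
    proof (rule ennreal_leI)
      have hz: "ereal (2 * T) \<le> horizon" unfolding T_def \<rho>_def by (rule \<Phi>_dist_le[OF D])
      have hT: "h T x y \<le> ch * 2 powr \<gamma> * h (2 * T) x y"
        using h_ratio[OF T _ hz D] T by simp
      have r1: "\<rho> \<le> \<Phi>i (2 * T)" using T by (intro scale_inv_ge[OF \<Phi>]) (auto simp: T_def)
      have "\<Phi>i (2 * T) \<le> C2 * \<rho>" using C2(2)[OF T] \<rho> by (simp add: T_def scale_inv_eq[OF \<Phi>])
      hence "(\<Phi>i (2 * T) / \<rho>) powr d \<le> C2 powr d" using \<rho> r1 d by (intro powr_mono2) (auto simp: pos_divide_le_eq)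
      hence "CV * (\<Phi>i (2 * T) / \<rho>) powr d * V x \<rho> \<le> CV * C2 powr d * V x \<rho>"
        using CV p by (intro mult_right_mono mult_left_mono) auto
      with doubling_\<Phi>i[OF \<rho> r1 hz, of x] have V2: "V x (\<Phi>i (2 * T)) \<le> CV * C2 powr d * V x \<rho>" by linarith
      have "b * T = h T x y / (V x \<rho> * \<phi> (1 / T))" using T by (simp add: b_def)
      also have "\<dots> \<le> (ch * 2 powr \<gamma> * h (2 * T) x y) / (V x (\<Phi>i (2 * T)) / (CV * C2 powr d) * \<phi> (1 / T))"
      proof (intro frac_le mult_right_mono)
        show "V x (\<Phi>i (2 * T)) / (CV * C2 powr d) \<le> V x \<rho>"
          using V2 CV C2 by (simp add: pos_divide_le_eq mult_ac)
      qed (use p hT CV C2 ch in auto)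
      also have "\<dots> = C * ?b"
        using p CV C2 by (simp add: C_def)
      finally show "b * T \<le> C * ?b" .
    qed
    also have "\<dots> = ennreal C * ennreal ?b"
      using C p by (intro ennreal_mult) auto
    also have "\<dots> \<le> ennreal C * green_integral x y"
      using green_integral_ge[OF D xy, of T] \<Phi>_dist_le[OF D] by (intro mult_left_mono) (auto simp: T_def \<rho>_def)
    finally show ?thesis .
  qed
  thus ?thesis using C by blast
qed

lemma green_lower:
  assumes meas: "\<And>x y. x \<in> D \<Longrightarrow> y \<in> D \<Longrightarrow> (\<lambda>s. p s x y * indicator {0<..} s) \<in> borel_measurable borel"
    and A: "1 < A" and ann: "\<And>r. r \<in> before_horizon \<Longrightarrow> ennreal (1 / (16 * \<phi> (1 / r))) \<le> emeasure U {r / A<..r}"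
    and c: "0 < c1" "0 < c2"
    and le: "\<And>s x y. s \<in> before_horizon \<Longrightarrow> x \<in> D \<Longrightarrow> y \<in> D \<Longrightarrow>
        ennreal (c1 * h s x y) * profile c2 s x y \<le> p s x y"
  shows "\<exists>c>0. \<forall>x\<in>D. \<forall>y\<in>D. x \<noteq> y \<longrightarrow> ennreal c * green_integral x y \<le> (\<integral>\<^sup>+s. p s x y * indicator {0<..} s \<partial>U)"
proof -
  obtain b where b: "0 < b" and kb: "\<forall>x\<in>D. \<forall>y\<in>D. \<forall>r s. x \<noteq> y \<and> 0 < r \<and> r / A < s \<and> s \<le> r \<longrightarrow>
       b * green_density x y r \<le> h s x y * rprofile c2 s x y"
    using green_density_lower[OF A c(2)] by (elim exE conjE)
  define a where "a = c1 * b"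
  define e where "e = 16 * (A - 1)"
  have a: "0 < a" "0 < e" using c b A by (auto simp: a_def e_def)
  have "ennreal (a / e) * green_integral x y \<le> (\<integral>\<^sup>+s. p s x y * indicator {0<..} s \<partial>U)"
    if D: "x \<in> D" "y \<in> D" and xy: "x \<noteq> y" for x y
  proof -
    let ?G = "\<integral>\<^sup>+s. p s x y * indicator {0<..} s \<partial>U"
    have "ennreal a * green_integral x y = (\<integral>\<^sup>+r. ennreal a * (ennreal (green_density x y r) * wt r * indicator before_horizon r) \<partial>lborel)"
      unfolding green_integral_def using weighted_measurable[OF green_density_measurable[OF D], of before_horizon]
      by (intro nn_integral_cmult[symmetric]) auto
    also have "\<dots> = (\<integral>\<^sup>+r. (ennreal a * ennreal (green_density x y r)) * wt r * indicator before_horizon r \<partial>lborel)"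
      by (simp add: mult_ac)
    also have "\<dots> \<le> ennreal (16 * (A - 1)) * (\<integral>\<^sup>+s. (p s x y * indicator {0<..} s) * indicator {0<..} s \<partial>U)"
    proof (rule nn_integral_potential_ge[OF meas[OF D] A])
      fix r s assume r: "r \<in> before_horizon" and s: "r / A < s" "s \<le> r"
      have r0: "0 < r" using r by simp
      have s0: "0 < s" using r0 s A by (meson divide_pos_pos less_trans zero_less_one)
      have "ereal s < horizon" by (rule le_less_trans[of _ "ereal r"]) (use r s in auto)
      hence st: "s \<in> before_horizon" using s0 by simp
      have hs: "0 \<le> h s x y" using h_nonneg[OF s0 D] .
      have "ennreal a * ennreal (green_density x y r) = ennreal (c1 * (b * green_density x y r))"
        using a green_density_nonneg[OF r0 D] by (simp add: a_def mult_ac flip: ennreal_mult)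
      also have "\<dots> \<le> ennreal (c1 * (h s x y * rprofile c2 s x y))"
        using kb[rule_format, OF D conjI[OF xy conjI[OF r0 conjI[OF s]]]] c by (intro ennreal_leI mult_left_mono) auto
      also have "\<dots> = ennreal (c1 * h s x y) * profile c2 s x y"
        using kernel_profile_eq[OF s0 xy] real_profile_nonneg[OF s0] hs c
        by (simp add: mult.assoc flip: ennreal_mult)
      also have "\<dots> \<le> p s x y" by (rule le[OF st D])
      finally show "ennreal a * ennreal (green_density x y r) \<le> p s x y * indicator {0<..} s" using s0 by simp
    qed (use ann in auto)
    also have "(\<integral>\<^sup>+s. (p s x y * indicator {0<..} s) * indicator {0<..} s \<partial>U) = ?G"
      by (intro nn_integral_cong) (auto simp: indicator_def)
    finally have le': "ennreal a * green_integral x y \<le> ennreal e * ?G" by (simp add: e_def)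
    have "ennreal (a / e) * green_integral x y = ennreal (1 / e) * (ennreal a * green_integral x y)"
      using a by (simp add: divide_inverse mult_ac flip: ennreal_mult mult.assoc)
    also have "\<dots> \<le> ennreal (1 / e) * (ennreal e * ?G)" using le' by (intro mult_left_mono) auto
    also have "\<dots> = ?G" using a by (simp flip: ennreal_mult mult.assoc)
    finally show ?thesis .
  qed
  moreover have "0 < a / e" using a by simp
  ultimately show ?thesis by blast
qed

lemma spike_nonneg: "x \<in> D \<Longrightarrow> y \<in> D \<Longrightarrow> x \<noteq> y \<Longrightarrow> 0 < r \<Longrightarrow> 0 \<le> spike x y r"
  using \<Phi>_pos[of "dist x y"] h_nonneg[of "\<Phi> (dist x y)" x y] by (simp add: spike_def vol_nonneg)

lemma spike_measurable: "(\<lambda>r. ennreal (spike x y r) * indicator {0<..} r) \<in> borel_measurable borel"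
  unfolding spike_def by measurable

lemma green_near_upper:
  assumes meas: "\<And>x y. x \<in> D \<Longrightarrow> y \<in> D \<Longrightarrow> (\<lambda>s. p s x y * indicator {0<..} s) \<in> borel_measurable borel"
    and c: "0 < c3" "0 < c4"
    and le: "\<And>s x y. s \<in> before_horizon \<Longrightarrow> x \<in> D \<Longrightarrow> y \<in> D \<Longrightarrow>
        p s x y \<le> ennreal (c3 * h s x y) * profile c4 s x y"
  shows "\<exists>C>0. \<forall>x\<in>D. \<forall>y\<in>D. x \<noteq> y \<longrightarrow> (\<integral>\<^sup>+s. p s x y * indicator before_horizon s \<partial>U) \<le> ennreal C * green_integral x y"
proof -
  obtain C where C: "0 < C" and kC: "\<forall>x\<in>D. \<forall>y\<in>D. \<forall>r s. x \<noteq> y \<and> 0 < r \<and> r \<le> s \<and> s < 2 * r \<longrightarrow>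
      h s x y * rprofile c4 s x y \<le> C * (green_density x y r + spike x y r)"
    using green_density_upper[OF c(2)] by (elim exE conjE)
  obtain Cs where Cs: "0 < Cs" and sp: "\<forall>x\<in>D. \<forall>y\<in>D. x \<noteq> y \<longrightarrow>
     (\<integral>\<^sup>+r. ennreal (spike x y r) * wt r * indicator before_horizon r \<partial>lborel) \<le> ennreal Cs * green_integral x y"
    using spike_integral_le by (elim exE conjE)
  define a where "a = c3 * C"
  have a: "0 < a" using c C by (simp add: a_def)
  have "(\<integral>\<^sup>+s. p s x y * indicator before_horizon s \<partial>U) \<le> ennreal (4 * exp 1 * a * (1 + Cs)) * green_integral x y"
    if D: "x \<in> D" "y \<in> D" and xy: "x \<noteq> y" for x y
  proof -
    let ?k = "\<lambda>r. ennreal (green_density x y r) * wt r * indicator before_horizon r"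
    let ?s = "\<lambda>r. ennreal (spike x y r) * wt r * indicator before_horizon r"
    define K where "K r = ennreal a * (ennreal (green_density x y r) * indicator {0<..} r + ennreal (spike x y r) * indicator {0<..} r)" for r
    note [measurable] = green_density_measurable[OF D] spike_measurable[of x y]
    have "(\<integral>\<^sup>+s. p s x y * indicator before_horizon s \<partial>U) = (\<integral>\<^sup>+s. (p s x y * indicator {0<..} s) * indicator before_horizon s \<partial>U)"
      by (intro nn_integral_cong) (auto simp: indicator_def)
    also have "\<dots> \<le> ennreal (4 * exp 1) * (\<integral>\<^sup>+r. K r * wt r * indicator before_horizon r \<partial>lborel)"
    proof (rule nn_integral_potential_le[OF meas[OF D]])
      show "K \<in> borel_measurable borel" unfolding K_def by measurable
      fix r s assume r: "0 < r" "r \<le> s" "s < 2 * r" "ereal s < horizon"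
      have s0: "0 < s" using r by simp
      have hs: "0 \<le> h s x y" using h_nonneg[OF s0 D] .
      have "p s x y \<le> ennreal (c3 * h s x y) * profile c4 s x y"
        using r s0 by (intro le D) auto
      also have "\<dots> = ennreal (c3 * (h s x y * rprofile c4 s x y))"
        using kernel_profile_eq[OF s0 xy] real_profile_nonneg[OF s0] hs c
        by (simp add: mult.assoc flip: ennreal_mult)
      also have "\<dots> \<le> ennreal (c3 * (C * (green_density x y r + spike x y r)))"
        using kC[rule_format, OF D conjI[OF xy conjI[OF r(1) conjI[OF r(2,3)]]]] c by (intro ennreal_leI mult_left_mono) auto
      also have "\<dots> = K r"
        using r a green_density_nonneg[OF r(1) D] spike_nonneg[OF D xy r(1)]
        by (simp add: K_def a_def mult.assoc flip: ennreal_plus ennreal_mult)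
      finally show "p s x y * indicator {0<..} s \<le> K r" using s0 by simp
    qed
    also have "(\<integral>\<^sup>+r. K r * wt r * indicator before_horizon r \<partial>lborel) =
       (\<integral>\<^sup>+r. ennreal a * (?k r + ?s r) \<partial>lborel)"
      by (intro nn_integral_cong) (auto simp: K_def indicator_def distrib_left distrib_right mult_ac)
    also have "\<dots> = ennreal a * (green_integral x y + (\<integral>\<^sup>+r. ?s r \<partial>lborel))"
    proof -
      have [measurable]: "(\<lambda>r. ?k r) \<in> borel_measurable borel"
        "(\<lambda>r. ?s r) \<in> borel_measurable borel"
        using weighted_measurable[OF green_density_measurable[OF D], of before_horizon] weighted_measurable[OF spike_measurable[of x y], of before_horizon] by auto
      show ?thesis unfolding green_integral_def by (subst nn_integral_cmult, measurable) (subst nn_integral_add, auto)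
    qed
    also have "\<dots> \<le> ennreal a * (green_integral x y + ennreal Cs * green_integral x y)"
      using sp[rule_format, OF D xy] by (intro mult_left_mono add_left_mono) auto
    also have "\<dots> = ennreal a * (ennreal (1 + Cs) * green_integral x y)"
      using Cs by (subst ennreal_plus) (auto simp: distrib_right)
    also have "ennreal (4 * exp 1) * (ennreal a * (ennreal (1 + Cs) * green_integral x y)) = ennreal (4 * exp 1 * a * (1 + Cs)) * green_integral x y"
    proof -
      have "ennreal (4 * exp 1 * a * (1 + Cs)) = ennreal (4 * exp 1) * (ennreal a * ennreal (1 + Cs))"
        using a Cs by (subst ennreal_mult_triple) (auto simp: mult.assoc)
      thus ?thesis by (simp only: mult.assoc)
    qed
    finally show ?thesis by (simp add: mult_left_mono)
  qed
  moreover have "0 < 4 * exp 1 * a * (1 + Cs)" using a Cs by simp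
  ultimately show ?thesis by blast
qed

text \<open>
  Exponential decay past the horizon is integrated exactly by the Laplace transform of \<open>U\<close>; the result
  is at most a multiple of the contribution of the last dyadic interval of times before the horizon.
\<close>

lemma green_far_upper:
  assumes bdd: "bounded D" and c: "0 < Cd" "0 < \<kappa>" "0 < v2"
    and vle: "\<And>x. x \<in> D \<Longrightarrow> V x (\<Phi>i end_time) \<le> v2"
    and le: "\<And>s x y. horizon \<le> ereal s \<Longrightarrow> x \<in> D \<Longrightarrow> y \<in> D \<Longrightarrow>
        p s x y \<le> ennreal (Cd * exp (- \<kappa> * s) * h end_time x y)"
  shows "\<exists>C>0. \<forall>x\<in>D. \<forall>y\<in>D. x \<noteq> y \<longrightarrow>
     (\<integral>\<^sup>+s. p s x y * indicator {s. horizon \<le> ereal s} s \<partial>U) \<le> ennreal C * green_integral x y"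
proof (cases "\<exists>x\<in>D. \<exists>y\<in>D. x \<noteq> y")
  case True
  then obtain x0 y0 where "x0 \<in> D" "y0 \<in> D" "x0 \<noteq> y0" by blast
  hence "0 < diameter D" using dist_le_diameter[of x0 y0] bdd by (metis zero_less_dist_iff less_le_trans)
  define \<tau> where "\<tau> = \<Phi> (diameter D)"
  have \<tau>: "0 < \<tau>" unfolding \<tau>_def by (rule \<Phi>_pos) fact
  have q: "0 < \<phi> (1 / \<tau>)" "0 < \<phi> \<kappa>" using \<tau> c by (auto intro!: \<phi>_pos)
  define C where "C = Cd / \<phi> \<kappa> * (2 * v2 * \<phi> (1 / \<tau>))"
  have C: "0 < C" using c q by (simp add: C_def)
  have "(\<integral>\<^sup>+s. p s x y * indicator {s. horizon \<le> ereal s} s \<partial>U) \<le> ennreal C * green_integral x y"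
    if D: "x \<in> D" "y \<in> D" and xy: "x \<noteq> y" for x y
  proof -
    have hh: "0 \<le> h (2 * \<tau>) x y" using \<tau> D by (intro h_nonneg) auto
    let ?b = "h (2 * \<tau>) x y / (2 * V x (\<Phi>i (2 * \<tau>)) * \<phi> (1 / \<tau>))"
    have "(\<integral>\<^sup>+s. p s x y * indicator {s. horizon \<le> ereal s} s \<partial>U) \<le>
       (\<integral>\<^sup>+s. ennreal (Cd * h (2 * \<tau>) x y) * ennreal (exp (- \<kappa> * s)) \<partial>U)"
      using le[OF _ D] c hh
      by (intro nn_integral_mono) (auto simp: indicator_def \<tau>_def mult_ac simp flip: ennreal_mult)
    also have "\<dots> = ennreal (Cd * h (2 * \<tau>) x y) * ennreal (1 / \<phi> \<kappa>)"
      using laplace_U[OF c(2)] by (subst nn_integral_cmult) auto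
    also have "\<dots> = ennreal (Cd * h (2 * \<tau>) x y / \<phi> \<kappa>)"
      using c hh q by (subst ennreal_mult[symmetric]) auto
    also have "\<dots> \<le> ennreal (C * ?b)"
    proof (rule ennreal_leI)
      have v: "0 < V x (\<Phi>i (2 * \<tau>))" using \<tau> by (intro V\<Phi>i_pos) auto
      have "Cd * h (2 * \<tau>) x y / \<phi> \<kappa> = C * (h (2 * \<tau>) x y / (2 * v2 * \<phi> (1 / \<tau>)))"
        using c q by (simp add: C_def)
      also have "\<dots> \<le> C * ?b"
        using vle[OF D(1)] v q C hh by (intro mult_left_mono divide_left_mono mult_right_mono) (auto simp: \<tau>_def)
      finally show "Cd * h (2 * \<tau>) x y / \<phi> \<kappa> \<le> C * ?b" .
    qed
    also have "\<dots> = ennreal C * ennreal ?b"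
      using C hh q by (intro ennreal_mult) (auto simp: vol_nonneg)
    also have "\<dots> \<le> ennreal C * green_integral x y"
    proof (intro mult_left_mono green_integral_ge[OF D xy])
      show "\<Phi> (dist x y) \<le> \<tau>" unfolding \<tau>_def using dist_le_diameter[OF D bdd] by (intro scale_function_mono[OF \<Phi>]) auto
      show "ereal (2 * \<tau>) \<le> horizon" using bdd by (simp add: horizon_bounded \<tau>_def)
    qed simp
    finally show ?thesis .
  qed
  thus ?thesis using C by blast
qed (auto intro: exI[of _ 1])

lemma green_upper:
  assumes meas: "\<And>x y. x \<in> D \<Longrightarrow> y \<in> D \<Longrightarrow> (\<lambda>s. p s x y * indicator {0<..} s) \<in> borel_measurable borel"
    and near: "0 < c3" "0 < c4" "\<And>s x y. s \<in> before_horizon \<Longrightarrow> x \<in> D \<Longrightarrow> y \<in> D \<Longrightarrow>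
        p s x y \<le> ennreal (c3 * h s x y) * profile c4 s x y"
    and far: "bounded D \<Longrightarrow> \<exists>Cd>0. \<exists>\<kappa>>0. \<exists>v2>0. \<forall>x\<in>D. V x (\<Phi>i end_time) \<le> v2 \<and>
       (\<forall>y\<in>D. \<forall>s. horizon \<le> ereal s \<longrightarrow> p s x y \<le> ennreal (Cd * exp (- \<kappa> * s) * h end_time x y))"
  shows "\<exists>C>0. \<forall>x\<in>D. \<forall>y\<in>D. x \<noteq> y \<longrightarrow> (\<integral>\<^sup>+s. p s x y * indicator {0<..} s \<partial>U) \<le> ennreal C * green_integral x y"
proof -
  let ?N = "\<lambda>x y. \<integral>\<^sup>+s. p s x y * indicator before_horizon s \<partial>U"
  let ?F = "\<lambda>x y. \<integral>\<^sup>+s. p s x y * indicator {s. horizon \<le> ereal s} s \<partial>U"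
  have "\<exists>C>0. \<forall>x\<in>D. \<forall>y\<in>D. x \<noteq> y \<longrightarrow> ?N x y \<le> ennreal C * green_integral x y"
    by (rule green_near_upper[OF _ near(1,2)]) (rule meas near(3); assumption)+
  then obtain C1 where C1: "0 < C1" "\<forall>x\<in>D. \<forall>y\<in>D. x \<noteq> y \<longrightarrow> ?N x y \<le> ennreal C1 * green_integral x y"
    by (elim exE conjE)
  have "\<exists>C>0. \<forall>x\<in>D. \<forall>y\<in>D. x \<noteq> y \<longrightarrow>
     ?F x y \<le> ennreal C * green_integral x y"
  proof (cases "bounded D")
    case True
    from far[OF True] obtain Cd \<kappa> v2 where "0 < Cd" "0 < \<kappa>" "0 < v2"
      and *: "\<forall>x\<in>D. V x (\<Phi>i end_time) \<le> v2 \<and>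
       (\<forall>y\<in>D. \<forall>s. horizon \<le> ereal s \<longrightarrow> p s x y \<le> ennreal (Cd * exp (- \<kappa> * s) * h end_time x y))"
      by blast
    thus ?thesis by (intro green_far_upper[OF True, of Cd \<kappa> v2]) auto
  next
    case False
    hence "horizon = \<infinity>" by (simp add: horizon_def scale_diam_def)
    hence "{s. horizon \<le> ereal s} = {}" by auto
    thus ?thesis by (intro exI[of _ 1]) simp
  qed
  then obtain C2 where C2: "0 < C2" "\<forall>x\<in>D. \<forall>y\<in>D. x \<noteq> y \<longrightarrow>
     ?F x y \<le> ennreal C2 * green_integral x y"
    by (elim exE conjE)
  have "(\<integral>\<^sup>+s. p s x y * indicator {0<..} s \<partial>U) \<le> ennreal (C1 + C2) * green_integral x y"
    if D: "x \<in> D" "y \<in> D" and xy: "x \<noteq> y" for x y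
  proof -
    have H[measurable]: "{s. horizon \<le> ereal s} \<in> sets borel" by measurable
    have "0 \<le> horizon" using scale_diam_nonneg by (simp add: horizon_def)
    hence sub: "(0::real) \<le> s" if "horizon \<le> ereal s" for s using order_trans[OF _ that] by force
    note [measurable] = meas[OF D]
    have "(\<integral>\<^sup>+s. p s x y * indicator {0<..} s \<partial>U) =
      (\<integral>\<^sup>+s. (p s x y * indicator {0<..} s) * indicator before_horizon s + (p s x y * indicator {0<..} s) * indicator {s. horizon \<le> ereal s} s \<partial>U)"
      by (intro nn_integral_cong) (auto simp: indicator_def not_less)
    also have "\<dots> = (\<integral>\<^sup>+s. (p s x y * indicator {0<..} s) * indicator before_horizon s \<partial>U) +
       (\<integral>\<^sup>+s. (p s x y * indicator {0<..} s) * indicator {s. horizon \<le> ereal s} s \<partial>U)"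
      by (rule nn_integral_add) measurable
    also have "\<dots> \<le> ?N x y +
       ?F x y"
      by (intro add_mono nn_integral_mono) (auto simp: indicator_def)
    also have "\<dots> \<le> ennreal C1 * green_integral x y + ennreal C2 * green_integral x y"
      by (intro add_mono C1(2)[rule_format] C2(2)[rule_format] D xy)
    also have "\<dots> = ennreal (C1 + C2) * green_integral x y"
      using C1(1) C2(1) by (subst ennreal_plus) (auto simp: distrib_right)
    finally show ?thesis .
  qed
  moreover have "0 < C1 + C2" using C1 C2 by simp
  ultimately show ?thesis by blast
qed

end

section \<open>Long times in a bounded domain\<close>

text \<open>
  Inserting \<open>p(S,x,z) \<le> p(T,x,z)/2\<close> into the Chapman-Kolmogorov equation gives
  \<open>p(s + S - T,x,y) \<le> p(s,x,y)/2\<close> for all \<open>s \<ge> T\<close>. The equation has to hold at every pair of points for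
  this to give a pointwise bound.
\<close>

lemma semigroup_exponential_decay:
  fixes p :: "real \<Rightarrow> 'a \<Rightarrow> 'a \<Rightarrow> ennreal"
  assumes CK: "\<And>s t x y. 0 < s \<Longrightarrow> 0 < t \<Longrightarrow> x \<in> D \<Longrightarrow> y \<in> D \<Longrightarrow>
        p (s + t) x y = (\<integral>\<^sup>+z. p s x z * p t z y * indicator D z \<partial>m)"
    and meas: "\<And>s t x y. 0 < s \<Longrightarrow> 0 < t \<Longrightarrow> x \<in> D \<Longrightarrow> y \<in> D \<Longrightarrow>
        (\<lambda>z. p s x z * p t z y * indicator D z) \<in> borel_measurable m"
    and T: "0 < T" "T < S"
    and half: "\<And>x y. x \<in> D \<Longrightarrow> y \<in> D \<Longrightarrow> p S x y \<le> ennreal (1 / 2) * p T x y"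
    and C: "0 < C" and dom: "\<And>s x y. T \<le> s \<Longrightarrow> x \<in> D \<Longrightarrow> y \<in> D \<Longrightarrow> p s x y \<le> ennreal C * p T x y"
  shows "\<exists>\<kappa>>0. \<exists>B>0. \<forall>s\<ge>T. \<forall>x\<in>D. \<forall>y\<in>D. p s x y \<le> ennreal (B * exp (- \<kappa> * s)) * p T x y"
proof -
  define \<delta> where "\<delta> = S - T"
  have \<delta>: "0 < \<delta>" using T by (simp add: \<delta>_def)
  have step: "p (s + \<delta>) x y \<le> ennreal (1 / 2) * p s x y" if "T \<le> s" and D: "x \<in> D" "y \<in> D" for s x y
  proof (cases "s = T")
    case True
    thus ?thesis using half[OF D] by (simp add: \<delta>_def)
  next
    case False
    define v where "v = s - T"
    have v: "0 < v" using that(1) False by (simp add: v_def)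
    have S0: "0 < S" using T by simp
    have "s + \<delta> = S + v" by (simp add: \<delta>_def v_def)
    hence "p (s + \<delta>) x y = p (S + v) x y" by (simp only:)
    also have "\<dots> = (\<integral>\<^sup>+z. p S x z * p v z y * indicator D z \<partial>m)" by (rule CK[OF S0 v D])
    also have "\<dots> \<le> (\<integral>\<^sup>+z. ennreal (1 / 2) * (p T x z * p v z y * indicator D z) \<partial>m)"
    proof (rule nn_integral_mono)
      fix z
      show "p S x z * p v z y * indicator D z \<le> ennreal (1 / 2) * (p T x z * p v z y * indicator D z)"
      proof (cases "z \<in> D")
        case True
        have "p S x z * p v z y \<le> (ennreal (1 / 2) * p T x z) * p v z y"
          by (intro mult_right_mono half D True) auto
        thus ?thesis using True by (simp add: mult.assoc)
      qed simp
    qed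
    also have "\<dots> = ennreal (1 / 2) * (\<integral>\<^sup>+z. p T x z * p v z y * indicator D z \<partial>m)"
      by (rule nn_integral_cmult[OF meas[OF T(1) v D]])
    also have "\<dots> = ennreal (1 / 2) * p s x y"
      using CK[OF T(1) v D] by (simp add: v_def)
    finally show ?thesis .
  qed
  have iter: "p (s + real n * \<delta>) x y \<le> ennreal ((1 / 2) ^ n) * p s x y" if "T \<le> s" and D: "x \<in> D" "y \<in> D" for s n x y
  proof (induction n)
    case (Suc n)
    have "s + real (Suc n) * \<delta> = (s + real n * \<delta>) + \<delta>" by (simp add: algebra_simps)
    hence "p (s + real (Suc n) * \<delta>) x y = p ((s + real n * \<delta>) + \<delta>) x y" by (simp only:)
    also have "\<dots> \<le> ennreal (1 / 2) * p (s + real n * \<delta>) x y" using that \<delta> by (intro step) (auto intro: add_increasing2)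
    also have "\<dots> \<le> ennreal (1 / 2) * (ennreal ((1 / 2) ^ n) * p s x y)" using Suc by (intro mult_left_mono) auto
    also have "\<dots> = ennreal ((1 / 2) ^ Suc n) * p s x y"
    proof -
      have "ennreal ((1 / 2) ^ Suc n) = ennreal (1 / 2) * ennreal ((1 / 2) ^ n)"
        unfolding power_Suc by (rule ennreal_mult) auto
      thus ?thesis by (simp only: mult.assoc)
    qed
    finally show ?case .
  qed simp
  define \<kappa> where "\<kappa> = ln 2 / \<delta>"
  define B where "B = 2 * C * exp (\<kappa> * T)"
  have "p s x y \<le> ennreal (B * exp (- \<kappa> * s)) * p T x y" if s: "T \<le> s" and D: "x \<in> D" "y \<in> D" for s x y
  proof -
    define n where "n = nat \<lfloor>(s - T) / \<delta>\<rfloor>"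
    have q: "0 \<le> (s - T) / \<delta>" using s \<delta> by simp
    have n: "real n \<le> (s - T) / \<delta>" "(s - T) / \<delta> \<le> real n + 1"
      unfolding n_def using q by (auto simp: of_nat_nat)
    have s': "T \<le> s - real n * \<delta>" using n(1) \<delta> by (simp add: pos_le_divide_eq)
    have "p s x y = p ((s - real n * \<delta>) + real n * \<delta>) x y" by simp
    also have "\<dots> \<le> ennreal ((1 / 2) ^ n) * p (s - real n * \<delta>) x y" by (rule iter[OF s' D])
    also have "\<dots> \<le> ennreal ((1 / 2) ^ n) * (ennreal C * p T x y)" by (intro mult_left_mono dom s' D) auto
    also have "\<dots> = ennreal ((1 / 2) ^ n * C) * p T x y"
      using C by (simp add: ennreal_mult mult.assoc)
    also have "\<dots> \<le> ennreal (B * exp (- \<kappa> * s)) * p T x y"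
    proof (intro mult_right_mono ennreal_leI)
      have "(1 / 2 :: real) ^ n = exp (- (real n * ln 2))"
        by (simp add: exp_minus power_one_over inverse_eq_divide exp_of_nat_mult)
      also have "\<dots> \<le> exp (ln 2 - \<kappa> * (s - T))"
      proof -
        have "(s - T) / \<delta> * ln 2 \<le> (real n + 1) * ln 2" using n(2) by (intro mult_right_mono) auto
        moreover have "\<kappa> * (s - T) = (s - T) / \<delta> * ln 2" by (simp add: \<kappa>_def)
        ultimately show ?thesis by (simp add: distrib_right)
      qed
      also have "\<dots> = 2 * exp (\<kappa> * T) * exp (- \<kappa> * s)"
      proof -
        have "ln 2 - \<kappa> * (s - T) = ln 2 + (\<kappa> * T + - \<kappa> * s)" by (simp add: right_diff_distrib)
        thus ?thesis by (simp only: exp_add) simp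
      qed
      finally have "(1 / 2) ^ n * C \<le> 2 * exp (\<kappa> * T) * exp (- \<kappa> * s) * C" using C by (intro mult_right_mono) auto
      thus "(1 / 2) ^ n * C \<le> B * exp (- \<kappa> * s)" by (simp add: B_def mult_ac)
    qed simp
    finally show ?thesis .
  qed
  moreover have "0 < \<kappa>" "0 < B" using \<delta> C by (auto simp: \<kappa>_def B_def)
  ultimately show ?thesis by blast
qed

context kernel_setting
begin

lemma one_divide_V: "0 < t \<Longrightarrow> 1 / ennreal (V x (\<Phi>i t)) = ennreal (1 / V x (\<Phi>i t))"
  using V\<Phi>i_pos[of t x] by (metis divide_ennreal ennreal_1 zero_le_one)

lemma kernel_profile_le: "0 < t \<Longrightarrow> profile c t x y \<le> ennreal (1 / V x (\<Phi>i t))"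
  unfolding kernel_profile_def by (simp add: one_divide_V)

lemma kernel_profile_ge:
  assumes "0 < t" "0 < c"
  shows "ennreal (exp (- (c * (dist x y)\<^sup>2 / (\<Phi>i t)\<^sup>2)) / V x (\<Phi>i t)) \<le> profile c t x y"
proof -
  define e where "e = exp (- (c * (dist x y)\<^sup>2 / (\<Phi>i t)\<^sup>2))"
  have v: "0 < V x (\<Phi>i t)" using V\<Phi>i_pos assms by blast
  have e: "0 \<le> e" "e \<le> 1" using assms by (auto simp: e_def)
  have "ennreal (e / V x (\<Phi>i t)) = 1 / ennreal (V x (\<Phi>i t)) * ennreal e"
    using v e one_divide_V[OF assms(1)] by (simp flip: ennreal_mult)
  moreover have "ennreal (e / V x (\<Phi>i t)) \<le> 1 / ennreal (V x (\<Phi>i t))"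
    using v e one_divide_V[OF assms(1)] by (simp add: ennreal_leI divide_right_mono)
  ultimately show ?thesis
    unfolding kernel_profile_def e_def[symmetric] by (simp add: add_increasing)
qed

text \<open>
  At the time \<open>T = 2 \<Phi>(diameter D)\<close> the exponential factor in the lower bound is bounded below. For later
  times \<open>s\<close> the ratio \<open>p(s) / p(T)\<close> is therefore at most a constant times the ratio of the volumes at \<open>\<Phi>i T\<close> and \<open>\<Phi>i s\<close>, the boundary function being
  non-increasing. Volume growth makes this ratio small for a suitable \<open>s\<close>.
\<close>

lemma global_bounds_imp_decay:
  fixes p :: "real \<Rightarrow> 'a \<Rightarrow> 'a \<Rightarrow> ennreal"
  assumes CK: "\<And>s t x y. 0 < s \<Longrightarrow> 0 < t \<Longrightarrow> x \<in> D \<Longrightarrow> y \<in> D \<Longrightarrow>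
        p (s + t) x y = (\<integral>\<^sup>+z. p s x z * p t z y * indicator D z \<partial>m)"
    and meas: "\<And>s t x y. 0 < s \<Longrightarrow> 0 < t \<Longrightarrow> x \<in> D \<Longrightarrow> y \<in> D \<Longrightarrow>
        (\<lambda>z. p s x z * p t z y * indicator D z) \<in> borel_measurable m"
    and bdd: "bounded D" and diam: "0 < diameter D"
    and growth: "0 < d1" "0 < CL" "\<And>x r R. 0 < r \<Longrightarrow> r \<le> R \<Longrightarrow> (R / r) powr d1 / CL * V x r \<le> V x R"
    and v1: "0 < v1" "\<And>x. x \<in> D \<Longrightarrow> v1 \<le> V x (\<Phi>i end_time)"
    and c: "0 < c1" "0 < c2" "0 < c3" "0 < c4"
    and lower: "\<And>t x y. 0 < t \<Longrightarrow> x \<in> D \<Longrightarrow> y \<in> D \<Longrightarrow> ennreal (c1 * h t x y) * profile c2 t x y \<le> p t x y"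
    and upper: "\<And>t x y. 0 < t \<Longrightarrow> x \<in> D \<Longrightarrow> y \<in> D \<Longrightarrow> p t x y \<le> ennreal (c3 * h t x y) * profile c4 t x y"
  shows "\<exists>\<kappa>>0. \<exists>B>0. \<forall>s\<ge>end_time. \<forall>x\<in>D. \<forall>y\<in>D.
           p s x y \<le> ennreal (B * exp (- \<kappa> * s) * h end_time x y)"
proof -
  define T where "T = end_time"
  have T: "0 < T" using \<Phi>_pos[OF diam] by (simp add: T_def)
  have dT: "diameter D \<le> \<Phi>i T" using \<Phi>_pos[OF diam] by (intro scale_inv_ge[OF \<Phi>]) (simp add: T_def)
  define e where "e = exp (- c2)"
  have up: "p s x y \<le> ennreal (c3 * h T x y / V x (\<Phi>i s))" if s: "T \<le> s" and D: "x \<in> D" "y \<in> D" for s x y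
  proof -
    have s0: "0 < s" using s T by simp
    have "p s x y \<le> ennreal (c3 * h s x y) * profile c4 s x y" by (rule upper[OF s0 D])
    also have "\<dots> \<le> ennreal (c3 * h T x y) * ennreal (1 / V x (\<Phi>i s))"
      using h_anti[OF D T s] h_nonneg[OF s0 D] c by (intro mult_mono kernel_profile_le s0 ennreal_leI) auto
    also have "\<dots> = ennreal (c3 * h T x y / V x (\<Phi>i s))"
      using h_nonneg[OF T D] c by (simp add: vol_nonneg flip: ennreal_mult)
    finally show ?thesis .
  qed
  have lo: "ennreal (c1 * h T x y * e / V x (\<Phi>i T)) \<le> p T x y" if D: "x \<in> D" "y \<in> D" for x y
  proof -
    have "(dist x y)\<^sup>2 \<le> (\<Phi>i T)\<^sup>2" using dist_le_diameter[OF D bdd] dT by (intro power_mono) auto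
    hence "(dist x y)\<^sup>2 / (\<Phi>i T)\<^sup>2 \<le> 1" using \<Phi>i_pos[OF T] by simp
    hence "c2 * ((dist x y)\<^sup>2 / (\<Phi>i T)\<^sup>2) \<le> c2 * 1" using c by (intro mult_left_mono) auto
    hence "e \<le> exp (- (c2 * (dist x y)\<^sup>2 / (\<Phi>i T)\<^sup>2))" by (simp add: e_def)
    hence "ennreal (e / V x (\<Phi>i T)) \<le> ennreal (exp (- (c2 * (dist x y)\<^sup>2 / (\<Phi>i T)\<^sup>2)) / V x (\<Phi>i T))"
      by (intro ennreal_leI divide_right_mono) (auto simp: vol_nonneg)
    also have "\<dots> \<le> profile c2 T x y" by (rule kernel_profile_ge[OF T c(2)])
    finally have "ennreal (c1 * h T x y) * ennreal (e / V x (\<Phi>i T)) \<le> ennreal (c1 * h T x y) * profile c2 T x y"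
      by (intro mult_left_mono) auto
    also have "\<dots> \<le> p T x y" by (rule lower[OF T D])
    finally show ?thesis using h_nonneg[OF T D] c by (simp add: e_def vol_nonneg flip: ennreal_mult)
  qed
  define C where "C = c3 / (c1 * e)"
  have C: "0 < C" using c by (simp add: C_def e_def)
  have rel: "p s x y \<le> ennreal q * p T x y"
    if s: "T \<le> s" and D: "x \<in> D" "y \<in> D" and q: "C * V x (\<Phi>i T) / V x (\<Phi>i s) \<le> q" for s x y q
  proof -
    have v: "0 < V x (\<Phi>i s)" "0 < V x (\<Phi>i T)" using s T by (auto intro!: V\<Phi>i_pos)
    have q0: "0 \<le> q" using q v C by (meson divide_nonneg_pos less_imp_le mult_nonneg_nonneg order_trans)
    have "c3 * h T x y / V x (\<Phi>i s) = (C * V x (\<Phi>i T) / V x (\<Phi>i s)) * (c1 * h T x y * e / V x (\<Phi>i T))"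
      using v c by (simp add: C_def e_def)
    also have "\<dots> \<le> q * (c1 * h T x y * e / V x (\<Phi>i T))"
      using q v c h_nonneg[OF T D] by (intro mult_right_mono) (auto simp: e_def)
    finally have le: "c3 * h T x y / V x (\<Phi>i s) \<le> q * (c1 * h T x y * e / V x (\<Phi>i T))" .
    have "p s x y \<le> ennreal (c3 * h T x y / V x (\<Phi>i s))" by (rule up[OF s D])
    also have "\<dots> \<le> ennreal (q * (c1 * h T x y * e / V x (\<Phi>i T)))" by (rule ennreal_leI[OF le])
    also have "\<dots> = ennreal q * ennreal (c1 * h T x y * e / V x (\<Phi>i T))"
      using q0 v c h_nonneg[OF T D] by (intro ennreal_mult) (auto simp: e_def)
    also have "\<dots> \<le> ennreal q * p T x y" by (intro mult_left_mono lo D) auto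
    finally show ?thesis .
  qed
  \<comment> \<open>the factor by which the radius has to grow for the volume to gain the factor \<open>2 * C\<close>\<close>
  define a where "a = max 1 ((2 * C * CL) powr (1 / d1))"
  have a: "1 \<le> a" by (simp add: a_def)
  have "2 * C * CL = ((2 * C * CL) powr (1 / d1)) powr d1" using C growth by (simp add: powr_powr)
  also have "\<dots> \<le> a powr d1" unfolding a_def using growth by (intro powr_mono2) auto
  finally have a2: "2 * C \<le> a powr d1 / CL" using growth by (simp add: pos_le_divide_eq)
  define S where "S = max (T + 1) (\<Phi> (a * \<Phi>i T))"
  have S: "T < S" by (simp add: S_def)
  have "a * \<Phi>i T \<le> \<Phi>i S" by (intro scale_inv_ge[OF \<Phi>]) (simp add: S_def)
  hence VS: "2 * C * V x (\<Phi>i T) \<le> V x (\<Phi>i S)" for x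
  proof -
    have u: "0 < \<Phi>i T" using \<Phi>i_pos[OF T] .
    have "2 * C * V x (\<Phi>i T) \<le> a powr d1 / CL * V x (\<Phi>i T)" using a2 by (intro mult_right_mono) (auto simp: vol_nonneg)
    also have "\<dots> = ((a * \<Phi>i T) / \<Phi>i T) powr d1 / CL * V x (\<Phi>i T)" using u by simp
    also have "\<dots> \<le> V x (a * \<Phi>i T)" using u a by (intro growth(3)) auto
    also have "\<dots> \<le> V x (\<Phi>i S)" by (rule vol_mono[OF radon]) fact
    finally show ?thesis .
  qed
  have half: "p S x y \<le> ennreal (1 / 2) * p T x y" if D: "x \<in> D" "y \<in> D" for x y
  proof (rule rel[OF less_imp_le[OF S] D])
    have "0 < V x (\<Phi>i S)" using S T by (intro V\<Phi>i_pos) auto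
    thus "C * V x (\<Phi>i T) / V x (\<Phi>i S) \<le> 1 / 2" using VS[of x] by (simp add: pos_divide_le_eq)
  qed
  have dom: "p s x y \<le> ennreal C * p T x y" if s: "T \<le> s" and D: "x \<in> D" "y \<in> D" for s x y
  proof (rule rel[OF s D])
    have "0 < V x (\<Phi>i s)" using s T by (intro V\<Phi>i_pos) auto
    moreover have "C * V x (\<Phi>i T) \<le> C * V x (\<Phi>i s)" using C V\<Phi>i_mono[OF s] by (intro mult_left_mono) auto
    ultimately show "C * V x (\<Phi>i T) / V x (\<Phi>i s) \<le> C" by (simp add: pos_divide_le_eq)
  qed
  obtain \<kappa> B where \<kappa>: "0 < \<kappa>" "0 < B"
    and dec: "\<And>s x y. T \<le> s \<Longrightarrow> x \<in> D \<Longrightarrow> y \<in> D \<Longrightarrow> p s x y \<le> ennreal (B * exp (- \<kappa> * s)) * p T x y"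
    using semigroup_exponential_decay[where p = p and m = m, OF CK meas T S half C dom] by blast
  have "p s x y \<le> ennreal (B * c3 / v1 * exp (- \<kappa> * s) * h T x y)" if s: "T \<le> s" and D: "x \<in> D" "y \<in> D" for s x y
  proof -
    have h0: "0 \<le> h T x y" using h_nonneg[OF T D] .
    have "p s x y \<le> ennreal (B * exp (- \<kappa> * s)) * p T x y" by (rule dec[OF s D])
    also have "\<dots> \<le> ennreal (B * exp (- \<kappa> * s)) * ennreal (c3 * h T x y / v1)"
    proof (intro mult_left_mono)
      have "p T x y \<le> ennreal (c3 * h T x y / V x (\<Phi>i T))" by (rule up[OF order_refl D])
      also have "\<dots> \<le> ennreal (c3 * h T x y / v1)"
        using v1(1) v1(2)[OF D(1)] c h0 by (intro ennreal_leI divide_left_mono) (auto simp: T_def)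
      finally show "p T x y \<le> ennreal (c3 * h T x y / v1)" .
    qed simp
    also have "\<dots> = ennreal (B * c3 / v1 * exp (- \<kappa> * s) * h T x y)"
      using \<kappa> c v1 h0 by (subst ennreal_mult[symmetric]) (auto simp: mult_ac)
    finally show ?thesis .
  qed
  moreover have "0 < B * c3 / v1" using \<kappa> c v1 by simp
  ultimately show ?thesis using \<kappa>(1) unfolding T_def[symmetric] by blast
qed

text \<open>
  On a bounded domain, at times between two positive constants, all volumes and exponential factors are
  comparable to constants, and \<open>h t x y\<close> is comparable to \<open>h 1 x y\<close>. Hence the short-time and the
  long-time bounds can be glued at any time of that range; the horizon may lie on either side of \<open>1\<close>.
\<close>

lemma bounded_kernel_extension:
  fixes p :: "real \<Rightarrow> 'a \<Rightarrow> 'a \<Rightarrow> ennreal"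
  assumes bdd: "bounded D" and diam: "0 < diameter D"
    and vu: "\<And>r. 0 < r \<Longrightarrow> \<exists>v1>0. \<exists>v2>0. \<forall>x\<in>D. v1 \<le> V x r \<and> V x r \<le> v2"
    and short: "kernel_bounds m \<Phi> \<Psi> D h C0 p {0<..1}"
    and long: "0 < \<kappa>" "0 < b1" "0 < b2"
       "\<And>t x y. 1 \<le> t \<Longrightarrow> x \<in> D \<Longrightarrow> y \<in> D \<Longrightarrow>
        ennreal (b1 * (exp (- \<kappa> * t) * h 1 x y)) \<le> p t x y \<and> p t x y \<le> ennreal (b2 * (exp (- \<kappa> * t) * h 1 x y))"
  shows "kernel_bounds m \<Phi> \<Psi> D h C0 p {s. 0 < s \<and> ereal s < horizon}" (is ?near)
    and "\<exists>\<kappa>>0. \<exists>B>0. \<forall>s\<ge>end_time. \<forall>x\<in>D. \<forall>y\<in>D.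
           p s x y \<le> ennreal (B * exp (- \<kappa> * s) * h end_time x y)" (is ?far)
proof -
  define T where "T = end_time"
  have T: "0 < T" using \<Phi>_pos[OF diam] by (simp add: T_def)
  have hz: "horizon = ereal T" using bdd by (simp add: horizon_bounded T_def)
  obtain c1 c2 c3 c4 where c: "0 < c1" "0 < c2" "0 < c3" "0 < c4"
    and lo: "\<And>t x y. 0 < t \<Longrightarrow> t \<le> 1 \<Longrightarrow> x \<in> D \<Longrightarrow> y \<in> D \<Longrightarrow> ennreal (c1 * h t x y) * profile c2 t x y \<le> p t x y"
    and up: "\<And>t x y. 0 < t \<Longrightarrow> t \<le> 1 \<Longrightarrow> x \<in> D \<Longrightarrow> y \<in> D \<Longrightarrow> p t x y \<le> ennreal (c3 * h t x y) * profile c4 t x y"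
    using short unfolding kernel_bounds_def by (metis greaterThanAtMost_iff)
  obtain v1 where v1: "0 < v1" "\<And>x. x \<in> D \<Longrightarrow> v1 \<le> V x (\<Phi>i 1)" using vu[OF \<Phi>i_pos[of 1]] by auto
  obtain w1 w2 where w: "0 < w1" "0 < w2" "\<And>x. x \<in> D \<Longrightarrow> w1 \<le> V x (\<Phi>i T) \<and> V x (\<Phi>i T) \<le> w2"
    using vu[OF \<Phi>i_pos[OF T]] by blast
  have h1: "0 \<le> h 1 x y" if "x \<in> D" "y \<in> D" for x y using h_nonneg[of 1] that by simp
  define e where "e = exp (- (c4 * (diameter D)\<^sup>2 / (\<Phi>i 1)\<^sup>2))"
  define a1 where "a1 = min c1 (b1 * exp (- \<kappa> * T) * v1)"
  define a3 where "a3 = max c3 (b2 * (ch * T powr \<gamma>) * w2 / e)"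
  have a: "0 < a1" "0 < a3" using c long v1 by (auto simp: a1_def a3_def)
  have main: "ennreal (a1 * h t x y) * profile c2 t x y \<le> p t x y \<and>
       p t x y \<le> ennreal (a3 * h t x y) * profile c4 t x y"
    if t: "0 < t" "t < T" and D: "x \<in> D" "y \<in> D" for t x y
  proof (cases "t \<le> 1")
    case True
    have h0: "0 \<le> h t x y" using h_nonneg[OF t(1) D] .
    have "ennreal (a1 * h t x y) * profile c2 t x y \<le> ennreal (c1 * h t x y) * profile c2 t x y"
      using h0 by (intro mult_right_mono ennreal_leI) (auto simp: a1_def)
    moreover have "ennreal (c3 * h t x y) * profile c4 t x y \<le> ennreal (a3 * h t x y) * profile c4 t x y"
      using h0 by (intro mult_right_mono ennreal_leI) (auto simp: a3_def)
    ultimately show ?thesis using lo[OF t(1) True D] up[OF t(1) True D] by (meson order_trans)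
  next
    case False
    hence t1: "1 \<le> t" by simp
    have h0: "0 \<le> h t x y" using h_nonneg[OF t(1) D] .
    have v: "0 < V x (\<Phi>i t)" using V\<Phi>i_pos[OF t(1)] .
    have ht: "h t x y \<le> h 1 x y" using h_anti[OF D _ t1] by simp
    have "ennreal (a1 * h t x y) * profile c2 t x y \<le> ennreal (a1 * h t x y) * ennreal (1 / v1)"
    proof (intro mult_left_mono)
      have "v1 \<le> V x (\<Phi>i t)" using v1(2)[OF D(1)] V\<Phi>i_mono[OF t1, of x] by simp
      hence "ennreal (1 / V x (\<Phi>i t)) \<le> ennreal (1 / v1)" using v1 by (intro ennreal_leI frac_le) auto
      thus "profile c2 t x y \<le> ennreal (1 / v1)"
        using kernel_profile_le[OF t(1)] order_trans by blast
    qed simp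
    also have "\<dots> = ennreal (a1 / v1 * h t x y)" using a v1 h0 by (simp flip: ennreal_mult)
    also have "\<dots> \<le> ennreal (b1 * exp (- \<kappa> * t) * h 1 x y)"
    proof (intro ennreal_leI mult_mono)
      have "a1 / v1 \<le> b1 * exp (- \<kappa> * T)" using v1 by (simp add: pos_divide_le_eq a1_def)
      also have "\<dots> \<le> b1 * exp (- \<kappa> * t)" using long t by (intro mult_left_mono) auto
      finally show "a1 / v1 \<le> b1 * exp (- \<kappa> * t)" .
    qed (use ht h0 long in auto)
    also have "\<dots> \<le> p t x y" using long(4)[OF t1 D] by (simp add: mult.assoc)
    finally have L: "ennreal (a1 * h t x y) * profile c2 t x y \<le> p t x y" .
    have "p t x y \<le> ennreal (b2 * (exp (- \<kappa> * t) * h 1 x y))" using long(4)[OF t1 D] by simp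
    also have "\<dots> \<le> ennreal (b2 * (1 * (ch * T powr \<gamma> * h t x y)))"
    proof (intro ennreal_leI mult_left_mono mult_mono)
      have "h 1 x y \<le> ch * (t / 1) powr \<gamma> * h t x y" using t t1 hz D by (intro h_ratio) auto
      also have "\<dots> \<le> ch * T powr \<gamma> * h t x y"
        using t ch \<gamma> h0 by (intro mult_right_mono mult_left_mono powr_mono2) auto
      finally show "h 1 x y \<le> ch * T powr \<gamma> * h t x y" .
    qed (use long t h1[OF D] in auto)
    also have "\<dots> = ennreal (b2 * (ch * T powr \<gamma>) * w2 / e * h t x y * (e / w2))"
      using w by (simp add: e_def mult_ac)
    also have "\<dots> \<le> ennreal (a3 * h t x y * (e / w2))"
      using h0 w by (intro ennreal_leI mult_right_mono) (auto simp: a3_def e_def)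
    also have "\<dots> = ennreal (a3 * h t x y) * ennreal (e / w2)"
      using a h0 w by (intro ennreal_mult) (auto simp: e_def)
    also have "\<dots> \<le> ennreal (a3 * h t x y) * profile c4 t x y"
    proof (intro mult_left_mono)
      have u: "0 < \<Phi>i 1" "\<Phi>i 1 \<le> \<Phi>i t" using \<Phi>i_pos[of 1] scale_inv_mono[OF \<Phi> t1] by auto
      have "(dist x y)\<^sup>2 / (\<Phi>i t)\<^sup>2 \<le> (diameter D)\<^sup>2 / (\<Phi>i 1)\<^sup>2"
        using u dist_le_diameter[OF D bdd] by (intro frac_le power_mono) auto
      hence "c4 * ((dist x y)\<^sup>2 / (\<Phi>i t)\<^sup>2) \<le> c4 * ((diameter D)\<^sup>2 / (\<Phi>i 1)\<^sup>2)"
        using c by (intro mult_left_mono) auto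
      hence "e \<le> exp (- (c4 * (dist x y)\<^sup>2 / (\<Phi>i t)\<^sup>2))" by (simp add: e_def)
      moreover have "V x (\<Phi>i t) \<le> w2" using w(3)[OF D(1)] V\<Phi>i_mono[OF less_imp_le[OF t(2)], of x] by simp
      ultimately have "e / w2 \<le> exp (- (c4 * (dist x y)\<^sup>2 / (\<Phi>i t)\<^sup>2)) / V x (\<Phi>i t)"
        using v by (intro frac_le) (auto simp: e_def)
      thus "ennreal (e / w2) \<le> profile c4 t x y"
        using kernel_profile_ge[OF t(1) c(4)] ennreal_leI order_trans by blast
    qed simp
    finally show ?thesis using L by blast
  qed
  show ?near
    unfolding kernel_bounds_def hz
  proof (rule exI[of _ a1], rule conjI[OF a(1)], rule exI[of _ c2], rule conjI[OF c(2)],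
      rule exI[of _ a3], rule conjI[OF a(2)], rule exI[of _ c4], rule conjI[OF c(4)], intro ballI)
    fix t x y
    assume "t \<in> {s. 0 < s \<and> ereal s < ereal T}" and D: "x \<in> D" "y \<in> D"
    hence t: "0 < t" "t < T" by auto
    show "ennreal (a1 * h t x y) * profile c2 t x y \<le> p t x y \<and>
       p t x y \<le> ennreal (a3 * h t x y) * profile c4 t x y"
      by (rule main[OF t D])
  qed
  define K where "K = max 1 (ch * T powr \<gamma>)"
  define B where "B = max (b2 * K) (c3 / w1 * exp \<kappa>)"
  have "p s x y \<le> ennreal (B * exp (- \<kappa> * s) * h T x y)" if s: "T \<le> s" and D: "x \<in> D" "y \<in> D" for s x y
  proof (cases "1 \<le> s")
    case True
    have hT: "0 \<le> h T x y" using h_nonneg[OF T D] .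
    have "h 1 x y \<le> K * h T x y"
    proof (cases "T \<le> 1")
      case True
      have "h 1 x y \<le> 1 * h T x y" using h_anti[OF D T True] by simp
      also have "\<dots> \<le> K * h T x y" using hT by (intro mult_right_mono) (auto simp: K_def)
      finally show ?thesis .
    next
      case False
      have "h 1 x y \<le> ch * (T / 1) powr \<gamma> * h T x y" using False hz D by (intro h_ratio) auto
      also have "\<dots> \<le> K * h T x y" using hT by (intro mult_right_mono) (auto simp: K_def)
      finally show ?thesis .
    qed
    hence "b2 * (exp (- \<kappa> * s) * h 1 x y) \<le> b2 * (exp (- \<kappa> * s) * (K * h T x y))"
      using long by (intro mult_left_mono) auto
    also have "\<dots> = b2 * K * (exp (- \<kappa> * s) * h T x y)" by (simp add: mult_ac)
    also have "\<dots> \<le> B * (exp (- \<kappa> * s) * h T x y)" using hT by (intro mult_right_mono) (auto simp: B_def)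
    finally have "ennreal (b2 * (exp (- \<kappa> * s) * h 1 x y)) \<le> ennreal (B * exp (- \<kappa> * s) * h T x y)"
      by (intro ennreal_leI) (simp add: mult.assoc)
    thus ?thesis using long(4)[OF True D] order_trans by blast
  next
    case False
    hence s1: "s \<le> 1" by simp
    have s0: "0 < s" using s T by simp
    have hT: "0 \<le> h T x y" using h_nonneg[OF T D] .
    have vs: "w1 \<le> V x (\<Phi>i s)" using w(3)[OF D(1)] V\<Phi>i_mono[OF s, of x] by simp
    have "p s x y \<le> ennreal (c3 * h s x y) * profile c4 s x y" by (rule up[OF s0 s1 D])
    also have "\<dots> \<le> ennreal (c3 * h T x y) * ennreal (1 / w1)"
    proof (intro mult_mono ennreal_leI)
      have "ennreal (1 / V x (\<Phi>i s)) \<le> ennreal (1 / w1)" using vs w by (intro ennreal_leI frac_le) auto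
      thus "profile c4 s x y \<le> ennreal (1 / w1)" using kernel_profile_le[OF s0] order_trans by blast
    qed (use h_anti[OF D T s] h_nonneg[OF s0 D] c in auto)
    also have "\<dots> = ennreal (c3 / w1 * 1 * h T x y)" using c w hT by (simp flip: ennreal_mult)
    also have "\<dots> \<le> ennreal (B * exp (- \<kappa> * s) * h T x y)"
    proof (intro ennreal_leI mult_right_mono hT)
      have "c3 / w1 * 1 \<le> c3 / w1 * (exp \<kappa> * exp (- \<kappa> * s))"
        using c w s1 long by (intro mult_left_mono) (auto simp: mult_exp_exp)
      also have "\<dots> = c3 / w1 * exp \<kappa> * exp (- \<kappa> * s)" by simp
      also have "\<dots> \<le> B * exp (- \<kappa> * s)" by (intro mult_right_mono) (auto simp: B_def)
      finally show "c3 / w1 * 1 \<le> B * exp (- \<kappa> * s)" .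
    qed
    finally show ?thesis .
  qed
  moreover have "0 < B" using long by (simp add: B_def K_def less_max_iff_disj)
  ultimately show ?far using long(1) unfolding T_def[symmetric] by blast
qed

end

section \<open>The Green function estimate\<close>

lemma heat_kernel_measurable_time:
  fixes D :: "'a::{heine_borel, second_countable_topology} set"
  assumes hk: "heat_kernel D m W P Y p" and D: "x \<in> D" "y \<in> D"
  shows "(\<lambda>s. p s x y * indicator {0<..} s) \<in> borel_measurable borel"
proof -
  have p: "(\<lambda>(t, x, y). p t x y) \<in> borel_measurable (restrict_space borel ({0<..} \<times> D \<times> D))"
    using hk by (simp add: heat_kernel_def)
  have "(\<lambda>s::real. (s, x, y)) \<in> borel_measurable borel"
    by (intro borel_measurable_continuous_onI continuous_intros)
  from measurable_restrict_space1[OF this]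
  have "(\<lambda>s::real. (s, x, y)) \<in> restrict_space borel {0<..} \<rightarrow>\<^sub>M restrict_space borel ({0<..} \<times> D \<times> D)"
    by (rule measurable_restrict_space2[rotated]) (use D in \<open>auto simp: space_restrict_space\<close>)
  from measurable_compose[OF this p]
  have "(\<lambda>s. p s x y) \<in> borel_measurable (restrict_space borel {0<..})" by simp
  thus ?thesis by (subst (asm) borel_measurable_restrict_space_iff_ennreal) auto
qed

lemma heat_kernel_measurable_space:
  fixes D :: "'a::{heine_borel, second_countable_topology} set"
  assumes hk: "heat_kernel D m W P Y p" and m: "sets m = sets borel" and "open D"
    and D: "x \<in> D" "y \<in> D" and t: "0 < s" "0 < t"
  shows "(\<lambda>z. p s x z * p t z y * indicator D z) \<in> borel_measurable m"
proof -
  have p: "(\<lambda>(t, x, y). p t x y) \<in> borel_measurable (restrict_space borel ({0<..} \<times> D \<times> D))"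
    using hk by (simp add: heat_kernel_def)
  have "(\<lambda>z. (s, x, z)) \<in> borel_measurable borel"
    by (intro borel_measurable_continuous_onI continuous_intros)
  from measurable_restrict_space1[OF this]
  have m1: "(\<lambda>z. (s, x, z)) \<in> restrict_space borel D \<rightarrow>\<^sub>M restrict_space borel ({0<..} \<times> D \<times> D)"
    by (rule measurable_restrict_space2[rotated]) (use D t in \<open>auto simp: space_restrict_space\<close>)
  have "(\<lambda>z. (t, z, y)) \<in> borel_measurable borel"
    by (intro borel_measurable_continuous_onI continuous_intros)
  from measurable_restrict_space1[OF this]
  have m2: "(\<lambda>z. (t, z, y)) \<in> restrict_space borel D \<rightarrow>\<^sub>M restrict_space borel ({0<..} \<times> D \<times> D)"
    by (rule measurable_restrict_space2[rotated]) (use D t in \<open>auto simp: space_restrict_space\<close>)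
  from measurable_compose[OF m1 p] measurable_compose[OF m2 p]
  have [measurable]: "(\<lambda>z. p s x z) \<in> borel_measurable (restrict_space borel D)"
    "(\<lambda>z. p t z y) \<in> borel_measurable (restrict_space borel D)" by simp_all
  have "(\<lambda>z. p s x z * p t z y) \<in> borel_measurable (restrict_space borel D)" by measurable
  hence "(\<lambda>z. p s x z * p t z y * indicator D z) \<in> borel_measurable borel"
    using \<open>open D\<close> by (subst (asm) borel_measurable_restrict_space_iff_ennreal) auto
  thus ?thesis using m by (simp cong: measurable_cong_sets)
qed

lemma kernel_bounds_subset:
  "kernel_bounds m \<Phi> \<Psi> D h C0 p T \<Longrightarrow> T' \<subseteq> T \<Longrightarrow> kernel_bounds m \<Phi> \<Psi> D h C0 p T'"
  unfolding kernel_bounds_def by (elim exE conjE) (intro exI conjI, assumption+, blast)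

theorem proposition5p3:
  fixes m :: "'a::{heine_borel, second_countable_topology} measure"
    and D :: "'a set"
    and R_E R\<^sub>1 :: ereal
    and d1 d2 C0 :: real
    and M :: "'v measure"
    and S :: "real \<Rightarrow> 'v \<Rightarrow> real"
    and \<nu> :: "real measure"
    and W :: "'w measure"
    and P :: "'a option \<Rightarrow> 'w measure"
    and Y :: "real \<Rightarrow> 'w \<Rightarrow> 'a option"
    and p :: "real \<Rightarrow> 'a \<Rightarrow> 'a \<Rightarrow> ennreal"
    and \<Phi> \<Psi> :: "real \<Rightarrow> real"
    and h :: "real \<Rightarrow> 'a \<Rightarrow> 'a \<Rightarrow> real"
  assumes "radon_measure m" and "full_support m" and "volume_growth m R_E d1 d2"
    and "open D" and "D \<noteq> UNIV"
    and "driftless_subordinator M S \<nu>"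
    and "hunt_process D W P Y" and "heat_kernel D m W P Y p"
    and "scale_function \<Phi>" and "scale_function \<Psi>" and "\<And>r. 0 \<le> r \<Longrightarrow> \<Phi> r \<le> \<Psi> r"
    and "boundary_function \<Phi> D h"
    and "C0 \<in> {0, 1}"
    and "(0 < R\<^sub>1 \<and> Poly_cond \<nu> R\<^sub>1 \<and> HK_B m \<Phi> \<Psi> D h C0 p \<and> scale_diam \<Phi> D < R\<^sub>1 / 8) \<or>
         (Poly_cond \<nu> \<infinity> \<and> HK_U m R_E \<Phi> \<Psi> D h C0 p)"
  shows "\<exists>c1>0. \<exists>c2>0. \<forall>x\<in>D. \<forall>y\<in>D. x \<noteq> y \<longrightarrow>
    ennreal c1 * green_profile m (laplace_exponent M S) \<Phi> \<Psi> D h C0 x y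
      \<le> green_function (subordinate_kernel M S p) x y \<and>
    green_function (subordinate_kernel M S p) x y
      \<le> ennreal c2 * green_profile m (laplace_exponent M S) \<Phi> \<Psi> D h C0 x y"
proof (cases "\<exists>x\<in>D. \<exists>y\<in>D. x \<noteq> y")
  case False
  moreover have "(0::real) < 1" by simp
  ultimately show ?thesis by blast
next
  case True
  note drift = assms(6) and hk = assms(8)
  have sub: "subordinator M S" using drift by (simp add: driftless_subordinator_def)
  have sets_m: "sets m = sets borel" using assms(1) by (simp add: radon_measure_def)
  define R where "R = (if HK_U m R_E \<Phi> \<Psi> D h C0 p \<and> Poly_cond \<nu> \<infinity> then \<infinity> else R\<^sub>1)"
  have poly: "Poly_cond \<nu> R" and R: "0 < R"
    and cases: "HK_B m \<Phi> \<Psi> D h C0 p \<and> scale_diam \<Phi> D < R / 8 \<or> HK_U m R_E \<Phi> \<Psi> D h C0 p \<and> R = \<infinity>"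
    using assms(14) by (auto simp: R_def)
  have bdRE: "bounded D \<or> R_E = \<infinity>" using cases by (auto simp: HK_B_def HK_U_def)
  interpret potential_estimates "potential_measure M S" "laplace_exponent M S"
    by (rule potential_estimates_subordinator[OF drift poly R])
  obtain c \<beta> where "0 < c" "0 < \<beta>" and scal: "\<forall>r R'. 0 < r \<and> r \<le> R' \<and> ereal R' < R \<longrightarrow>
     c * (R' / r) powr \<beta> * laplace_exponent M S (1 / R') \<le> laplace_exponent M S (1 / r)"
    using laplace_exponent_scaling[OF drift poly] by (elim exE conjE)
  then obtain A where A: "1 < A" and ann: "\<And>r. 0 < r \<Longrightarrow> ereal r < R \<Longrightarrow>
      ennreal (1 / (16 * laplace_exponent M S (1 / r))) \<le> emeasure (potential_measure M S) {r / A<..r}"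
    using potential_annulus[of c \<beta> R] by blast
  obtain ch \<gamma> where ch: "0 < ch" "0 \<le> \<gamma>" and hd: "\<forall>s t. 0 < s \<and> s \<le> t \<and> ereal t < 4 * scale_diam \<Phi> D + 1 \<longrightarrow>
        (\<forall>x\<in>D. \<forall>y\<in>D. s powr \<gamma> * h s x y \<le> ch * (t powr \<gamma> * h t x y))"
    using assms(12) unfolding boundary_function_def by (elim exE conjE)
  have d: "0 < d2" using assms(3) by (auto simp: volume_growth_def)
  obtain CV where CV: "1 \<le> CV" and dbl: "\<forall>x r R. 0 < r \<and> r \<le> R \<and> (bounded D \<longrightarrow> R \<le> scale_inv \<Phi> (2 * \<Phi> (diameter D))) \<longrightarrow>
       vol m x R \<le> CV * (R / r) powr d2 * vol m x r"
    using vol_doubling[OF assms(1-3) bdRE, of "scale_inv \<Phi> (2 * \<Phi> (diameter D))"] by (elim exE conjE)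
  interpret green_setting m \<Phi> \<Psi> D h C0 CV d2 ch \<gamma> "potential_measure M S" "laplace_exponent M S"
  proof
    show "0 \<le> h s x y" if "0 < s" "x \<in> D" "y \<in> D" for s x y
      using assms(12) that by (auto simp: boundary_function_def)
    show "h t x y \<le> h s x y" if "x \<in> D" "y \<in> D" "0 < s" "s \<le> t" for s t x y
      using assms(12) that by (auto simp: boundary_function_def)
    show "s powr \<gamma> * h s x y \<le> ch * (t powr \<gamma> * h t x y)"
      if "0 < s" "s \<le> t" "ereal t < 4 * scale_diam \<Phi> D + 1" "x \<in> D" "y \<in> D" for s t x y
      using that by (intro hd[rule_format] conjI)
    show "vol m x R' \<le> CV * (R' / r) powr d2 * vol m x r"
      if "0 < r" "r \<le> R'" "bounded D \<Longrightarrow> R' \<le> scale_inv \<Phi> (2 * \<Phi> (diameter D))" for x r R'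
      using that by (intro dbl[rule_format] conjI impI)
  qed (use assms ch CV d in auto)
  let ?G = "\<lambda>x y. \<integral>\<^sup>+s. p s x y * indicator {0<..} s \<partial>potential_measure M S"
  let ?far = "\<exists>\<kappa>>0. \<exists>B>0. \<forall>s\<ge>end_time. \<forall>x\<in>D. \<forall>y\<in>D.
           p s x y \<le> ennreal (B * exp (- \<kappa> * s) * h end_time x y)"
  have meas: "(\<lambda>s. p s x y * indicator {0<..} s) \<in> borel_measurable borel" if "x \<in> D" "y \<in> D" for x y
    by (rule heat_kernel_measurable_time[OF hk that])
  have CK: "p (s + t) x y = (\<integral>\<^sup>+z. p s x z * p t z y * indicator D z \<partial>m)"
    if "0 < s" "0 < t" "x \<in> D" "y \<in> D" for s t x y
    using hk that unfolding heat_kernel_def by blast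
  have diam: "0 < diameter D" if "bounded D"
  proof -
    obtain x y where "x \<in> D" "y \<in> D" "x \<noteq> y" using True by blast
    thus ?thesis using dist_le_diameter[of x y] that by (metis zero_less_dist_iff less_le_trans)
  qed
  have vu: "\<exists>v1>0. \<exists>v2>0. \<forall>x\<in>D. v1 \<le> V x r \<and> V x r \<le> v2" if "bounded D" "0 < r" for r
    by (rule vol_uniform[OF assms(1-3) that])
  have "kernel_bounds m \<Phi> \<Psi> D h C0 p before_horizon \<and> (bounded D \<longrightarrow>
      ?far)"
    using cases
  proof (elim disjE conjE)
    assume HKB: "HK_B m \<Phi> \<Psi> D h C0 p"
    hence bdd: "bounded D" and short: "kernel_bounds m \<Phi> \<Psi> D h C0 p {0<..1}" by (auto simp: HK_B_def)
    obtain \<kappa> b1 b2 where b: "0 < \<kappa>" "0 < b1" "0 < b2" and "\<forall>t\<ge>1. \<forall>x\<in>D. \<forall>y\<in>D.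
        ennreal (b1 * (exp (- \<kappa> * t) * h 1 x y)) \<le> p t x y \<and> p t x y \<le> ennreal (b2 * (exp (- \<kappa> * t) * h 1 x y))"
      using HKB unfolding HK_B_def by (elim exE conjE)
    hence long: "ennreal (b1 * (exp (- \<kappa> * t) * h 1 x y)) \<le> p t x y \<and> p t x y \<le> ennreal (b2 * (exp (- \<kappa> * t) * h 1 x y))"
      if "1 \<le> t" "x \<in> D" "y \<in> D" for t x y using that by blast
    note ext = bounded_kernel_extension[OF bdd diam[OF bdd] vu[OF bdd] short b long]
    show ?thesis using ext(1) ext(2) by blast
  next
    assume HKU: "HK_U m R_E \<Phi> \<Psi> D h C0 p"
    hence RE: "R_E = \<infinity>" and kb: "kernel_bounds m \<Phi> \<Psi> D h C0 p {0<..}" by (auto simp: HK_U_def)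
    have "kernel_bounds m \<Phi> \<Psi> D h C0 p before_horizon" by (rule kernel_bounds_subset[OF kb]) auto
    moreover have ?far if bdd: "bounded D"
    proof -
      obtain CL where CL: "0 < CL" and grow: "\<forall>x r R. 0 < r \<and> r \<le> R \<longrightarrow> (R / r) powr d1 / CL * vol m x r \<le> vol m x R"
        using volume_growth_lower[OF assms(1,2)] assms(3) RE by blast
      obtain v1 where v1: "0 < v1" "\<And>x. x \<in> D \<Longrightarrow> v1 \<le> V x (\<Phi>i end_time)"
        using vu[OF bdd \<Phi>i_pos, of "end_time"] \<Phi>_pos[OF diam[OF bdd]] by auto
      obtain c1 c2 c3 c4 where c: "0 < c1" "0 < c2" "0 < c3" "0 < c4"
        and kb': "\<forall>t\<in>{0<..}. \<forall>x\<in>D. \<forall>y\<in>D. ennreal (c1 * h t x y) * profile c2 t x y \<le> p t x y \<and>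
          p t x y \<le> ennreal (c3 * h t x y) * profile c4 t x y"
        using kb unfolding kernel_bounds_def by (elim exE conjE)
      show ?thesis
      proof (rule global_bounds_imp_decay[OF CK _ bdd diam[OF bdd] _ CL _ v1 c])
        show "0 < d1" using assms(3) by (simp add: volume_growth_def)
        show "(\<lambda>z. p s x z * p t z y * indicator D z) \<in> borel_measurable m"
          if "0 < s" "0 < t" "x \<in> D" "y \<in> D" for s t x y
          by (rule heat_kernel_measurable_space[OF hk sets_m assms(4) that(3,4,1,2)])
        show "(R / r) powr d1 / CL * V x r \<le> V x R" if "0 < r" "r \<le> R" for x r R
          using grow that by blast
        show "ennreal (c1 * h t x y) * profile c2 t x y \<le> p t x y"
          "p t x y \<le> ennreal (c3 * h t x y) * profile c4 t x y"
          if "0 < t" "x \<in> D" "y \<in> D" for t x y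
          using kb' that by auto
      qed
    qed
    ultimately show ?thesis by blast
  qed
  hence near: "kernel_bounds m \<Phi> \<Psi> D h C0 p before_horizon" and far: "bounded D \<Longrightarrow>
      ?far"
    by blast+
  obtain c1 c2 c3 c4 where c: "0 < c1" "0 < c2" "0 < c3" "0 < c4"
    and nb: "\<forall>t\<in>before_horizon. \<forall>x\<in>D. \<forall>y\<in>D. ennreal (c1 * h t x y) * profile c2 t x y \<le> p t x y \<and>
          p t x y \<le> ennreal (c3 * h t x y) * profile c4 t x y"
    using near unfolding kernel_bounds_def by (elim exE conjE)
  have hR: "ereal r < R" if "0 < r" "ereal r < horizon" for r
    using cases
  proof (elim disjE conjE)
    assume "HK_B m \<Phi> \<Psi> D h C0 p" and lt: "scale_diam \<Phi> D < R / 8"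
    hence "bounded D" by (simp add: HK_B_def)
    hence "r < end_time" "ereal (\<Phi> (diameter D)) < R / 8"
      using that(2) lt by (auto simp: horizon_bounded) (simp add: scale_diam_def)
    moreover have "0 < \<Phi> (diameter D)" using \<Phi>_pos[OF diam] \<open>bounded D\<close> by blast
    ultimately show ?thesis by (cases R) (auto simp: field_simps)
  qed simp
  have lower: "\<exists>a>0. \<forall>x\<in>D. \<forall>y\<in>D. x \<noteq> y \<longrightarrow> ennreal a * green_integral x y \<le>
      ?G x y"
  proof (rule green_lower[OF meas A _ c(1,2)])
    show "ennreal (1 / (16 * laplace_exponent M S (1 / r))) \<le> emeasure (potential_measure M S) {r / A<..r}"
      if "r \<in> before_horizon" for r using that hR by (intro ann) auto
  qed (use nb in blast)+
  have upper: "\<exists>b>0. \<forall>x\<in>D. \<forall>y\<in>D. x \<noteq> y \<longrightarrow>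
      ?G x y \<le> ennreal b * green_integral x y"
  proof (rule green_upper[OF meas c(3,4)])
    show "p s x y \<le> ennreal (c3 * h s x y) * profile c4 s x y"
      if "s \<in> before_horizon" "x \<in> D" "y \<in> D" for s x y using nb that by blast
    assume bdd: "bounded D"
    obtain \<kappa> B where \<kappa>: "0 < \<kappa>" "0 < B" and dec: "\<forall>s\<ge>end_time. \<forall>x\<in>D. \<forall>y\<in>D.
           p s x y \<le> ennreal (B * exp (- \<kappa> * s) * h end_time x y)"
      using far[OF bdd] by (elim exE conjE)
    obtain v2 where v2: "0 < v2" "\<forall>x\<in>D. V x (\<Phi>i end_time) \<le> v2"
      using vu[OF bdd \<Phi>i_pos, of "end_time"] \<Phi>_pos[OF diam[OF bdd]] by auto
    show "\<exists>Cd>0. \<exists>\<kappa>>0. \<exists>v2>0. \<forall>x\<in>D. V x (\<Phi>i end_time) \<le> v2 \<and>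
       (\<forall>y\<in>D. \<forall>s. horizon \<le> ereal s \<longrightarrow> p s x y \<le> ennreal (Cd * exp (- \<kappa> * s) * h end_time x y))"
    proof (rule exI[of _ B], rule conjI[OF \<kappa>(2)], rule exI[of _ \<kappa>], rule conjI[OF \<kappa>(1)],
        rule exI[of _ v2], rule conjI[OF v2(1)], intro ballI conjI allI impI)
      show "V x (\<Phi>i end_time) \<le> v2" if "x \<in> D" for x using v2 that by blast
      show "p s x y \<le> ennreal (B * exp (- \<kappa> * s) * h end_time x y)"
        if "x \<in> D" "y \<in> D" "horizon \<le> ereal s" for s x y
        using dec that by (simp add: horizon_bounded[OF bdd])
    qed
  qed
  obtain a b where ab: "0 < a" "0 < b"
    and lo: "\<forall>x\<in>D. \<forall>y\<in>D. x \<noteq> y \<longrightarrow> ennreal a * green_integral x y \<le> ?G x y"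
    and up: "\<forall>x\<in>D. \<forall>y\<in>D. x \<noteq> y \<longrightarrow> ?G x y \<le> ennreal b * green_integral x y"
    using lower upper by (elim exE conjE)
  show ?thesis
  proof (rule exI[of _ a], rule conjI[OF ab(1)], rule exI[of _ b], rule conjI[OF ab(2)], intro ballI impI)
    fix x y assume xy: "x \<in> D" "y \<in> D" "x \<noteq> y"
    show "ennreal a * green_profile m (laplace_exponent M S) \<Phi> \<Psi> D h C0 x y
      \<le> green_function (subordinate_kernel M S p) x y \<and>
    green_function (subordinate_kernel M S p) x y
      \<le> ennreal b * green_profile m (laplace_exponent M S) \<Phi> \<Psi> D h C0 x y"
      unfolding green_profile_eq[OF xy]
        green_function_eq_potential[where p = p and x = x and y = y, OF sub meas[OF xy(1,2)]]
      using lo[rule_format, OF xy] up[rule_format, OF xy] by (rule conjI)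
  qed
qed

end
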